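(* Let $k$ be a field, $G=\mathrm{GL}_{n,k}$, $B$ a Borel subgroup of $G$, $T$ a maximal split torus in $G$, and $\mathfrak{g}=\mathrm{Lie}\,G$, $\mathfrak{b}=\mathrm{Lie}\,B$. Let $\widetilde{\mathfrak{g}}=\{(A,gB)\mid\mathrm{Ad}(g^{-1})A\in\mathfrak{b}\}\subset\mathfrak{g}\times_kG/B$, and let $\pi_2:\widetilde{\mathfrak{g}}\times_{\mathfrak{g}}\widetilde{\mathfrak{g}}\to\widetilde{\mathfrak{g}}$ be the second projection. Then for every $hB(k)\in(G/B)(k)$, $$\sum_{gB(k)\in(G/B)^T}d\pi_2\bigl(T_{(gB(k),0,hB(k))}(\widetilde{\mathfrak{g}}\times_{\mathfrak{g}}\widetilde{\mathfrak{g}})\bigr)=T_{(0,hB(k))}\widetilde{\mathfrak{g}} .$$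
   Context: $\widetilde{\mathfrak{g}}$ is the Grothendieck simultaneous resolution, a closed subscheme of $\mathfrak{g}\times_kG/B$. $k$-points of $G/B$ are identified with cosets $gB(k)$, $g\in G(k)$. The scheme $\widetilde{\mathfrak{g}}\times_{\mathfrak{g}}\widetilde{\mathfrak{g}}$ is viewed inside $G/B\times\mathfrak{g}\times G/B$, the point $(gB,A,hB)$ corresponding to the pair $((A,gB),(A,hB))$, so $\pi_2(gB,A,hB)=(A,hB)$. $(G/B)^T$ denotes the set of $k$-points of $G/B$ fixed by the group $T(k)$; the paper identifies it with the set of $gB(k)$ such that $T\subset gBg^{-1}$ (in bijection with the Weyl group of $(G,T)$). $T_xX$ is the tangent space of $X$ at $x$. *)

theory Defs
  imports
    "HOL-Analysis.Analysis"
    "HOL-Algebra.Solvable_Groups"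
    "HOL-Algebra.Left_Coset"
    "HOL-Algebra.Algebraic_Closure_Type"
    "HOL-Library.Poly_Mapping"
begin

section \<open>Test rings\<close>

text \<open>
  Tangent spaces are computed on the functor of points: the tangent space of a \<open>k\<close>-scheme \<open>X\<close> at
  \<open>x \<in> X(k)\<close> is the fibre over \<open>x\<close> of \<open>X(k[\<epsilon>]) \<rightarrow> X(k)\<close>, and its linear structure comes from
  \<open>X(k[\<epsilon>1,\<epsilon>2]/(\<epsilon>1,\<epsilon>2)^2) = X(k[\<epsilon>]) \<times>\<^sub>X\<^sub>(\<^sub>k\<^sub>) X(k[\<epsilon>])\<close>.
  \<open>Dual a b\<close> is \<open>a + b\<epsilon>\<close> with \<open>\<epsilon>^2 = 0\<close>.
\<close>

datatype 'k dual = Dual (std: 'k) 'k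

text \<open>\<open>Dual2 a b c\<close> is \<open>a + b\<epsilon>1 + c\<epsilon>2\<close> in \<open>k[\<epsilon>1,\<epsilon>2]/(\<epsilon>1,\<epsilon>2)^2\<close>.\<close>

datatype 'k dual2 = Dual2 'k 'k 'k

instantiation dual :: (comm_ring_1) comm_ring_1
begin
definition "0 = Dual 0 0"
definition "1 = Dual 1 0"
fun plus_dual where "Dual a b + Dual c d = Dual (a + c) (b + d)"
fun minus_dual where "Dual a b - Dual c d = Dual (a - c) (b - d)"
fun uminus_dual where "- Dual a b = Dual (- a) (- b)"
fun times_dual where "Dual a b * Dual c d = Dual (a * c) (a * d + b * c)"
instance
proof
  fix a b c :: "'a dual"
  show "a * b * c = a * (b * c)" by (cases a; cases b; cases c) (simp add: algebra_simps)
  show "a * b = b * a" by (cases a; cases b) (simp add: algebra_simps)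
  show "1 * a = a" by (cases a) (simp add: one_dual_def)
  show "a + b + c = a + (b + c)" by (cases a; cases b; cases c) (simp add: algebra_simps)
  show "a + b = b + a" by (cases a; cases b) (simp add: algebra_simps)
  show "0 + a = a" by (cases a) (simp add: zero_dual_def)
  show "- a + a = 0" by (cases a) (simp add: zero_dual_def)
  show "a - b = a + - b" by (cases a; cases b) simp
  show "(a + b) * c = a * c + b * c" by (cases a; cases b; cases c) (simp add: algebra_simps)
  show "(0 :: 'a dual) \<noteq> 1" by (simp add: zero_dual_def one_dual_def)
qed
end

instantiation dual2 :: (comm_ring_1) comm_ring_1
begin
definition "0 = Dual2 0 0 0"
definition "1 = Dual2 1 0 0"
fun plus_dual2 where "Dual2 a b c + Dual2 a' b' c' = Dual2 (a + a') (b + b') (c + c')"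
fun minus_dual2 where "Dual2 a b c - Dual2 a' b' c' = Dual2 (a - a') (b - b') (c - c')"
fun uminus_dual2 where "- Dual2 a b c = Dual2 (- a) (- b) (- c)"
fun times_dual2 where
  "Dual2 a b c * Dual2 a' b' c' = Dual2 (a * a') (a * b' + b * a') (a * c' + c * a')"
instance
proof
  fix a b c :: "'a dual2"
  show "a * b * c = a * (b * c)" by (cases a; cases b; cases c) (simp add: algebra_simps)
  show "a * b = b * a" by (cases a; cases b) (simp add: algebra_simps)
  show "1 * a = a" by (cases a) (simp add: one_dual2_def)
  show "a + b + c = a + (b + c)" by (cases a; cases b; cases c) (simp add: algebra_simps)
  show "a + b = b + a" by (cases a; cases b) (simp add: algebra_simps)
  show "0 + a = a" by (cases a) (simp add: zero_dual2_def)
  show "- a + a = 0" by (cases a) (simp add: zero_dual2_def)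
  show "a - b = a + - b" by (cases a; cases b) simp
  show "(a + b) * c = a * c + b * c" by (cases a; cases b; cases c) (simp add: algebra_simps)
  show "(0 :: 'a dual2) \<noteq> 1" by (simp add: zero_dual2_def one_dual2_def)
qed
end

definition dual_of :: "'k::comm_ring_1 \<Rightarrow> 'k dual" where
  "dual_of a = Dual a 0"

definition dual2_of :: "'k::comm_ring_1 \<Rightarrow> 'k dual2" where
  "dual2_of a = Dual2 a 0 0"

text \<open>The \<open>k\<close>-algebra homomorphism with \<open>\<epsilon>1 \<mapsto> a\<epsilon>\<close> and \<open>\<epsilon>2 \<mapsto> b\<epsilon>\<close>.\<close>

fun comb :: "'k::comm_ring_1 \<Rightarrow> 'k \<Rightarrow> 'k dual2 \<Rightarrow> 'k dual" where
  "comb a b (Dual2 x y z) = Dual x (a * y + b * z)"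


section \<open>The general linear group and its closed subgroups\<close>

definition GL :: "('r::comm_ring_1^'n::finite^'n) monoid" where
  "GL = \<lparr>carrier = {g. invertible g}, monoid.mult = (**), one = mat 1\<rparr>"

definition Ad :: "'r::comm_ring_1^'n::finite^'n \<Rightarrow> 'r^'n^'n \<Rightarrow> 'r^'n^'n" where
  "Ad g A = g ** A ** inv\<^bsub>GL\<^esub> g"

text \<open>Polynomials in the matrix entries are finitely supported functions on exponent vectors.\<close>

type_synonym ('k, 'n) entry_poly = "('n \<times> 'n \<Rightarrow>\<^sub>0 nat) \<Rightarrow>\<^sub>0 'k"

definition poly_at :: "('k::comm_ring_1 \<Rightarrow> 'r::comm_ring_1) \<Rightarrow> ('k, 'n::finite) entry_poly
    \<Rightarrow> 'r^'n^'n \<Rightarrow> 'r" where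
  "poly_at \<iota> f g =
     (\<Sum>m\<in>Poly_Mapping.keys f. \<iota> (Poly_Mapping.lookup f m) *
        (\<Prod>(i, j)\<in>Poly_Mapping.keys m. (g $ i $ j) ^ Poly_Mapping.lookup m (i, j)))"

text \<open>The Zariski topology on \<open>GL\<^sub>n(K)\<close>, generated by the principal open sets.\<close>

definition zariski :: "('K::field^'n::finite^'n) topology" where
  "zariski = topology_generated_by
     {{g \<in> carrier GL. poly_at id f g \<noteq> 0} | f :: ('K, 'n) entry_poly. True}"

text \<open>
  A geometrically reduced closed subscheme of \<open>GL\<^sub>n\<close> over \<open>k\<close> is given by its set \<open>H\<close> of geometric
  points, subject to the condition that the ideal of \<open>H\<close> over the algebraic closure is generated
  by polynomials over \<open>k\<close>. It is then the closed subscheme of \<open>GL\<^sub>n\<close> cut out by \<open>vanishing to_ac H\<close>.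
\<close>

definition vanishing :: "('k::comm_ring_1 \<Rightarrow> 'K::comm_ring_1) \<Rightarrow> ('K^'n::finite^'n) set
    \<Rightarrow> ('k, 'n) entry_poly set" where
  "vanishing \<iota> H = {f. \<forall>g\<in>H. poly_at \<iota> f g = 0}"

definition defined_over_base :: "('k::field alg_closure^'n::finite^'n) set \<Rightarrow> bool" where
  "defined_over_base H \<longleftrightarrow>
     vanishing id H = module.span (*) (Poly_Mapping.map to_ac ` vanishing to_ac H)"
  \<comment> \<open>The span of a subset of a commutative ring, as a module over itself, is the ideal it generates.\<close>

definition k_subgroup :: "('k::field alg_closure^'n::finite^'n) set \<Rightarrow> bool" where
  "k_subgroup H \<longleftrightarrow> subgroup H GL \<and> closedin zariski H \<and> defined_over_base H"

text \<open>Points with values in a \<open>k\<close>-algebra \<open>R\<close> with structure map \<open>\<iota>\<close>.\<close>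

definition points :: "('k::field \<Rightarrow> 'r::comm_ring_1) \<Rightarrow> ('k alg_closure^'n::finite^'n) set
    \<Rightarrow> ('r^'n^'n) set" where
  "points \<iota> H = {g \<in> carrier GL. \<forall>f\<in>vanishing to_ac H. poly_at \<iota> f g = 0}"

text \<open>The matrices \<open>A\<close> over \<open>k\<close> such that \<open>1 + \<epsilon>A \<in> H(k[\<epsilon>])\<close>.\<close>

definition lie :: "('k::field alg_closure^'n::finite^'n) set \<Rightarrow> ('k^'n^'n) set" where
  "lie H = {A. (\<chi> i j. Dual (mat 1 $ i $ j) (A $ i $ j)) \<in> points dual_of H}"

text \<open>The \<open>R\<close>-points \<open>Lie H \<otimes>\<^sub>k R\<close> of the vector scheme attached to \<open>Lie H\<close>, inside \<open>n \<times> n\<close> matrices.\<close>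

definition lie_points :: "('k::field \<Rightarrow> 'r::comm_ring_1) \<Rightarrow> ('k alg_closure^'n::finite^'n) set
    \<Rightarrow> ('r^'n^'n) set" where
  "lie_points \<iota> H = module.span (\<lambda>c. map_matrix ((*) c)) (map_matrix \<iota> ` lie H)"


section \<open>Borel subgroups and maximal split tori\<close>

definition connected_solvable :: "('K::field^'n::finite^'n) set \<Rightarrow> bool" where
  "connected_solvable H \<longleftrightarrow>
     subgroup H GL \<and> closedin zariski H \<and> connectedin zariski H \<and> solvable (GL\<lparr>carrier := H\<rparr>)"

definition borel_subgroup :: "('k::field alg_closure^'n::finite^'n) set \<Rightarrow> bool" where
  "borel_subgroup B \<longleftrightarrow> k_subgroup B \<and> connected_solvable B \<and>
     (\<forall>B'. connected_solvable B' \<and> B \<subseteq> B' \<longrightarrow> B' = B)"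

text \<open>
  The geometric points of \<open>\<bbbG>\<^sub>m\<^sup>r\<close>, with coordinates indexed by \<open>i < r\<close>; the remaining entries
  are the junk value 1.
\<close>

definition Gm_power :: "nat \<Rightarrow> (nat \<Rightarrow> 'K::field) monoid" where
  "Gm_power r = \<lparr>carrier = {t. (\<forall>i<r. t i \<noteq> 0) \<and> (\<forall>i\<ge>r. t i = 1)},
                 monoid.mult = (\<lambda>s t i. s i * t i), one = (\<lambda>i. 1)\<rparr>"

text \<open>Laurent polynomials over \<open>k\<close>: the group algebra of finitely supported integer exponents.\<close>

definition laurent_at :: "((nat \<Rightarrow>\<^sub>0 int) \<Rightarrow>\<^sub>0 'k::field) \<Rightarrow> (nat \<Rightarrow> 'k alg_closure) \<Rightarrow> 'k alg_closure" where
  "laurent_at f t =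
     (\<Sum>m\<in>Poly_Mapping.keys f. to_ac (Poly_Mapping.lookup f m) *
        (\<Prod>i\<in>Poly_Mapping.keys m. t i powi Poly_Mapping.lookup m i))"

text \<open>
  A split torus is a closed \<open>k\<close>-subgroup isomorphic over \<open>k\<close> to some \<open>\<bbbG>\<^sub>m\<^sup>r\<close>. The isomorphism is given
  by Laurent polynomials over \<open>k\<close>, its inverse by regular functions on \<open>GL\<^sub>n\<close> over \<open>k\<close>, that is, by
  polynomials in the entries divided by powers of the determinant.
\<close>

definition split_torus :: "('k::field alg_closure^'n::finite^'n) set \<Rightarrow> bool" where
  "split_torus T \<longleftrightarrow> k_subgroup T \<and>
     (\<exists>r. \<exists>\<phi>\<in>iso (Gm_power r) (GL\<lparr>carrier := T\<rparr>).
        (\<forall>i j. \<exists>f. \<forall>t\<in>carrier (Gm_power r). \<phi> t $ i $ j = laurent_at f t) \<and>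
        (\<forall>i<r. \<exists>p d. \<forall>t\<in>carrier (Gm_power r). t i = poly_at to_ac p (\<phi> t) / det (\<phi> t) ^ d))"

definition maximal_split_torus :: "('k::field alg_closure^'n::finite^'n) set \<Rightarrow> bool" where
  "maximal_split_torus T \<longleftrightarrow>
     split_torus T \<and> (\<forall>T'. split_torus T' \<and> T \<subseteq> T' \<longrightarrow> T' = T)"


section \<open>The flag variety and the Grothendieck simultaneous resolution\<close>

text \<open>
  The following describe \<open>R\<close>-points only for local \<open>k\<close>-algebras \<open>R\<close>, which covers the three test
  rings used: since \<open>G \<rightarrow> G/B\<close> has sections Zariski locally, \<open>(G/B)(R) = G(R)/B(R)\<close> for local \<open>R\<close>.
\<close>

definition flag_points :: "('k::field \<Rightarrow> 'r::comm_ring_1) \<Rightarrow> ('k alg_closure^'n::finite^'n) set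
    \<Rightarrow> ('r^'n^'n) set set" where
  "flag_points \<iota> B = lcosets\<^bsub>GL\<^esub> (points \<iota> B)"

definition gtilde :: "('k::field \<Rightarrow> 'r::comm_ring_1) \<Rightarrow> ('k alg_closure^'n::finite^'n) set
    \<Rightarrow> (('r^'n^'n) \<times> ('r^'n^'n) set) set" where
  "gtilde \<iota> B = {(A, g <#\<^bsub>GL\<^esub> points \<iota> B) | A g.
     g \<in> carrier GL \<and> Ad (inv\<^bsub>GL\<^esub> g) A \<in> lie_points \<iota> B}"

text \<open>The fibre product of \<open>gtilde\<close> with itself over \<open>\<gg>\<close>, inside \<open>G/B \<times> \<gg> \<times> G/B\<close>.\<close>

definition steinberg :: "('k::field \<Rightarrow> 'r::comm_ring_1) \<Rightarrow> ('k alg_closure^'n::finite^'n) set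
    \<Rightarrow> (('r^'n^'n) set \<times> ('r^'n^'n) \<times> ('r^'n^'n) set) set" where
  "steinberg \<iota> B = {(C, A, D). (A, C) \<in> gtilde \<iota> B \<and> (A, D) \<in> gtilde \<iota> B}"

definition pi2 :: "'c \<times> 'a \<times> 'd \<Rightarrow> 'a \<times> 'd" where
  "pi2 = (\<lambda>(C, A, D). (A, D))"

text \<open>
  Functoriality in a homomorphism \<open>\<phi> : R \<rightarrow> S\<close> of \<open>k\<close>-algebras, \<open>\<iota>\<close> being the structure map of the
  target \<open>S\<close>: the coset \<open>gB(R)\<close> is sent to \<open>\<phi>(g)B(S)\<close>, which equals \<open>\<phi>(gB(R))B(S)\<close>.
\<close>

definition flag_map :: "('k::field \<Rightarrow> 's::comm_ring_1) \<Rightarrow> ('k alg_closure^'n::finite^'n) set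
    \<Rightarrow> ('r::comm_ring_1 \<Rightarrow> 's) \<Rightarrow> ('r^'n^'n) set \<Rightarrow> ('s^'n^'n) set" where
  "flag_map \<iota> B \<phi> C = (map_matrix \<phi> ` C) <#>\<^bsub>GL\<^esub> points \<iota> B"

definition gtilde_map :: "('k::field \<Rightarrow> 's::comm_ring_1) \<Rightarrow> ('k alg_closure^'n::finite^'n) set
    \<Rightarrow> ('r::comm_ring_1 \<Rightarrow> 's) \<Rightarrow> ('r^'n^'n) \<times> ('r^'n^'n) set \<Rightarrow> ('s^'n^'n) \<times> ('s^'n^'n) set" where
  "gtilde_map \<iota> B \<phi> = (\<lambda>(A, C). (map_matrix \<phi> A, flag_map \<iota> B \<phi> C))"

definition steinberg_map :: "('k::field \<Rightarrow> 's::comm_ring_1) \<Rightarrow> ('k alg_closure^'n::finite^'n) set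
    \<Rightarrow> ('r::comm_ring_1 \<Rightarrow> 's) \<Rightarrow> ('r^'n^'n) set \<times> ('r^'n^'n) \<times> ('r^'n^'n) set
    \<Rightarrow> ('s^'n^'n) set \<times> ('s^'n^'n) \<times> ('s^'n^'n) set" where
  "steinberg_map \<iota> B \<phi> =
     (\<lambda>(C, A, D). (flag_map \<iota> B \<phi> C, map_matrix \<phi> A, flag_map \<iota> B \<phi> D))"


section \<open>Tangent spaces and torus-fixed points\<close>

definition tangent_gtilde :: "('k::field alg_closure^'n::finite^'n) set
    \<Rightarrow> ('k^'n^'n) \<times> ('k^'n^'n) set \<Rightarrow> (('k dual^'n^'n) \<times> ('k dual^'n^'n) set) set" where
  "tangent_gtilde B x = {v \<in> gtilde dual_of B. gtilde_map id B std v = x}"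

definition tangent_steinberg :: "('k::field alg_closure^'n::finite^'n) set
    \<Rightarrow> ('k^'n^'n) set \<times> ('k^'n^'n) \<times> ('k^'n^'n) set
    \<Rightarrow> (('k dual^'n^'n) set \<times> ('k dual^'n^'n) \<times> ('k dual^'n^'n) set) set" where
  "tangent_steinberg B x = {v \<in> steinberg dual_of B. steinberg_map id B std v = x}"

text \<open>
  Linear subspaces of the tangent space at \<open>x\<close>. The zero vector is the image of \<open>x\<close> under \<open>k \<rightarrow> k[\<epsilon>]\<close>.
  A pair of tangent vectors \<open>v\<close>, \<open>w\<close> at \<open>x\<close> corresponds to a unique point \<open>z\<close> over \<open>k[\<epsilon>1,\<epsilon>2]/(\<epsilon>1,\<epsilon>2)^2\<close>
  with images \<open>v\<close>, \<open>w\<close> under \<open>comb 1 0\<close>, \<open>comb 0 1\<close>; the image of \<open>z\<close> under \<open>comb a b\<close> is \<open>av + bw\<close>.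
\<close>

definition tangent_subspace :: "('k::field alg_closure^'n::finite^'n) set
    \<Rightarrow> ('k^'n^'n) \<times> ('k^'n^'n) set \<Rightarrow> (('k dual^'n^'n) \<times> ('k dual^'n^'n) set) set \<Rightarrow> bool" where
  "tangent_subspace B x W \<longleftrightarrow>
     W \<subseteq> tangent_gtilde B x \<and>
     gtilde_map dual_of B dual_of x \<in> W \<and>
     (\<forall>z\<in>gtilde dual2_of B.
        gtilde_map dual_of B (comb 1 0) z \<in> W \<and> gtilde_map dual_of B (comb 0 1) z \<in> W \<longrightarrow>
        (\<forall>a b. gtilde_map dual_of B (comb a b) z \<in> W))"

text \<open>The sum of a family of subspaces is the subspace generated by their union.\<close>

definition tangent_sum :: "('k::field alg_closure^'n::finite^'n) set
    \<Rightarrow> ('k^'n^'n) \<times> ('k^'n^'n) set \<Rightarrow> ('i \<Rightarrow> (('k dual^'n^'n) \<times> ('k dual^'n^'n) set) set)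
    \<Rightarrow> 'i set \<Rightarrow> (('k dual^'n^'n) \<times> ('k dual^'n^'n) set) set" where
  "tangent_sum B x V I = tangent_subspace B x hull (\<Union>i\<in>I. V i)"

text \<open>
  Two versions of the set of \<open>T\<close>-fixed \<open>k\<close>-points of \<open>G/B\<close>: the points fixed by the group \<open>T(k)\<close>, and
  the points \<open>gB(k)\<close> such that \<open>T \<subseteq> gBg\<^sup>-\<^sup>1\<close> as subgroup schemes. They can differ only if \<open>k\<close> has two
  elements: then \<open>T(k)\<close> is trivial, and the second set is the one in bijection with the Weyl group.
\<close>

definition fixed_by_rational_points :: "('k::field alg_closure^'n::finite^'n) set
    \<Rightarrow> ('k alg_closure^'n^'n) set \<Rightarrow> ('k^'n^'n) set set" where
  "fixed_by_rational_points B T =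
     {C \<in> flag_points id B. \<forall>t\<in>points id T. t <#\<^bsub>GL\<^esub> C = C}"

definition fixed_by_torus :: "('k::field alg_closure^'n::finite^'n) set
    \<Rightarrow> ('k alg_closure^'n^'n) set \<Rightarrow> ('k^'n^'n) set set" where
  "fixed_by_torus B T =
     {g <#\<^bsub>GL\<^esub> points id B | g. g \<in> carrier GL \<and> T \<subseteq> Ad (map_matrix to_ac g) ` B}"

end

theory Submission
  imports Defs
begin

text \<open>
  A tangent vector of the resolution at \<open>(0, hB)\<close> is a pair of some \<open>A \<in> Ad(h) \<bb>\<close> and a tangent vector of
  \<open>G/B\<close> at \<open>hB\<close>, and the image of \<open>d\<pi>\<^sub>2\<close> for \<open>gB\<close> consists of the pairs with \<open>A \<in> Ad(g) \<bb> \<inter> Ad(h) \<bb>\<close>. So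
  one has to write every matrix \<open>A\<close> stabilizing a complete flag \<open>F\<close> as a sum of matrices that stabilize
  \<open>F\<close> and also some coordinate flag. Such an \<open>A\<close> is a sum of rank one matrices \<open>v \<otimes> \<phi>\<close> with \<open>v \<in> F\<^sub>j\<close> and \<open>\<phi>\<close>
  vanishing on \<open>F\<^sub>j\<^sub>-\<^sub>1\<close>. Choose a set \<open>J\<close> of coordinates that identifies \<open>F\<^sub>j\<close> with \<open>k\<^sup>J\<close>; then \<open>\<phi>\<close> can be taken
  with support in \<open>J\<close>, and \<open>v\<close> from the basis dual to \<open>J\<close>, so that the supports of \<open>v\<close> and \<open>\<phi>\<close> share at
  most one index \<open>p\<close>. Any order of the coordinates that puts the support of \<open>v\<close> first, with \<open>p\<close> last
  in it, gives a coordinate flag stabilized by \<open>v \<otimes> \<phi>\<close>.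

  To reduce to coordinates, \<open>B\<close> has to be conjugate over \<open>k\<close> to the upper triangular group. Over the
  algebraic closure this is the theorem of Lie and Kolchin. The flag of \<open>B\<close> descends to \<open>k\<close> because it
  is determined by the linear forms vanishing on \<open>B\<close>, which are spanned by forms over \<open>k\<close>. The torus
  is contained in a \<open>k\<close>-conjugate of the diagonal torus by independence of characters, so it fixes the
  coordinate flags.
\<close>

section \<open>Matrices over commutative rings\<close>

text \<open>At a point with \<open>A = 0\<close> the tangent condition decouples: a deformation
  \<open>h + \<epsilon> Z\<close> of the flag acts on \<open>\<epsilon> A\<close> only through
  \<open>h\<close>, so \<open>Z\<close> is arbitrary, and the first flag can be kept constant when a
  vector is lifted. What remains is a statement about matrices over k. Descent uses all k-linear
  functionals on the closure instead of Galois automorphisms, whose fixed field can exceed k when k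
  is imperfect. Applied to coefficients, such a functional sends an ideal generated over k into the
  ideal over k. To apply this to flags, the trace form identifies linear forms with matrices; the
  forms vanishing on B are then the matrices \<open>N\<close> that are strictly triangular in a
  basis adapted to the flag, and a vector \<open>v\<close> lies in step m+1 of the flag iff every
  \<open>N v\<close> lies in step m.\<close>

lemma group_GL: "group (GL :: ('r::comm_ring_1^'n::finite^'n) monoid)"
proof (rule groupI)
  fix x assume "x \<in> carrier (GL :: ('r^'n^'n) monoid)"
  then obtain y where "x ** y = mat 1" "y ** x = mat 1" by (auto simp: GL_def invertible_def)
  then show "\<exists>y\<in>carrier (GL :: ('r^'n^'n) monoid). y \<otimes>\<^bsub>GL\<^esub> x = \<one>\<^bsub>GL\<^esub>"
    by (auto simp: GL_def invertible_def)
next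
  fix x y assume "x \<in> carrier (GL :: ('r^'n^'n) monoid)" "y \<in> carrier (GL :: ('r^'n^'n) monoid)"
  then obtain x' y' where "x ** x' = mat 1" "x' ** x = mat 1" "y ** y' = mat 1" "y' ** y = mat 1"
    by (auto simp: GL_def invertible_def)
  then have "(x ** y) ** (y' ** x') = mat 1" "(y' ** x') ** (x ** y) = mat 1"
    by (metis matrix_mul_assoc matrix_mul_rid)+
  then show "x \<otimes>\<^bsub>GL\<^esub> y \<in> carrier GL" by (auto simp: GL_def invertible_def)
qed (auto simp: GL_def invertible_def matrix_mul_assoc)

interpretation GL: group "GL :: ('r::comm_ring_1^'n::finite^'n) monoid"
  by (rule group_GL)

lemma GL_mult [simp]: "g \<otimes>\<^bsub>GL\<^esub> h = g ** h"
  and GL_one [simp]: "\<one>\<^bsub>GL\<^esub> = mat 1"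
  and GL_carrier: "g \<in> carrier GL \<longleftrightarrow> invertible g"
  by (simp_all add: GL_def)

abbreviation ginv :: "'r::comm_ring_1^'n::finite^'n \<Rightarrow> 'r^'n^'n" where
  "ginv g \<equiv> inv\<^bsub>GL\<^esub> g"

lemma GL_inv_right [simp]: "g \<in> carrier GL \<Longrightarrow> g ** ginv g = mat 1"
  and GL_inv_left [simp]: "g \<in> carrier GL \<Longrightarrow> ginv g ** g = mat 1"
  using GL.r_inv[of g] GL.l_inv[of g] by simp_all

lemma GL_inv_right' [simp]: "g \<in> carrier GL \<Longrightarrow> g ** (ginv g ** A) = A"
  and GL_inv_left' [simp]: "g \<in> carrier GL \<Longrightarrow> ginv g ** (g ** A) = A"
  by (simp_all add: matrix_mul_assoc)

lemma GL_inv_eqI: "g ** h = mat 1 \<Longrightarrow> h ** g = mat 1 \<Longrightarrow> ginv g = h"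
  by (rule GL.inv_equality) (auto simp: GL_carrier invertible_def)

lemma GL_memI: "g ** h = mat 1 \<Longrightarrow> h ** g = mat 1 \<Longrightarrow> g \<in> carrier GL"
  by (auto simp: GL_carrier invertible_def)

lemma GL_mem_mult [simp]: "g \<in> carrier GL \<Longrightarrow> h \<in> carrier GL \<Longrightarrow> g ** h \<in> carrier GL"
  using GL.m_closed[of g h] by simp

lemma GL_mem_one [simp]: "mat 1 \<in> carrier GL"
  using GL.one_closed by simp

lemma GL_inv_mult: "g \<in> carrier GL \<Longrightarrow> h \<in> carrier GL \<Longrightarrow>
    ginv (g ** h) = ginv h ** ginv g"
  using GL.inv_mult_group[of g h] by simp

lemma GL_inv_one [simp]: "ginv (mat 1) = mat 1"
  using GL.inv_one by simp

lemma Ad_mult: "g \<in> carrier GL \<Longrightarrow> h \<in> carrier GL \<Longrightarrow> Ad (g ** h) A = Ad g (Ad h A)"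
  by (simp add: Ad_def GL_inv_mult matrix_mul_assoc)

lemma Ad_one [simp]: "Ad (mat 1) A = A"
  by (simp add: Ad_def)

lemma Ad_inv_Ad [simp]: "g \<in> carrier GL \<Longrightarrow> Ad (ginv g) (Ad g A) = A"
  and Ad_Ad_inv [simp]: "g \<in> carrier GL \<Longrightarrow> Ad g (Ad (ginv g) A) = A"
  by (simp_all add: Ad_mult[symmetric])

lemma Ad_mult_matrix: "g \<in> carrier GL \<Longrightarrow> Ad g (A ** B) = Ad g A ** Ad g B"
  by (simp add: Ad_def matrix_mul_assoc[symmetric])

lemma Ad_mat_one: "g \<in> carrier GL \<Longrightarrow> Ad g (mat 1) = mat 1"
  by (simp add: Ad_def)

lemma Ad_GL_iff: "g \<in> carrier GL \<Longrightarrow> Ad g A \<in> carrier GL \<longleftrightarrow> A \<in> carrier GL"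
proof -
  have *: "Ad g A \<in> carrier GL" if "g \<in> carrier GL" "A \<in> carrier GL" for g A
    using that by (simp add: Ad_def)
  assume g: "g \<in> carrier GL"
  show ?thesis using *[OF g] *[of "ginv g" "Ad g A"] g by auto
qed

lemma Ad_inv_GL: "g \<in> carrier GL \<Longrightarrow> x \<in> carrier GL \<Longrightarrow> ginv (Ad g x) = Ad g (ginv x)"
  by (rule GL_inv_eqI) (simp_all add: Ad_mult_matrix[symmetric] Ad_mat_one)

lemma matrix_mult_add_right: "(A + B) ** C = A ** C + B ** (C :: 'r::comm_ring_1^'n::finite^'n)"
  by (simp add: vec_eq_iff matrix_matrix_mult_def distrib_right sum.distrib)

lemma Ad_add: "Ad g (A + B) = Ad g A + Ad g B"
  by (simp add: Ad_def matrix_add_ldistrib matrix_mult_add_right)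

lemma Ad_entry: "Ad g A $ i $ j = (\<Sum>a\<in>UNIV. \<Sum>b\<in>UNIV. g $ i $ a * A $ a $ b * (ginv g) $ b $ j)"
  unfolding Ad_def matrix_matrix_mult_def
  by (subst sum.swap) (simp add: sum_distrib_right)

lemma Ad_scale: "Ad g (map_matrix ((*) c) A) = map_matrix ((*) c) (Ad g A)"
  by (simp add: vec_eq_iff Ad_entry sum_distrib_left mult_ac)

lemma Ad_0 [simp]: "Ad g 0 = 0"
  by (simp add: Ad_def)

subsection \<open>Ring homomorphisms\<close>

text \<open>Structure maps, reductions, evaluations and combinations of tangent vectors are all
  instances, so that points, inverses and conjugation are transported by one set of lemmas.\<close>

locale ring_map =
  fixes \<phi> :: "'r::comm_ring_1 \<Rightarrow> 's::comm_ring_1"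
  assumes map_add: "\<phi> (x + y) = \<phi> x + \<phi> y"
    and map_mult: "\<phi> (x * y) = \<phi> x * \<phi> y"
    and map_one: "\<phi> 1 = 1"
begin

lemma map_zero: "\<phi> 0 = 0"
  using map_add[of 0 0] by simp

lemma map_sum: "\<phi> (\<Sum>i\<in>I. f i) = (\<Sum>i\<in>I. \<phi> (f i))"
  by (induction I rule: infinite_finite_induct) (simp_all add: map_zero map_add)

lemma map_prod: "\<phi> (\<Prod>i\<in>I. f i) = (\<Prod>i\<in>I. \<phi> (f i))"
  by (induction I rule: infinite_finite_induct) (simp_all add: map_one map_mult)

lemma map_power: "\<phi> (x ^ n) = \<phi> x ^ n"
  by (induction n) (simp_all add: map_one map_mult)

lemma mm_mult: "map_matrix \<phi> (A ** B) = map_matrix \<phi> A ** map_matrix \<phi> B"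
  for A B :: "'r^'n::finite^'n"
  by (simp add: vec_eq_iff matrix_matrix_mult_def map_sum map_mult)

lemma mm_one: "map_matrix \<phi> (mat 1) = (mat 1 :: 's^'n::finite^'n)"
  by (simp add: vec_eq_iff mat_def map_one map_zero)

lemma mm_GL: "g \<in> carrier GL \<Longrightarrow> map_matrix \<phi> g \<in> carrier GL"
  for g :: "'r^'n::finite^'n"
  by (rule GL_memI[of _ "map_matrix \<phi> (ginv g)"]) (simp_all add: mm_mult[symmetric] mm_one)

lemma mm_inv: "g \<in> carrier GL \<Longrightarrow> map_matrix \<phi> (ginv g) = ginv (map_matrix \<phi> g)"
  for g :: "'r^'n::finite^'n"
  by (rule GL_inv_eqI[symmetric]) (simp_all add: mm_mult[symmetric] mm_one)

lemma mm_Ad: "g \<in> carrier GL \<Longrightarrow> map_matrix \<phi> (Ad g A) = Ad (map_matrix \<phi> g) (map_matrix \<phi> A)"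
  for g :: "'r^'n::finite^'n"
  by (simp add: Ad_def mm_mult mm_inv)

lemma poly_at_map: "\<phi> (poly_at \<iota> f g) = poly_at (\<lambda>c. \<phi> (\<iota> c)) f (map_matrix \<phi> g)"
  by (simp add: poly_at_def map_sum map_mult map_prod map_power case_prod_unfold)

lemma mm_points: "g \<in> points \<iota> H \<Longrightarrow> map_matrix \<phi> g \<in> points (\<lambda>c. \<phi> (\<iota> c)) H"
  for g :: "'r^'n::finite^'n"
  by (auto simp: points_def mm_GL map_zero simp flip: poly_at_map)

end

lemma ring_map_to_ac: "ring_map to_ac"
  by unfold_locales simp_all

lemma ring_map_dual_of: "ring_map dual_of"
  by unfold_locales (simp_all add: dual_of_def one_dual_def)

lemma ring_map_dual2_of: "ring_map dual2_of"
  by unfold_locales (simp_all add: dual2_of_def one_dual2_def)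

lemma ring_map_std: "ring_map std"
proof
  fix x y :: "'a dual"
  show "std (x + y) = std x + std y" by (cases x; cases y) simp
  show "std (x * y) = std x * std y" by (cases x; cases y) simp
qed (simp add: one_dual_def)

lemma ring_map_comb: "ring_map (comb a b)"
proof
  fix x y :: "'a dual2"
  show "comb a b (x + y) = comb a b x + comb a b y"
    by (cases x; cases y) (simp add: algebra_simps)
  show "comb a b (x * y) = comb a b x * comb a b y"
    by (cases x; cases y) (simp add: algebra_simps)
qed (simp add: one_dual2_def one_dual_def)

interpretation to_ac: ring_map to_ac by (rule ring_map_to_ac)
interpretation dual_of: ring_map dual_of by (rule ring_map_dual_of)
interpretation dual2_of: ring_map dual2_of by (rule ring_map_dual2_of)
interpretation std: ring_map std by (rule ring_map_std)
interpretation comb: ring_map "comb a b" for a b by (rule ring_map_comb)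

subsection \<open>Triangular matrices\<close>

text \<open>The index type carries no order; an injection \<open>r\<close> into the natural numbers orders it.\<close>

definition upper :: "('n::finite \<Rightarrow> nat) \<Rightarrow> ('r::comm_ring_1^'n^'n) set" where
  "upper r = {A. \<forall>i j. r j < r i \<longrightarrow> A $ i $ j = 0}"

lemma upper_one [simp]: "mat 1 \<in> upper r"
  by (auto simp: upper_def mat_def)

lemma upper_zero [simp]: "0 \<in> upper r"
  by (auto simp: upper_def)

lemma upper_add: "A \<in> upper r \<Longrightarrow> B \<in> upper r \<Longrightarrow> A + B \<in> upper r"
  by (auto simp: upper_def)

lemma upper_mult: "A \<in> upper r \<Longrightarrow> B \<in> upper r \<Longrightarrow> A ** B \<in> upper r"
  unfolding upper_def matrix_matrix_mult_def
  by (auto intro!: sum.neutral) (metis linorder_neqE_nat mult_not_zero order_less_trans)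

lemma upper_scale: "A \<in> upper r \<Longrightarrow> map_matrix ((*) c) A \<in> upper r"
  by (auto simp: upper_def)

text \<open>In column \<open>j\<close> of \<open>B ** A = mat 1\<close>, at rows \<open>i\<close>
  with \<open>r j \<le> r i\<close>, a single product survives: earlier columns of \<open>B\<close>
  are triangular by induction, and \<open>A\<close> is triangular. Diagonal entries come out as
  units, which is the notion that also works over the dual numbers.\<close>

lemma upper_left_inverse:
  fixes A B :: "'r::comm_ring_1^'n::finite^'n"
  assumes r: "inj r" and A: "A \<in> upper r" and BA: "B ** A = mat 1"
  shows "A $ j $ j * B $ j $ j = 1" and "r j < r i \<Longrightarrow> B $ i $ j = 0"
proof -
  have "A $ j $ j * B $ j $ j = 1 \<and> (\<forall>i. r j < r i \<longrightarrow> B $ i $ j = 0)"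
  proof (induction "r j" arbitrary: j rule: less_induct)
    case less
    have entry: "B $ i $ j * A $ j $ j = mat 1 $ i $ j" if "r j \<le> r i" for i
    proof -
      have "mat 1 $ i $ j = (\<Sum>k\<in>UNIV. B $ i $ k * A $ k $ j)"
        by (simp add: BA[symmetric] matrix_matrix_mult_def)
      also have "\<dots> = (\<Sum>k\<in>{j}. B $ i $ k * A $ k $ j)"
      proof (rule sum.mono_neutral_right)
        show "\<forall>k\<in>UNIV - {j}. B $ i $ k * A $ k $ j = 0"
        proof
          fix k assume "k \<in> UNIV - {j}"
          then have "r k < r j \<or> r j < r k" using r by (metis DiffD2 injD insertI1 linorder_neqE_nat)
          then show "B $ i $ k * A $ k $ j = 0"
            using less[of k] that A by (auto simp: upper_def)
        qed
      qed auto
      finally show ?thesis by simp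
    qed
    have 1: "A $ j $ j * B $ j $ j = 1"
      using entry[of j] by (simp add: mat_def mult.commute)
    have "B $ i $ j = 0" if "r j < r i" for i
    proof -
      have "B $ i $ j * A $ j $ j = 0" using entry[of i] that by (auto simp: mat_def)
      then have "B $ i $ j * (A $ j $ j * B $ j $ j) = 0" by (simp flip: mult.assoc)
      then show ?thesis by (simp add: 1)
    qed
    then show ?case using 1 by blast
  qed
  then show "A $ j $ j * B $ j $ j = 1" and "r j < r i \<Longrightarrow> B $ i $ j = 0" by auto
qed

lemma upper_inv: "inj r \<Longrightarrow> A \<in> carrier GL \<Longrightarrow> A \<in> upper r \<Longrightarrow> ginv A \<in> upper r"
  using upper_left_inverse(2)[of r A "ginv A"] by (auto simp: upper_def[of r])

lemma subgroup_upper: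
  assumes r: "inj r" and g: "g \<in> carrier GL"
  shows "subgroup {x \<in> carrier GL. Ad (ginv g) x \<in> upper r} GL"
proof
  fix x assume "x \<in> {x \<in> carrier GL. Ad (ginv g) x \<in> upper r}"
  then show "ginv x \<in> {x \<in> carrier GL. Ad (ginv g) x \<in> upper r}"
    using g upper_inv[OF r, of "Ad (ginv g) x"] by (auto simp: Ad_GL_iff Ad_inv_GL)
qed (use g in \<open>auto simp: Ad_mult_matrix Ad_mat_one upper_mult\<close>)

section \<open>Polynomials in the matrix entries\<close>

lemma poly_mapping_sum_induct [case_names single add]:
  fixes f :: "'a \<Rightarrow>\<^sub>0 'b::comm_monoid_add"
  assumes single: "\<And>k v. P (Poly_Mapping.single k v)"
    and add: "\<And>f g. P f \<Longrightarrow> P g \<Longrightarrow> P (f + g)"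
  shows "P f"
proof -
  have eq: "f = (\<Sum>k\<in>Poly_Mapping.keys f. Poly_Mapping.single k (Poly_Mapping.lookup f k))"
  proof (rule poly_mapping_eqI)
    fix k
    show "Poly_Mapping.lookup f k =
        Poly_Mapping.lookup (\<Sum>k\<in>Poly_Mapping.keys f. Poly_Mapping.single k (Poly_Mapping.lookup f k)) k"
      by (auto simp: lookup_sum lookup_single when_def sum.delta in_keys_iff)
  qed
  have "P (\<Sum>k\<in>S. Poly_Mapping.single k (Poly_Mapping.lookup f k))" if "finite S" for S
    using that
  proof induction
    case empty
    then show ?case using single[of undefined 0] by simp
  qed (auto intro: single add)
  from this[of "Poly_Mapping.keys f"] eq show ?thesis by simp
qed

lemma poly_mapping_map_add:
  assumes "\<phi> 0 = 0" and "\<And>x y. \<phi> (x + y) = \<phi> x + \<phi> y"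
  shows "Poly_Mapping.map \<phi> (f + g) = Poly_Mapping.map \<phi> f + Poly_Mapping.map \<phi> g"
  by (rule poly_mapping_eqI) (auto simp: map.rep_eq lookup_add when_def assms(1) in_keys_iff simp flip: assms(2))

text \<open>The product runs over all positions instead of the keys, so that adding exponents does
  not change the index set.\<close>

definition monom_at :: "('n::finite \<times> 'n \<Rightarrow>\<^sub>0 nat) \<Rightarrow> 'r::comm_ring_1^'n^'n \<Rightarrow> 'r" where
  "monom_at m g = (\<Prod>p\<in>UNIV. (g $ fst p $ snd p) ^ Poly_Mapping.lookup m p)"

lemma monom_at_zero [simp]: "monom_at 0 g = 1"
  by (simp add: monom_at_def)

lemma monom_at_add: "monom_at (m + m') g = monom_at m g * monom_at m' g"
  by (simp add: monom_at_def lookup_add power_add prod.distrib)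

lemma monom_at_single [simp]: "monom_at (Poly_Mapping.single (i, j) e) g = (g $ i $ j) ^ e"
proof -
  have "monom_at (Poly_Mapping.single (i, j) e) g =
      (\<Prod>p\<in>{(i, j)}. (g $ fst p $ snd p) ^ Poly_Mapping.lookup (Poly_Mapping.single (i, j) e) p)"
    unfolding monom_at_def by (rule prod.mono_neutral_right) (auto simp: lookup_single when_def)
  then show ?thesis by simp
qed

lemma poly_at_monoms:
  "poly_at \<iota> f g = (\<Sum>m\<in>Poly_Mapping.keys f. \<iota> (Poly_Mapping.lookup f m) * monom_at m g)"
proof -
  have "monom_at m g = (\<Prod>(i, j)\<in>Poly_Mapping.keys m. (g $ i $ j) ^ Poly_Mapping.lookup m (i, j))" for m
    unfolding monom_at_def case_prod_unfold
    by (rule prod.mono_neutral_cong_right) (auto simp: in_keys_iff)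
  then show ?thesis by (simp add: poly_at_def)
qed

lemma poly_at_monoms_superset:
  assumes "\<iota> 0 = 0" "finite S" "Poly_Mapping.keys f \<subseteq> S"
  shows "poly_at \<iota> f g = (\<Sum>m\<in>S. \<iota> (Poly_Mapping.lookup f m) * monom_at m g)"
  unfolding poly_at_monoms
  by (rule sum.mono_neutral_left) (use assms in \<open>auto simp: in_keys_iff\<close>)

lemma poly_at_single: "\<iota> 0 = 0 \<Longrightarrow> poly_at \<iota> (Poly_Mapping.single m c) g = \<iota> c * monom_at m g"
  by (simp add: poly_at_monoms)

context ring_map begin

lemma poly_at_zero [simp]: "poly_at \<phi> 0 g = 0"
  by (simp add: poly_at_def)

lemma poly_at_one [simp]: "poly_at \<phi> 1 g = 1"
  by (simp add: poly_at_monoms map_one)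

lemma poly_at_add: "poly_at \<phi> (f + f') g = poly_at \<phi> f g + poly_at \<phi> f' g"
proof -
  let ?S = "Poly_Mapping.keys f \<union> Poly_Mapping.keys f'"
  have "poly_at \<phi> f g = (\<Sum>m\<in>?S. \<phi> (Poly_Mapping.lookup f m) * monom_at m g)"
    and "poly_at \<phi> f' g = (\<Sum>m\<in>?S. \<phi> (Poly_Mapping.lookup f' m) * monom_at m g)"
    and "poly_at \<phi> (f + f') g = (\<Sum>m\<in>?S. \<phi> (Poly_Mapping.lookup (f + f') m) * monom_at m g)"
    using Poly_Mapping.keys_add[of f f'] by (intro poly_at_monoms_superset; simp add: map_zero)+
  then show ?thesis by (simp add: lookup_add map_add distrib_right sum.distrib)
qed

lemma poly_at_mult: "poly_at \<phi> (f * f') g = poly_at \<phi> f g * poly_at \<phi> f' g"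
proof (induction f rule: poly_mapping_sum_induct)
  case (single k v)
  show ?case
  proof (induction f' rule: poly_mapping_sum_induct)
    case (single l w)
    show ?case by (simp add: mult_single poly_at_single map_zero monom_at_add map_mult mult_ac)
  qed (simp add: algebra_simps poly_at_add)
qed (simp add: algebra_simps poly_at_add)

end

lemma ring_map_id: "ring_map id"
  by unfold_locales simp_all

interpretation id: ring_map id by (rule ring_map_id)

definition poly_fun :: "('r::comm_ring_1^'n::finite^'n \<Rightarrow> 'r) \<Rightarrow> bool" where
  "poly_fun p \<longleftrightarrow> (\<exists>f. \<forall>g. p g = poly_at id f g)"

lemma poly_funI: "(\<And>g. p g = poly_at id f g) \<Longrightarrow> poly_fun p"
  by (auto simp: poly_fun_def)

lemma poly_fun_const: "poly_fun (\<lambda>_. c)"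
  by (rule poly_funI[of _ "Poly_Mapping.single 0 c"]) (simp add: poly_at_single)

lemma poly_fun_entry: "poly_fun (\<lambda>g. g $ i $ j)"
  by (rule poly_funI[of _ "Poly_Mapping.single (Poly_Mapping.single (i, j) 1) 1"])
     (simp add: poly_at_single)

lemma poly_fun_add: "poly_fun p \<Longrightarrow> poly_fun q \<Longrightarrow> poly_fun (\<lambda>g. p g + q g)"
  unfolding poly_fun_def by (metis id.poly_at_add)

lemma poly_fun_mult: "poly_fun p \<Longrightarrow> poly_fun q \<Longrightarrow> poly_fun (\<lambda>g. p g * q g)"
  unfolding poly_fun_def by (metis id.poly_at_mult)

lemma poly_fun_sum: "(\<And>i. i \<in> I \<Longrightarrow> poly_fun (p i)) \<Longrightarrow> poly_fun (\<lambda>g. \<Sum>i\<in>I. p i g)"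
  by (induction I rule: infinite_finite_induct) (simp_all add: poly_fun_const poly_fun_add)

lemma poly_fun_prod: "(\<And>i. i \<in> I \<Longrightarrow> poly_fun (p i)) \<Longrightarrow> poly_fun (\<lambda>g. \<Prod>i\<in>I. p i g)"
  by (induction I rule: infinite_finite_induct) (simp_all add: poly_fun_const poly_fun_mult)

lemma poly_fun_power: "poly_fun p \<Longrightarrow> poly_fun (\<lambda>g. p g ^ n)"
  by (induction n) (simp_all add: poly_fun_const poly_fun_mult)

lemma poly_fun_diff: "poly_fun p \<Longrightarrow> poly_fun q \<Longrightarrow> poly_fun (\<lambda>g. p g - q g)"
  using poly_fun_add[of p "\<lambda>g. (- 1) * q g"] poly_fun_mult[OF poly_fun_const[of "- 1"], of q] by simp

lemma poly_fun_det:
  fixes A :: "'r::comm_ring_1^'n::finite^'n \<Rightarrow> 'r^'m::finite^'m"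
  assumes "\<And>i j. poly_fun (\<lambda>g. A g $ i $ j)"
  shows "poly_fun (\<lambda>g. det (A g))"
  unfolding det_def by (intro poly_fun_sum poly_fun_mult poly_fun_prod poly_fun_const assms)


section \<open>The Zariski topology\<close>

lemma det_nonzero_GL: "g \<in> carrier GL \<longleftrightarrow> det g \<noteq> 0"
  for g :: "'K::field^'n::finite^'n"
  by (simp add: GL_carrier invertible_det_nz)

lemma topspace_zariski [simp]: "topspace zariski = carrier (GL :: ('K::field^'n::finite^'n) monoid)"
proof -
  have "carrier (GL :: ('K^'n^'n) monoid) \<in> {{g \<in> carrier GL. poly_at id f g \<noteq> 0} |f :: ('K, 'n) entry_poly. True}"
    by (rule CollectI, rule exI[of _ "Poly_Mapping.single 0 1"]) (auto simp: poly_at_single)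
  then show ?thesis unfolding zariski_def topology_generated_by_topspace by auto
qed

text \<open>Elements of the coordinate ring of \<open>GL\<close>: polynomials with the determinant
  inverted. The denominator is cleared, and only the values on \<open>GL\<close> count.\<close>

definition regular :: "('K::field^'n::finite^'n \<Rightarrow> 'K) \<Rightarrow> bool" where
  "regular q \<longleftrightarrow> (\<exists>p d. poly_fun p \<and> (\<forall>g\<in>carrier GL. q g * det g ^ d = p g))"

lemma regular_poly_fun: "poly_fun p \<Longrightarrow> regular p"
  unfolding regular_def by (intro exI[of _ p] exI[of _ 0]) simp

lemma regular_add:
  assumes "regular q" "regular q'" shows "regular (\<lambda>g. q g + q' g)"
proof -
  obtain p d p' d' where p: "poly_fun p" "poly_fun p'"
    and "\<forall>g\<in>carrier GL. q g * det g ^ d = p g" "\<forall>g\<in>carrier GL. q' g * det g ^ d' = p' g"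
    using assms unfolding regular_def by blast
  then have "\<forall>g\<in>carrier GL. (q g + q' g) * det g ^ (d + d') = p g * det g ^ d' + p' g * det g ^ d"
    by (auto simp: algebra_simps power_add)
  moreover have "poly_fun (\<lambda>g. p g * det g ^ d' + p' g * det g ^ d)"
    by (intro poly_fun_add poly_fun_mult poly_fun_power poly_fun_det poly_fun_entry p)
  ultimately show ?thesis unfolding regular_def by blast
qed

lemma regular_mult:
  assumes "regular q" "regular q'" shows "regular (\<lambda>g. q g * q' g)"
proof -
  obtain p d p' d' where p: "poly_fun p" "poly_fun p'"
    and "\<forall>g\<in>carrier GL. q g * det g ^ d = p g" "\<forall>g\<in>carrier GL. q' g * det g ^ d' = p' g"
    using assms unfolding regular_def by blast
  then have "\<forall>g\<in>carrier GL. (q g * q' g) * det g ^ (d + d') = p g * p' g"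
    by (metis mult.assoc mult.left_commute power_add)
  moreover have "poly_fun (\<lambda>g. p g * p' g)" by (intro poly_fun_mult p)
  ultimately show ?thesis unfolding regular_def by blast
qed

lemma regular_sum: "(\<And>i. i \<in> I \<Longrightarrow> regular (p i)) \<Longrightarrow> regular (\<lambda>g. \<Sum>i\<in>I. p i g)"
  by (induction I rule: infinite_finite_induct)
     (simp_all add: regular_poly_fun poly_fun_const regular_add)

lemma regular_prod: "(\<And>i. i \<in> I \<Longrightarrow> regular (p i)) \<Longrightarrow> regular (\<lambda>g. \<Prod>i\<in>I. p i g)"
  by (induction I rule: infinite_finite_induct)
     (simp_all add: regular_poly_fun poly_fun_const regular_mult)

lemma regular_power: "regular p \<Longrightarrow> regular (\<lambda>g. p g ^ n)"
  by (induction n) (simp_all add: regular_poly_fun poly_fun_const regular_mult)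

lemma regular_const: "regular (\<lambda>_. c)"
  by (intro regular_poly_fun poly_fun_const)

lemma regular_entry: "regular (\<lambda>g. g $ i $ j)"
  by (intro regular_poly_fun poly_fun_entry)

lemma regular_matrix_mult:
  fixes A B :: "'K::field^'n::finite^'n \<Rightarrow> 'K^'m::finite^'m"
  assumes "\<And>i j. regular (\<lambda>g. A g $ i $ j)" "\<And>i j. regular (\<lambda>g. B g $ i $ j)"
  shows "regular (\<lambda>g. (A g ** B g) $ i $ j)"
  unfolding matrix_matrix_mult_def by (simp add: regular_sum regular_mult assms)

text \<open>Cramer's rule: up to the factor \<open>det g\<close> the entry is the determinant of
  \<open>g\<close> with column \<open>i\<close> replaced by the unit vector of
  \<open>j\<close>.\<close>

lemma regular_inv:
  fixes i j :: "'n::finite"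
  shows "regular (\<lambda>g :: 'K::field^'n^'n. (ginv g) $ i $ j)"
proof -
  let ?p = "\<lambda>g :: 'K^'n^'n. det (\<chi> a b. if b = i then mat 1 $ a $ j else g $ a $ b)"
  have "(ginv g) $ i $ j * det g ^ 1 = ?p g" if "g \<in> carrier GL" for g :: "'K^'n^'n"
  proof -
    have *: "(g *v column j (ginv g)) $ a = mat 1 $ a $ j" for a
      by (simp add: GL_inv_right[OF that, symmetric] matrix_vector_mult_def matrix_matrix_mult_def
          column_def)
    show ?thesis
      using cramer_lemma[of i g "column j (ginv g)"] unfolding * by (simp add: column_def)
  qed
  moreover have "poly_fun ?p"
  proof (rule poly_fun_det)
    show "poly_fun (\<lambda>g :: 'K^'n^'n. (\<chi> a b. if b = i then mat 1 $ a $ j else g $ a $ b) $ a $ b)" for a b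
      by (cases "b = i") (simp_all add: poly_fun_const poly_fun_entry)
  qed
  ultimately show ?thesis unfolding regular_def by blast
qed

lemma regular_poly_at:
  fixes A :: "'K::field^'n::finite^'n \<Rightarrow> 'K^'m::finite^'m"
  assumes "\<And>i j. regular (\<lambda>g. A g $ i $ j)"
  shows "regular (\<lambda>g. poly_at id f (A g))"
  unfolding poly_at_monoms monom_at_def
  by (intro regular_sum regular_mult regular_const regular_prod regular_power assms)

lemma openin_zariski_regular:
  fixes q :: "'K::field^'n::finite^'n \<Rightarrow> 'K"
  assumes "regular q"
  shows "openin zariski {g \<in> carrier GL. q g \<noteq> 0}"
proof -
  obtain p d where "poly_fun p" and eq: "\<forall>g\<in>carrier GL. q g * det g ^ d = p g"
    using assms unfolding regular_def by blast
  then obtain f where p: "p = poly_at id f" by (auto simp: poly_fun_def fun_eq_iff)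
  have "{g \<in> carrier GL. q g \<noteq> 0} = {g \<in> carrier GL. poly_at id f g \<noteq> 0}"
    unfolding p[symmetric] by (auto simp: eq[rule_format, symmetric] det_nonzero_GL)
  then show ?thesis
    unfolding zariski_def by (auto intro!: topology_generated_by_Basis)
qed

lemma closedin_zariski_regular:
  fixes q :: "'K::field^'n::finite^'n \<Rightarrow> 'K"
  assumes "regular q"
  shows "closedin zariski {g \<in> carrier GL. q g = 0}"
proof -
  have "carrier GL - {g \<in> carrier GL. q g = 0} = {g \<in> carrier GL. q g \<noteq> 0}" by auto
  then show ?thesis using openin_zariski_regular[OF assms] by (auto simp: closedin_def)
qed

lemma continuous_map_zariski:
  fixes F :: "'K::field^'n::finite^'n \<Rightarrow> 'K^'n^'n"
  assumes reg: "\<And>i j. regular (\<lambda>g. F g $ i $ j)"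
    and GL: "\<And>g. g \<in> carrier GL \<Longrightarrow> F g \<in> carrier GL"
  shows "continuous_map zariski zariski F"
proof -
  let ?\<S> = "{{g \<in> carrier GL. poly_at id f g \<noteq> 0} |f :: ('K, 'n) entry_poly. True}"
  have "continuous_map zariski (topology_generated_by ?\<S>) F"
  proof (rule continuous_on_generated_topo)
    fix U assume "U \<in> ?\<S>"
    then obtain f where U: "U = {g \<in> carrier GL. poly_at id f g \<noteq> 0}" by blast
    have "F -` U \<inter> carrier GL = {g \<in> carrier GL. poly_at id f (F g) \<noteq> 0}"
      using GL by (auto simp: U)
    then show "openin zariski (F -` U \<inter> topspace zariski)"
      using openin_zariski_regular[OF regular_poly_at[OF reg]] by simp
  next
    show "F ` topspace zariski \<subseteq> \<Union>?\<S>"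
      using GL topspace_zariski[where 'K='K and 'n='n]
      unfolding zariski_def topology_generated_by_topspace by auto
  qed
  then show ?thesis unfolding zariski_def .
qed

text \<open>The topology is given by a subbasis; multiplying polynomials intersects principal open
  sets, which therefore form a basis.\<close>

lemma openin_zariski_principal:
  fixes U :: "('K::field^'n::finite^'n) set"
  assumes U: "openin zariski U" and g: "g \<in> U"
  shows "\<exists>p. poly_fun p \<and> p g \<noteq> 0 \<and> (\<forall>x\<in>carrier GL. p x \<noteq> 0 \<longrightarrow> x \<in> U)"
proof -
  have "generate_topology_on {{g \<in> carrier GL. poly_at id f g \<noteq> 0} |f :: ('K, 'n) entry_poly. True} U"
    using U by (simp add: zariski_def openin_topology_generated_by_iff)
  then show ?thesis using g
  proof (induction arbitrary: g)
    case (Int a b)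
    obtain p where p: "poly_fun p" "p g \<noteq> 0" "\<forall>x\<in>carrier GL. p x \<noteq> 0 \<longrightarrow> x \<in> a"
      using Int.IH(1)[of g] Int.prems by blast
    obtain q where q: "poly_fun q" "q g \<noteq> 0" "\<forall>x\<in>carrier GL. q x \<noteq> 0 \<longrightarrow> x \<in> b"
      using Int.IH(2)[of g] Int.prems by blast
    show ?case
      by (rule exI[of _ "\<lambda>g. p g * q g"]) (use p q in \<open>simp add: poly_fun_mult\<close>)
  next
    case (UN K)
    then obtain k where k: "k \<in> K" "g \<in> k" by blast
    show ?case using UN.IH[OF k] k(1) by blast
  next
    case (Basis s)
    then obtain f where s: "s = {g \<in> carrier GL. poly_at id f g \<noteq> 0}" by blast
    show ?case
      by (rule exI[of _ "poly_at id f"]) (use Basis.prems s in \<open>auto simp: poly_fun_def\<close>)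
  qed simp
qed

section \<open>Connected sets in the Zariski topology\<close>

lemma connectedin_level_sets:
  assumes conn: "connectedin Y H" and fin: "finite (f ` H)"
    and closed: "\<And>c. c \<in> f ` H \<Longrightarrow> \<exists>Z. closedin Y Z \<and> H \<inter> Z = {x \<in> H. f x = c}"
    and xy: "x \<in> H" "y \<in> H"
  shows "f x = f y"
proof (rule ccontr)
  assume ne: "f x \<noteq> f y"
  obtain Z where Z: "\<And>c. c \<in> f ` H \<Longrightarrow> closedin Y (Z c) \<and> H \<inter> Z c = {x \<in> H. f x = c}"
    using closed by metis
  \<comment> \<open>All level sets but one, taken together; their union is closed because only
    finitely many values occur.\<close>
  define E where "E = (\<Union>c\<in>f ` H - {f x}. Z c)"
  have Zmem: "a \<in> Z c \<longleftrightarrow> f a = c" if "a \<in> H" "c \<in> f ` H" for a c using Z[OF that(2)] that(1) by blast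
  have Emem: "a \<in> E \<longleftrightarrow> f a \<noteq> f x" if "a \<in> H" for a using that Zmem by (auto simp: E_def)
  have fx: "f x \<in> f ` H" using xy by blast
  have "closedin Y E" unfolding E_def
    by (rule closedin_Union) (use fin Z in auto)
  moreover have "closedin Y (Z (f x))" using Z[OF fx] by blast
  moreover have "H \<subseteq> Z (f x) \<union> E" using Zmem[OF _ fx] Emem by blast
  moreover have "Z (f x) \<inter> E \<inter> H = {}" using Zmem[OF _ fx] Emem by blast
  moreover have "x \<in> Z (f x)" "y \<in> E" using Zmem[OF xy(1) fx] Emem[OF xy(2)] ne by auto
  then have "Z (f x) \<inter> H \<noteq> {}" "E \<inter> H \<noteq> {}" using xy by blast+
  ultimately have "closedin Y (Z (f x)) \<and> closedin Y E \<and> H \<subseteq> Z (f x) \<union> E \<and> Z (f x) \<inter> E \<inter> H = {} \<and>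
      Z (f x) \<inter> H \<noteq> {} \<and> E \<inter> H \<noteq> {}" by (intro conjI)
  then show False
    by (rule notE[OF conjunct2[OF conn[unfolded connectedin_closedin]], OF exI, OF exI])
qed

text \<open>
  The product of two connected sets is connected, although multiplication is not continuous for the
  product of the Zariski topologies: translations suffice.
\<close>

lemma connectedin_generate:
  fixes S :: "('K::field^'n::finite^'n) set"
  assumes S: "\<And>s. s \<in> S \<Longrightarrow> \<exists>C. connectedin zariski C \<and> C \<subseteq> S \<and> s \<in> C \<and> mat 1 \<in> C"
    and inv: "\<And>s. s \<in> S \<Longrightarrow> ginv s \<in> S"
  shows "connectedin zariski (generate GL S)"
proof -
  let ?D = "generate GL S"
  let ?\<C> = "{C. connectedin zariski C \<and> C \<subseteq> ?D \<and> mat 1 \<in> C}"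
  have SG: "S \<subseteq> carrier GL" using S connectedin_subset_topspace by fastforce
  have DG: "?D \<subseteq> carrier GL" using GL.generate_incl[OF SG] .
  \<comment> \<open>If \<open>C\<close> is connected and contains 1 and \<open>x\<close>, the
    translate by \<open>x\<close> of a connected set joining 1 to \<open>s\<close> meets
    \<open>C\<close> in \<open>x\<close> and reaches \<open>x ** s\<close>.\<close>
  have step: "x ** s \<in> \<Union>?\<C>" if x: "x \<in> \<Union>?\<C>" and s: "s \<in> S" for x s
  proof -
    obtain C where C: "C \<in> ?\<C>" "x \<in> C" using x by blast
    obtain C' where C': "connectedin zariski C'" "C' \<subseteq> S" "s \<in> C'" "mat 1 \<in> C'" using S[OF s] by blast
    have xG: "x \<in> carrier GL" using C DG by blast
    have "continuous_map zariski zariski ((**) x)"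
      by (rule continuous_map_zariski) (auto simp: xG intro!: regular_matrix_mult regular_const regular_entry)
    then have conn: "connectedin zariski ((**) x ` C')"
      using C'(1) by (rule connectedin_continuous_map_image)
    have "x \<in> (**) x ` C'" using C'(4) by force
    then have "connectedin zariski (C \<union> (**) x ` C')"
      using conn C by (intro connectedin_Un) auto
    moreover have "x ** c \<in> ?D" if "c \<in> C'" for c
      using generate.eng[of x GL S c] generate.incl[of c S GL] C C'(2) that by auto
    ultimately have "C \<union> (**) x ` C' \<in> ?\<C>" using C by auto
    then show ?thesis using C'(3) by blast
  qed
  have mult: "\<forall>x\<in>\<Union>?\<C>. x ** d \<in> \<Union>?\<C>" if "d \<in> ?D" for d
    using that
  proof induction
    case (inv h)
    then show ?case using assms(2) step by blast
  next
    case (eng h1 h2)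
    show ?case
    proof
      fix x assume "x \<in> \<Union>?\<C>"
      with eng.IH(1) have "x ** h1 \<in> \<Union>?\<C>" by (rule bspec)
      with eng.IH(2) have "x ** h1 ** h2 \<in> \<Union>?\<C>" by (rule bspec)
      then show "x ** (h1 \<otimes>\<^bsub>GL\<^esub> h2) \<in> \<Union>?\<C>" unfolding GL_mult matrix_mul_assoc .
    qed
  qed (use step in auto)
  have one: "mat 1 \<in> \<Union>?\<C>"
  proof
    show "{mat 1} \<in> ?\<C>" using generate.one[of GL S] by auto
  qed simp
  have "?D \<subseteq> \<Union>?\<C>"
  proof
    fix d assume "d \<in> ?D"
    then have "mat 1 ** d \<in> \<Union>?\<C>" using mult one by blast
    then show "d \<in> \<Union>?\<C>" by simp
  qed
  then have "?D = \<Union>?\<C>" by blast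
  moreover have "connectedin zariski (\<Union>?\<C>)" by (rule connectedin_Union) auto
  ultimately show ?thesis by simp
qed

text \<open>For fixed \<open>b\<close>, the commutators with \<open>b\<close> are the image of
  \<open>H\<close> under a continuous map sending 1 to 1. So every commutator is joined to 1 by a
  connected set of commutators, as \<open>connectedin_generate\<close> asks.\<close>

lemma connectedin_derived:
  fixes H :: "('K::field^'n::finite^'n) set"
  assumes H: "subgroup H GL" and conn: "connectedin zariski H"
  shows "connectedin zariski (derived GL H)"
  unfolding derived_def
proof (rule connectedin_generate)
  have HG: "H \<subseteq> carrier GL" using subgroup.subset[OF H] .
  note sub = subgroup.m_closed[OF H, simplified] subgroup.m_inv_closed[OF H]
  fix s assume "s \<in> derived_set GL H"
  then obtain a b where ab: "a \<in> H" "b \<in> H" and s: "s = a ** b ** ginv a ** ginv b" by auto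
  then have G: "a \<in> carrier GL" "b \<in> carrier GL" using HG by auto
  let ?F = "\<lambda>x. x ** b ** ginv x ** ginv b"
  have "ginv s = b ** a ** ginv b ** ginv a"
    by (simp add: s G GL_inv_mult matrix_mul_assoc)
  then show "ginv s \<in> derived_set GL H" using ab by auto
  have "continuous_map zariski zariski ?F"
    by (rule continuous_map_zariski)
       (auto simp: G intro!: regular_matrix_mult regular_const regular_entry regular_inv)
  then have "connectedin zariski (?F ` H)" using conn by (rule connectedin_continuous_map_image)
  moreover have "?F ` H \<subseteq> derived_set GL H" using ab by auto
  moreover have "mat 1 \<in> ?F ` H"
    using subgroup.one_closed[OF H] G by (intro image_eqI[of _ _ "mat 1"]) simp_all
  moreover have "s \<in> ?F ` H" using ab s by simp
  ultimately show "\<exists>C. connectedin zariski C \<and> C \<subseteq> derived_set GL H \<and> s \<in> C \<and> mat 1 \<in> C"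
    by (intro exI[of _ "?F ` H"] conjI)
qed

section \<open>Stable subspaces\<close>

definition stable :: "('K::field^'n::finite^'n) set \<Rightarrow> ('K^'n) set \<Rightarrow> bool" where
  "stable H V \<longleftrightarrow> (\<forall>h\<in>H. \<forall>v\<in>V. h *v v \<in> V)"

text \<open>The vector \<open>q(h) v\<close>, that is, the K[x]-module structure defined by
  \<open>h\<close>.\<close>

definition poly_act :: "'K::field^'n::finite^'n \<Rightarrow> 'K poly \<Rightarrow> 'K^'n \<Rightarrow> 'K^'n" where
  "poly_act h q v = (\<Sum>i\<le>Polynomial.degree q. poly.coeff q i *s (((*v) h ^^ i) v))"

lemma poly_act_bound:
  assumes "Polynomial.degree q \<le> N"
  shows "poly_act h q v = (\<Sum>i\<le>N. poly.coeff q i *s (((*v) h ^^ i) v))"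
  unfolding poly_act_def
  by (rule sum.mono_neutral_left) (use assms in \<open>auto simp: coeff_eq_0\<close>)

lemma poly_act_0 [simp]: "poly_act h 0 v = 0"
  by (simp add: poly_act_def)

lemma poly_act_pCons: "poly_act h (pCons a q) v = a *s v + h *v poly_act h q v"
proof -
  have "poly_act h (pCons a q) v = (\<Sum>i\<le>Suc (Polynomial.degree q). poly.coeff (pCons a q) i *s (((*v) h ^^ i) v))"
    by (rule poly_act_bound) (simp add: degree_pCons_le)
  also have "\<dots> = a *s v + (\<Sum>i\<le>Polynomial.degree q. poly.coeff q i *s (h *v (((*v) h ^^ i) v)))"
    by (subst sum.atMost_Suc_shift) simp
  also have "(\<Sum>i\<le>Polynomial.degree q. poly.coeff q i *s (h *v (((*v) h ^^ i) v))) = h *v poly_act h q v"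
    unfolding poly_act_def
    by (simp add: vec.linear_sum[OF matrix_vector_mul_linear_gen] vector_scalar_commute)
  finally show ?thesis .
qed

lemma poly_act_add: "poly_act h (p + q) v = poly_act h p v + poly_act h q v"
proof -
  let ?N = "max (Polynomial.degree p) (Polynomial.degree q)"
  have "Polynomial.degree (p + q) \<le> ?N" by (rule degree_add_le_max)
  then show ?thesis
    by (simp add: poly_act_bound[of _ ?N] vec.scale_left_distrib sum.distrib)
qed

lemma poly_act_smult: "poly_act h (Polynomial.smult a q) v = a *s poly_act h q v"
  by (simp add: poly_act_bound[OF degree_smult_le] poly_act_def vec.scale_sum_right)

lemma poly_act_mult: "poly_act h (p * q) v = poly_act h p (poly_act h q v)"
  by (induction p) (simp_all add: poly_act_add poly_act_smult poly_act_pCons mult_pCons_left)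

lemma poly_act_vec_add: "poly_act h q (v + w) = poly_act h q v + poly_act h q w"
  by (induction q) (simp_all add: poly_act_pCons matrix_vector_right_distrib vec.scale_right_distrib)

lemma poly_act_scale: "poly_act h q (a *s v) = a *s poly_act h q v"
  by (induction q)
     (simp_all add: poly_act_pCons vector_scalar_commute vec.scale_right_distrib mult.commute)

lemma poly_act_zero_vec [simp]: "poly_act h q 0 = 0"
  using poly_act_scale[of h q 0 0] by simp

lemma poly_act_sum: "poly_act h q (\<Sum>i\<in>I. f i) = (\<Sum>i\<in>I. poly_act h q (f i))"
  by (induction I rule: infinite_finite_induct) (simp_all add: poly_act_vec_add)

lemma poly_act_stable:
  assumes "vec.subspace V" "stable {h} V" "v \<in> V"
  shows "poly_act h q v \<in> V"
proof (induction q)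
  case 0
  show ?case using vec.subspace_0[OF assms(1)] by simp
next
  case (pCons a q)
  then show ?case
    using assms by (auto simp: poly_act_pCons stable_def intro: vec.subspace_add vec.subspace_scale)
qed

lemma annihilating_poly_vec:
  fixes h :: "'K::field^'n::finite^'n" and v :: "'K^'n"
  obtains q where "q \<noteq> 0" "poly_act h q v = 0"
proof (cases "inj (\<lambda>i. ((*v) h ^^ i) v)")
  \<comment> \<open>Linear dependence concerns sets of vectors, so a repetition among the vectors
    \<open>h^i v\<close> is treated apart; it gives the polynomial x^i - x^j.\<close>
  case False
  then obtain i j where ij: "i \<noteq> j" "((*v) h ^^ i) v = ((*v) h ^^ j) v" by (auto simp: inj_def)
  let ?q = "Polynomial.monom (1::'K) i + Polynomial.smult (- 1) (Polynomial.monom 1 j)"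
  have monom: "poly_act h (Polynomial.monom 1 i) v = ((*v) h ^^ i) v" for i
    by (simp add: poly_act_def degree_monom_eq coeff_monom if_distrib[of "\<lambda>c. c *s _"] sum.delta' cong: if_cong)
  have "poly.coeff ?q i = 1" using ij by (simp add: coeff_monom)
  then have "?q \<noteq> 0" by (metis Polynomial.coeff_0 zero_neq_one)
  moreover have "poly_act h ?q v = 0" unfolding poly_act_add poly_act_smult monom using ij by simp
  ultimately show thesis using that by blast
next
  case True
  let ?w = "\<lambda>i. ((*v) h ^^ i) v"
  let ?S = "?w ` {..CARD('n)}"
  have inj: "inj_on ?w {..CARD('n)}" using True by (rule inj_on_subset) simp
  have "card ?S = Suc (CARD('n))" using inj by (simp add: card_image)
  then have "vec.dependent ?S" using vec.independent_bound_general[of ?S] dim_subset_UNIV_cart_gen[of ?S]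
    by fastforce
  then obtain u where u: "\<exists>x\<in>?S. u x \<noteq> 0" "(\<Sum>x\<in>?S. u x *s x) = 0"
    using vec.dependent_finite[of ?S] by auto
  define q where "q = (\<Sum>i\<le>CARD('n). Polynomial.monom (u (?w i)) i)"
  have coeff: "poly.coeff q i = (if i \<le> CARD('n) then u (?w i) else 0)" for i
    unfolding q_def by (simp add: coeff_sum coeff_monom)
  have "Polynomial.degree q \<le> CARD('n)" by (rule degree_le) (simp add: coeff)
  then have "poly_act h q v = (\<Sum>i\<le>CARD('n). u (?w i) *s ?w i)"
    by (simp add: poly_act_bound coeff)
  also have "\<dots> = 0" using u(2) by (simp add: sum.reindex[OF inj])
  finally have "poly_act h q v = 0" .
  moreover obtain i where "i \<le> CARD('n)" "u (?w i) \<noteq> 0" using u(1) by auto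
  then have "q \<noteq> 0" using coeff[of i] by auto
  ultimately show thesis using that by blast
qed

text \<open>The product of annihilators of the unit vectors kills all of them, since any factor may
  be applied first.\<close>

lemma annihilating_poly:
  fixes h :: "'K::field^'n::finite^'n"
  obtains q where "q \<noteq> 0" "\<And>v. poly_act h q v = 0"
proof -
  have "\<exists>q. q \<noteq> 0 \<and> poly_act h q (axis i 1) = 0" for i :: 'n
    using annihilating_poly_vec[of h "axis i 1"] by metis
  then obtain p where p: "\<And>i. p i \<noteq> 0" "\<And>i. poly_act h (p i) (axis i 1) = 0" by metis
  define q where "q = (\<Prod>i\<in>UNIV. p i)"
  have axis: "poly_act h q (axis i 1) = 0" for i
  proof -
    have "q = (\<Prod>j\<in>UNIV - {i}. p j) * p i"
      unfolding q_def by (subst prod.remove[of _ i]) (auto simp: mult.commute)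
    then show ?thesis by (simp add: poly_act_mult p)
  qed
  have "poly_act h q v = 0" for v
  proof -
    have "v = (\<Sum>i\<in>UNIV. v $ i *s axis i 1)" by (simp add: basis_expansion)
    then show ?thesis by (metis (no_types, lifting) axis poly_act_scale poly_act_sum sum.neutral vec.scale_zero_right)
  qed
  moreover have "q \<noteq> 0" using p(1) by (simp add: q_def)
  ultimately show thesis using that by blast
qed

text \<open>These are the eigenvalues on the quotient by \<open>U\<close>. For such a
  \<open>w\<close>, the vector \<open>q(h) w\<close> is congruent to \<open>q(c) w\<close> modulo
  \<open>U\<close>, so \<open>c\<close> is a root of every polynomial that annihilates
  \<open>h\<close>.\<close>

lemma finite_eigenvalues_mod:
  fixes h :: "'K::field^'n::finite^'n"
  assumes U: "vec.subspace U" and st: "stable {h} U"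
  shows "finite {c. \<exists>w. w \<notin> U \<and> h *v w - c *s w \<in> U}"
proof -
  obtain q where q: "q \<noteq> 0" "\<And>v. poly_act h q v = 0" using annihilating_poly[of h] by blast
  have "poly q c = 0" if w: "w \<notin> U" "h *v w - c *s w \<in> U" for c w
  proof -
    have "poly_act h p w - poly p c *s w \<in> U" for p
    proof (induction p)
      case 0
      then show ?case using vec.subspace_0[OF U] by simp
    next
      case (pCons a p)
      have "poly_act h (pCons a p) w - poly (pCons a p) c *s w
          = h *v (poly_act h p w - poly p c *s w) + poly p c *s (h *v w - c *s w)"
        by (simp add: poly_act_pCons vec.scale_left_distrib vec.scale_right_diff_distrib
            matrix_vector_mult_diff_distrib vector_scalar_commute mult.commute)
      moreover have "h *v (poly_act h p w - poly p c *s w) \<in> U"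
        using pCons st by (auto simp: stable_def)
      moreover have "poly p c *s (h *v w - c *s w) \<in> U" using w(2) by (rule vec.subspace_scale[OF U])
      ultimately show ?case using vec.subspace_add[OF U] by metis
    qed
    from this[of q] have "poly q c *s w \<in> U" using vec.subspace_neg[OF U] by (fastforce simp: q(2))
    then have "inverse (poly q c) *s (poly q c *s w) \<in> U" by (rule vec.subspace_scale[OF U])
    then show ?thesis using w(1) by (cases "poly q c = 0") auto
  qed
  then have "{c. \<exists>w. w \<notin> U \<and> h *v w - c *s w \<in> U} \<subseteq> {c. poly q c = 0}" by auto
  then show ?thesis using poly_roots_finite[OF q(1)] by (rule finite_subset)
qed

text \<open>Linear factors are split off a polynomial with \<open>q(h) v\<close> in
  \<open>U\<close>: if q = (x - c) p, then either \<open>p(h) v\<close> lies in \<open>U\<close> and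
  \<open>p\<close> replaces \<open>q\<close>, or \<open>p(h) v\<close> is the eigenvector.\<close>

lemma exists_eigenvector_mod:
  fixes h :: "'K::alg_closed_field^'n::finite^'n"
  assumes U: "vec.subspace U" and V: "vec.subspace V" and st: "stable {h} V"
    and v: "v \<in> V" "v \<notin> U"
  obtains w c where "w \<in> V" "w \<notin> U" "h *v w - c *s w \<in> U"
proof -
  obtain q where q: "q \<noteq> 0" "poly_act h q v = 0" by (rule annihilating_poly_vec)
  have "\<exists>w c. w \<in> V \<and> w \<notin> U \<and> h *v w - c *s w \<in> U" if "q \<noteq> 0" "poly_act h q v \<in> U" for q
    using that
  proof (induction "Polynomial.degree q" arbitrary: q rule: less_induct)
    case less
    have "Polynomial.degree q > 0"
    proof (rule ccontr)
      assume "\<not> Polynomial.degree q > 0"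
      then obtain a where a: "q = [:a:]" by (metis degree_eq_zeroE gr0I)
      then have "a *s v \<in> U" using less.prems by (simp add: poly_act_pCons)
      then have "inverse a *s (a *s v) \<in> U" by (rule vec.subspace_scale[OF U])
      then show False using a less.prems v by auto
    qed
    then obtain c where "poly q c = 0" using alg_closed_imp_poly_has_root by blast
    then obtain p where p: "q = [:- c, 1:] * p" by (metis dvdE poly_eq_0_iff_dvd)
    let ?w = "poly_act h p v"
    have eq: "poly_act h q v = h *v ?w - c *s ?w"
      unfolding p poly_act_mult by (simp add: poly_act_pCons)
    show ?case
    proof (cases "?w \<in> U")
      case True
      have "p \<noteq> 0" using p less.prems by auto
      moreover have "Polynomial.degree p < Polynomial.degree q"
        unfolding p using \<open>p \<noteq> 0\<close> by (subst degree_mult_eq) auto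
      ultimately show ?thesis using less.hyps True by blast
    next
      case False
      then show ?thesis using eq less.prems poly_act_stable[OF V st v(1)] by metis
    qed
  qed
  then show thesis using q that vec.subspace_0[OF U] by metis
qed

text \<open>The coordinates along the vectors that complete a basis of \<open>U\<close> to a basis
  of the whole space serve as equations. They turn membership in \<open>U\<close> into a Zariski
  closed condition.\<close>

lemma subspace_linear_equations:
  fixes U :: "('K::field^'n::finite) set"
  assumes U: "vec.subspace U"
  obtains L :: "('K^'n) set" where "finite L" "\<And>x. x \<in> U \<longleftrightarrow> (\<forall>l\<in>L. (\<Sum>i\<in>UNIV. l $ i * x $ i) = 0)"
proof -
  obtain B0 where B0: "B0 \<subseteq> U" "vec.independent B0" "U \<subseteq> vec.span B0"
    using vec.maximal_independent_subset by metis
  have spanB0: "vec.span B0 = U" using B0 U by (metis subset_antisym vec.span_minimal)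
  define B where "B = vec.extend_basis B0"
  have B: "B0 \<subseteq> B" "vec.independent B" "vec.span B = UNIV"
    using vec.extend_basis_superset[OF B0(2)] vec.independent_extend_basis[OF B0(2)]
      vec.span_extend_basis[OF B0(2)] by (simp_all add: B_def)
  have finB: "finite B" using B(2) by (rule vec.finiteI_independent)
  define l where "l b = (\<chi> i. vec.representation B (axis i 1) b)" for b
  have rep: "vec.representation B x b = (\<Sum>i\<in>UNIV. l b $ i * x $ i)" for x b
  proof -
    have "vec.representation B x b = vec.representation B (\<Sum>i\<in>UNIV. x $ i *s axis i 1) b"
      by (simp add: basis_expansion)
    also have "\<dots> = (\<Sum>i\<in>UNIV. x $ i * vec.representation B (axis i 1) b)"
      using B by (simp add: vec.representation_sum vec.representation_scale)
    finally show ?thesis by (simp add: l_def mult.commute)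
  qed
  have "x \<in> U \<longleftrightarrow> (\<forall>l\<in>l ` (B - B0). (\<Sum>i\<in>UNIV. l $ i * x $ i) = 0)" for x
  proof -
    have "x \<in> U \<longleftrightarrow> (\<forall>b\<in>B - B0. vec.representation B x b = 0)"
    proof
      assume "x \<in> U"
      then have "x \<in> vec.span B0" by (simp add: spanB0)
      then have "vec.representation B x = vec.representation B0 x"
        using B by (intro vec.representation_extend)
      then show "\<forall>b\<in>B - B0. vec.representation B x b = 0"
        using vec.representation_ne_zero by fastforce
    next
      assume 0: "\<forall>b\<in>B - B0. vec.representation B x b = 0"
      have "x = (\<Sum>b\<in>B. vec.representation B x b *s b)"
        using B finB by (simp add: vec.sum_representation_eq)
      also have "\<dots> = (\<Sum>b\<in>B0. vec.representation B x b *s b)"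
        using finB B(1) 0 by (intro sum.mono_neutral_right) auto
      also have "\<dots> \<in> U" using B0 U by (intro vec.subspace_sum vec.subspace_scale) auto
      finally show "x \<in> U" .
    qed
    then show ?thesis by (simp add: rep)
  qed
  then show thesis using that[of "l ` (B - B0)"] finB by blast
qed

section \<open>The theorem of Lie and Kolchin\<close>

text \<open>
  For connected \<open>H\<close>, an eigenvalue of \<open>h\<close> modulo \<open>U\<close> on the vectors \<open>x w\<close>, \<open>x \<in> H\<close>, cannot depend
  on \<open>x\<close>, since \<open>h\<close> has finitely many eigenvalues.
\<close>

lemma eigenvalue_mod_constant:
  fixes H :: "('K::field^'n::finite^'n) set"
  assumes H: "subgroup H GL" and conn: "connectedin zariski H"
    and U: "vec.subspace U" and stH: "stable H U" and sth: "stable {h} U"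
    and w: "w \<notin> U" and ev: "\<And>x. x \<in> H \<Longrightarrow> \<exists>c. h *v (x *v w) - c *s (x *v w) \<in> U"
    and c: "h *v w - c *s w \<in> U" and x: "x \<in> H"
  shows "h *v (x *v w) - c *s (x *v w) \<in> U"
proof -
  have HG: "H \<subseteq> carrier GL" using subgroup.subset[OF H] .
  have notin: "x *v w \<notin> U" if "x \<in> H" for x
  proof
    assume "x *v w \<in> U"
    then have "ginv x *v (x *v w) \<in> U"
      using stH subgroup.m_inv_closed[OF H that] by (auto simp: stable_def)
    then show False using w that HG by (auto simp: matrix_vector_mul_assoc)
  qed
  have uniq: "a = b" if "h *v (x *v w) - a *s (x *v w) \<in> U" "h *v (x *v w) - b *s (x *v w) \<in> U" "x \<in> H" for a b x
  proof (rule ccontr)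
    assume "a \<noteq> b"
    have "(b - a) *s (x *v w) \<in> U"
      using vec.subspace_diff[OF U that(1,2)] by (simp add: vec.scale_left_diff_distrib)
    then have "inverse (b - a) *s ((b - a) *s (x *v w)) \<in> U" by (rule vec.subspace_scale[OF U])
    then show False using \<open>a \<noteq> b\<close> notin[OF that(3)] unfolding vec.scale_scale by simp
  qed
  obtain f where f: "\<And>x. x \<in> H \<Longrightarrow> h *v (x *v w) - f x *s (x *v w) \<in> U" using ev by metis
  obtain L where L: "finite L" "\<And>x. x \<in> U \<longleftrightarrow> (\<forall>l\<in>L. (\<Sum>i\<in>UNIV. l $ i * x $ i) = 0)"
    using subspace_linear_equations[OF U] by blast
  have "f x = f (mat 1)"
  proof (rule connectedin_level_sets[OF conn])
    have "f ` H \<subseteq> {c. \<exists>w. w \<notin> U \<and> h *v w - c *s w \<in> U}" using f notin by blast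
    then show "finite (f ` H)" using finite_eigenvalues_mod[OF U sth] by (rule finite_subset)
  next
    fix c assume "c \<in> f ` H"
    \<comment> \<open>For fixed \<open>c\<close> these conditions are linear in the entries of
      \<open>x\<close>, so the level set of \<open>f\<close> at \<open>c\<close> is closed in
      \<open>H\<close>.\<close>
    let ?Z = "\<lambda>l. {x \<in> carrier GL. (\<Sum>i\<in>UNIV. l $ i * (h *v (x *v w) - c *s (x *v w)) $ i) = 0}"
    have "closedin zariski (?Z l)" for l
    proof (rule closedin_zariski_regular)
      show "regular (\<lambda>x. \<Sum>i\<in>UNIV. l $ i * (h *v (x *v w) - c *s (x *v w)) $ i)"
        unfolding matrix_vector_mult_def
        by (simp, intro regular_poly_fun poly_fun_sum poly_fun_mult poly_fun_diff poly_fun_const poly_fun_entry)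
    qed
    then have "closedin zariski (carrier GL \<inter> (\<Inter>l\<in>L. ?Z l))"
      using closedin_topspace[of "zariski :: ('K^'n^'n) topology"]
      by (cases "L = {}") (auto intro!: closedin_Int closedin_Inter)
    moreover have "H \<inter> (carrier GL \<inter> (\<Inter>l\<in>L. ?Z l)) = {x \<in> H. h *v (x *v w) - c *s (x *v w) \<in> U}"
      using HG by (auto simp: L(2))
    moreover have "\<dots> = {x \<in> H. f x = c}" using f uniq by blast
    ultimately show "\<exists>Z. closedin zariski Z \<and> H \<inter> Z = {x \<in> H. f x = c}" by auto
  qed (use x subgroup.one_closed[OF H] in auto)
  moreover have "f (mat 1) = c"
    using uniq[of "mat 1" "f (mat 1)" c] f[of "mat 1"] c subgroup.one_closed[OF H] by simp
  ultimately show ?thesis using f[OF x] by simp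
qed

text \<open>Congruences modulo \<open>U\<close> stand for the quotient space. Choose
  \<open>W\<close> so that \<open>W / U\<close> is a simple \<open>H\<close>-module. By induction
  the derived group has a common eigenvector in it; its weight space is \<open>H\<close>-stable, so
  the derived group acts on \<open>W / U\<close> by scalars. Hence an eigenspace of any
  \<open>h\<close> in \<open>H\<close> is also \<open>H\<close>-stable, and \<open>h\<close> itself
  acts by a scalar.\<close>

lemma common_eigenvector_mod:
  fixes H :: "('K::alg_closed_field^'n::finite^'n) set"
  assumes "subgroup H GL" "connectedin zariski H" "(derived GL ^^ m) H = {mat 1}"
    and "vec.subspace U" "vec.subspace V" "U \<subset> V" "stable H U" "stable H V"
  shows "\<exists>v\<in>V - U. \<forall>h\<in>H. \<exists>c. h *v v - c *s v \<in> U"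
  using assms
proof (induction m arbitrary: H V)
  case 0
  have "mat 1 *v v - 1 *s v \<in> U" for v using vec.subspace_0[OF \<open>vec.subspace U\<close>] by simp
  then have "\<forall>h\<in>H. \<exists>c. h *v v - c *s v \<in> U" for v using 0(3) by (auto intro!: exI[of _ 1])
  then show ?case using 0(6) by blast
next
  case (Suc m)
  note H = Suc.prems(1) and conn = Suc.prems(2) and U = Suc.prems(4) and stU = Suc.prems(7)
  have HG: "H \<subseteq> carrier GL" using subgroup.subset[OF H] .
  define D where "D = derived GL H"
  have D: "subgroup D GL" "connectedin zariski D" "(derived GL ^^ m) D = {mat 1}"
    using GL.derived_is_subgroup[OF HG] connectedin_derived[OF H conn] Suc.prems(3)
    by (simp_all add: D_def funpow_swap1)
  have DH: "D \<subseteq> H" unfolding D_def by (rule GL.derived_incl[OF subset_refl H])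
  have stsub: "stable S Y" if "stable H Y" "S \<subseteq> H" for S Y using that by (auto simp: stable_def)
  define P where "P W \<longleftrightarrow> vec.subspace W \<and> U \<subset> W \<and> W \<subseteq> V \<and> stable H W" for W
  have "\<exists>W. P W \<and> (\<forall>W'. P W' \<longrightarrow> vec.dim W \<le> vec.dim W')"
    using ex_has_least_nat[of P V vec.dim] Suc.prems by (auto simp: P_def)
  then obtain W where PW: "P W" and min: "\<And>W'. P W' \<Longrightarrow> vec.dim W \<le> vec.dim W'" by blast
  then have W: "vec.subspace W" "U \<subset> W" "W \<subseteq> V" "stable H W" by (auto simp: P_def)
  have minimal: "W' = W" if W': "vec.subspace W'" "U \<subseteq> W'" "W' \<subseteq> W" "stable H W'" "\<not> W' \<subseteq> U" for W'
  proof (rule vec.subspace_dim_equal)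
    show "vec.dim W \<le> vec.dim W'" by (rule min) (use W' W in \<open>auto simp: P_def\<close>)
  qed (use W' W in auto)
  have eigenspace: "vec.subspace {w \<in> W. h *v w - c *s w \<in> U}" for h c
  proof (rule vec.subspaceI)
    show "0 \<in> {w \<in> W. h *v w - c *s w \<in> U}"
      using vec.subspace_0[OF W(1)] vec.subspace_0[OF U] by simp
  next
    fix a b assume ab: "a \<in> {w \<in> W. h *v w - c *s w \<in> U}" "b \<in> {w \<in> W. h *v w - c *s w \<in> U}"
    have "h *v (a + b) - c *s (a + b) = (h *v a - c *s a) + (h *v b - c *s b)"
      by (simp add: matrix_vector_right_distrib vec.scale_right_distrib)
    moreover have "(h *v a - c *s a) + (h *v b - c *s b) \<in> U"
      using ab by (intro vec.subspace_add[OF U]) auto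
    ultimately show "a + b \<in> {w \<in> W. h *v w - c *s w \<in> U}"
      using ab vec.subspace_add[OF W(1)] by (metis (mono_tags, lifting) mem_Collect_eq)
  next
    fix e a assume a: "a \<in> {w \<in> W. h *v w - c *s w \<in> U}"
    have "h *v (e *s a) - c *s (e *s a) = e *s (h *v a - c *s a)"
      by (simp add: vector_scalar_commute vec.scale_right_diff_distrib mult.commute)
    moreover have "e *s (h *v a - c *s a) \<in> U"
      using a by (intro vec.subspace_scale[OF U]) auto
    ultimately show "e *s a \<in> {w \<in> W. h *v w - c *s w \<in> U}"
      using a vec.subspace_scale[OF W(1)] by (metis (mono_tags, lifting) mem_Collect_eq)
  qed
  have Uin: "h *v w - c *s w \<in> U" if "h \<in> H" "w \<in> U" for h w c
    using that U stU by (auto simp: stable_def intro: vec.subspace_diff vec.subspace_scale)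
  obtain v \<psi> where v: "v \<in> W" "v \<notin> U" and \<psi>: "\<And>d. d \<in> D \<Longrightarrow> d *v v - \<psi> d *s v \<in> U"
    using Suc.IH[OF D U W(1,2) stsub[OF stU DH] stsub[OF W(4) DH]] by (metis DiffE)
  have scal: "x *v a - c *s (x *v w) = x *v (a - c *s w)" for x :: "'K^'n^'n" and a c w
    by (simp add: matrix_vector_mult_diff_distrib vector_scalar_commute)
  have Dscalar: "d *v w - \<psi> d *s w \<in> U" if w: "w \<in> W" and d: "d \<in> D" for w d
  proof -
    let ?W = "{w \<in> W. \<forall>d\<in>D. d *v w - \<psi> d *s w \<in> U}"
    have "?W = W"
    proof (rule minimal)
      have eq: "?W = (if D = {} then W else \<Inter>d\<in>D. {w \<in> W. d *v w - \<psi> d *s w \<in> U})" by auto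
      show "vec.subspace ?W" unfolding eq using W(1) eigenspace by (auto intro!: vec.subspace_Inter)
      show "stable H ?W"
        unfolding stable_def
      proof (intro ballI CollectI conjI)
        fix x w d assume x: "x \<in> H" and w: "w \<in> ?W" and d: "d \<in> D"
        show "d *v (x *v w) - \<psi> d *s (x *v w) \<in> U"
        proof (cases "w \<in> U")
          case True
          then show ?thesis using x d DH Uin stU by (auto simp: stable_def)
        next
          case False
          show ?thesis
          proof (rule eigenvalue_mod_constant[OF H conn U stU _ False _ _ x])
            \<comment> \<open>\<open>d (y w) = y (y^-1 d y) w\<close>, and \<open>y^-1 d y\<close>
              is again in \<open>D\<close>, because it is a commutator times
              \<open>d\<close>.\<close>
            fix y assume y: "y \<in> H"
            let ?e = "ginv y ** d ** y"
            have yG: "y \<in> carrier GL" "d \<in> carrier GL" using y d DH HG by auto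
            have "?e \<in> D"
            proof -
              have "?e = ((ginv y) \<otimes>\<^bsub>GL\<^esub> d \<otimes>\<^bsub>GL\<^esub> ginv (ginv y) \<otimes>\<^bsub>GL\<^esub> ginv d) ** d"
                using yG by (simp flip: matrix_mul_assoc)
              moreover have "(ginv y) \<otimes>\<^bsub>GL\<^esub> d \<otimes>\<^bsub>GL\<^esub> ginv (ginv y) \<otimes>\<^bsub>GL\<^esub> ginv d \<in> derived_set GL H"
                using subgroup.m_inv_closed[OF H y] d DH by blast
              ultimately show ?thesis
                using subgroup.m_closed[OF D(1) _ d] generate.incl[of _ "derived_set GL H" GL]
                unfolding D_def derived_def by auto
            qed
            then have "y *v (?e *v w - \<psi> ?e *s w) \<in> U" using w y stU by (auto simp: stable_def)
            moreover have "y *v (?e *v w) = d *v (y *v w)"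
              using yG by (simp add: matrix_vector_mul_assoc matrix_mul_assoc[symmetric])
            ultimately show "\<exists>c. d *v (y *v w) - c *s (y *v w) \<in> U" by (metis scal)
          qed (use w d DH stU in \<open>auto simp: stable_def\<close>)
        qed
      qed (use W(4) in \<open>auto simp: stable_def\<close>)
    qed (use W(2) Uin DH v \<psi> in auto)
    then show ?thesis using w d by blast
  qed
  have Hscalar: "\<exists>c. \<forall>w\<in>W. h *v w - c *s w \<in> U" if h: "h \<in> H" for h
  proof -
    obtain w0 c where w0: "w0 \<in> W" "w0 \<notin> U" "h *v w0 - c *s w0 \<in> U"
      using exists_eigenvector_mod[OF U W(1) stsub[OF W(4), of "{h}"] v] h by auto
    let ?W = "{w \<in> W. h *v w - c *s w \<in> U}"
    have "?W = W"
    proof (rule minimal)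
      show "vec.subspace ?W" by (rule eigenspace)
      show "stable H ?W"
        unfolding stable_def
      proof (intro ballI CollectI conjI)
        fix x w assume x: "x \<in> H" and w: "w \<in> ?W"
        show "h *v (x *v w) - c *s (x *v w) \<in> U"
        proof (cases "w \<in> U")
          case True
          then show ?thesis using x h Uin stU by (auto simp: stable_def)
        next
          case False
          show ?thesis
          proof (rule eigenvalue_mod_constant[OF H conn U stU _ False _ _ x])
            fix y assume y: "y \<in> H"
            \<comment> \<open>This commutator satisfies \<open>h y = y h d\<close> and acts by the
              scalar \<open>\<psi> d\<close> modulo \<open>U\<close>, so \<open>y w\<close> is again
              an eigenvector of \<open>h\<close>; its eigenvalue is then \<open>c\<close> by
              connectedness.\<close>
            let ?d = "ginv h ** ginv y ** h ** y"
            have G: "y \<in> carrier GL" "h \<in> carrier GL" using y h HG by auto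
            have "?d \<in> D"
            proof -
              have "?d = (ginv h) \<otimes>\<^bsub>GL\<^esub> (ginv y) \<otimes>\<^bsub>GL\<^esub> ginv (ginv h) \<otimes>\<^bsub>GL\<^esub> ginv (ginv y)"
                using G by simp
              then have "?d \<in> derived_set GL H" using subgroup.m_inv_closed[OF H] h y by blast
              then show ?thesis unfolding D_def derived_def by (rule generate.incl)
            qed
            then have 1: "y *v (h *v (?d *v w - \<psi> ?d *s w)) \<in> U"
              using Dscalar w h y stU by (auto simp: stable_def)
            have 2: "\<psi> ?d *s (y *v (h *v w - c *s w)) \<in> U"
              using w y stU U by (auto simp: stable_def intro: vec.subspace_scale)
            have "h *v (y *v w) = y *v (h *v (?d *v w))"
              using G by (simp add: matrix_vector_mul_assoc matrix_mul_assoc[symmetric])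
            then have "h *v (y *v w) - (\<psi> ?d * c) *s (y *v w)
                = y *v (h *v (?d *v w - \<psi> ?d *s w)) + \<psi> ?d *s (y *v (h *v w - c *s w))"
              by (simp add: matrix_vector_mult_diff_distrib vector_scalar_commute vec.scale_right_diff_distrib)
            then show "\<exists>c. h *v (y *v w) - c *s (y *v w) \<in> U"
              using vec.subspace_add[OF U 1 2] by metis
          qed (use w h stU in \<open>auto simp: stable_def\<close>)
        qed
      qed (use W(4) in \<open>auto simp: stable_def\<close>)
    qed (use W(2) Uin h w0 in auto)
    then show ?thesis by blast
  qed
  then have "\<forall>h\<in>H. \<exists>c. h *v v - c *s v \<in> U" using v(1) by blast
  then show ?case using v W(3) by blast
qed

section \<open>Flags spanned by the columns of a matrix\<close>

definition flag :: "'K::field^'n::finite^'n \<Rightarrow> ('n \<Rightarrow> nat) \<Rightarrow> nat \<Rightarrow> ('K^'n) set" where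
  "flag g r m = {g *v c | c. \<forall>i. m \<le> r i \<longrightarrow> c $ i = 0}"

lemma flag_iff:
  fixes g :: "'K::field^'n::finite^'n"
  shows "g \<in> carrier GL \<Longrightarrow> v \<in> flag g r m \<longleftrightarrow> (\<forall>i. m \<le> r i \<longrightarrow> (ginv g *v v) $ i = 0)"
  unfolding flag_def
  by (auto simp: matrix_vector_mul_assoc intro!: exI[of _ "ginv g *v v"])

lemma subspace_flag: "vec.subspace (flag g r m)"
proof (rule vec.subspaceI)
  show "0 \<in> flag g r m" unfolding flag_def by (rule CollectI, rule exI[of _ 0]) simp
next
  fix x y assume "x \<in> flag g r m" "y \<in> flag g r m"
  then obtain a b where "x = g *v a" "\<forall>i. m \<le> r i \<longrightarrow> a $ i = 0" "y = g *v b" "\<forall>i. m \<le> r i \<longrightarrow> b $ i = 0"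
    by (auto simp: flag_def)
  then show "x + y \<in> flag g r m"
    unfolding flag_def by (intro CollectI exI[of _ "a + b"]) (simp add: matrix_vector_right_distrib)
next
  fix c x assume "x \<in> flag g r m"
  then obtain a where "x = g *v a" "\<forall>i. m \<le> r i \<longrightarrow> a $ i = 0" by (auto simp: flag_def)
  then show "c *s x \<in> flag g r m"
    unfolding flag_def by (intro CollectI exI[of _ "c *s a"]) (simp add: vector_scalar_commute)
qed

lemma column_mult: "column j (A ** B) = A *v column j B"
  by (simp add: vec_eq_iff column_def matrix_matrix_mult_def matrix_vector_mult_def)

lemma column_in_flag:
  fixes g :: "'K::field^'n::finite^'n"
  assumes "g \<in> carrier GL"
  shows "column j g \<in> flag g r m \<longleftrightarrow> r j < m"
proof -
  have "ginv g *v column j g = column j (mat 1)"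
    using assms by (simp flip: column_mult)
  then show ?thesis by (auto simp: flag_iff[OF assms] column_def mat_def not_le[symmetric])
qed

text \<open>Being triangular in the basis of the columns of \<open>g\<close> means preserving their
  flag, and this can be tested on the columns.\<close>

lemma Ad_inv_upper_iff:
  fixes g x :: "'K::field^'n::finite^'n"
  assumes "g \<in> carrier GL"
  shows "Ad (ginv g) x \<in> upper r \<longleftrightarrow> (\<forall>j. x *v column j g \<in> flag g r (Suc (r j)))"
proof -
  have "Ad (ginv g) x $ i $ j = (ginv g *v (x *v column j g)) $ i" for i j
  proof -
    have "Ad (ginv g) x $ i $ j = column j (ginv g ** (x ** g)) $ i"
      using assms by (simp add: Ad_def column_def matrix_mul_assoc)
    then show ?thesis by (simp add: column_mult)
  qed
  then show ?thesis by (auto simp: upper_def flag_iff[OF assms] Suc_le_eq)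
qed

theorem lie_kolchin:
  fixes H :: "('K::alg_closed_field^'n::finite^'n) set" and r :: "'n \<Rightarrow> nat"
  assumes H: "subgroup H GL" and conn: "connectedin zariski H" and solv: "solvable (GL\<lparr>carrier := H\<rparr>)"
    and r: "bij_betw r UNIV {..<CARD('n)}"
  obtains g where "g \<in> carrier GL" "\<And>h. h \<in> H \<Longrightarrow> Ad (ginv g) h \<in> upper r"
proof -
  have HG: "H \<subseteq> carrier GL" using subgroup.subset[OF H] .
  interpret HH: group "GL\<lparr>carrier := H\<rparr>" by (rule GL.subgroup_imp_group[OF H])
  obtain m where m: "(derived (GL\<lparr>carrier := H\<rparr>) ^^ m) H = {mat 1}"
    using HH.solvable_iff_trivial_derived_seq solv by auto
  have "(derived (GL\<lparr>carrier := H\<rparr>) ^^ k) H = (derived GL ^^ k) H \<and> (derived GL ^^ k) H \<subseteq> H" for k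
  proof (induction k)
    case (Suc k)
    then show ?case using GL.derived_consistent[OF _ H] GL.derived_incl[OF _ H] by auto
  qed simp
  then have dm: "(derived GL ^^ m) H = {mat 1}" using m by metis
  \<comment> \<open>Each \<open>v i\<close> is a common eigenvector modulo the span of its
    predecessors; the second clause keeps these spans stable, so that the construction can go
    on.\<close>
  have "\<exists>v :: nat \<Rightarrow> 'K^'n. (\<forall>i<k. v i \<notin> vec.span (v ` {..<i})) \<and>
      (\<forall>i<k. \<forall>h\<in>H. h *v v i \<in> vec.span (v ` {..i}))" if "k \<le> CARD('n)" for k
    using that
  proof (induction k)
    case (Suc k)
    then obtain v :: "nat \<Rightarrow> 'K^'n" where v: "\<And>i. i < k \<Longrightarrow> v i \<notin> vec.span (v ` {..<i})"
        "\<And>i h. i < k \<Longrightarrow> h \<in> H \<Longrightarrow> h *v v i \<in> vec.span (v ` {..i})" by force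
    let ?U = "vec.span (v ` {..<k})"
    have stU: "stable H ?U"
      unfolding stable_def
    proof (intro ballI)
      fix h w assume h: "h \<in> H" and w: "w \<in> ?U"
      show "h *v w \<in> ?U" using w
      proof (induction rule: vec.span_induct_alt)
        case base
        then show ?case by (simp add: vec.span_zero)
      next
        case (step c x y)
        then obtain i where i: "i < k" "x = v i" by auto
        have "vec.span (v ` {..i}) \<subseteq> ?U" using i by (intro vec.span_mono image_mono) auto
        then have "h *v x \<in> ?U" using v(2)[OF i(1) h] i by auto
        then show ?case using step
          by (simp add: matrix_vector_right_distrib vector_scalar_commute vec.span_add vec.span_scale)
      qed
    qed
    have "vec.dim ?U \<le> k"
      using vec.dim_le_card'[of "v ` {..<k}"] card_image_le[of "{..<k}" v] by simp
    have "?U \<noteq> UNIV"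
    proof
      assume eq: "?U = UNIV"
      have "vec.dim ?U = CARD('n)" unfolding eq by (rule vec_dim_card)
      then show False using \<open>vec.dim ?U \<le> k\<close> Suc.prems by simp
    qed
    then have "?U \<subset> UNIV" by blast
    moreover have stUNIV: "stable H UNIV" by (simp add: stable_def)
    ultimately obtain w where w: "w \<notin> ?U" "\<And>h. h \<in> H \<Longrightarrow> \<exists>c. h *v w - c *s w \<in> ?U"
      using common_eigenvector_mod[OF H conn dm vec.subspace_span vec.subspace_UNIV _ stU] stUNIV by blast
    let ?v = "v(k := w)"
    have im: "?v ` {..<i} = v ` {..<i}" if "i \<le> k" for i using that by auto
    have im': "?v ` {..i} = v ` {..i}" if "i < k" for i using that by auto
    have imk: "?v ` {..k} = insert w (v ` {..<k})" by (auto simp: le_less)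
    have hw: "h *v w \<in> vec.span (insert w (v ` {..<k}))" if "h \<in> H" for h
      using w(2)[OF that] by (auto simp: vec.span_breakdown_eq)
    have "\<forall>i<Suc k. ?v i \<notin> vec.span (?v ` {..<i})"
    proof (intro allI impI)
      fix i assume "i < Suc k"
      then show "?v i \<notin> vec.span (?v ` {..<i})"
        using v(1)[of i] w(1) im[of i] by (cases "i = k") simp_all
    qed
    moreover have "\<forall>i<Suc k. \<forall>h\<in>H. h *v ?v i \<in> vec.span (?v ` {..i})"
    proof (intro allI impI ballI)
      fix i h assume "i < Suc k" "h \<in> H"
      then show "h *v ?v i \<in> vec.span (?v ` {..i})"
        using v(2) hw im' imk by (cases "i = k") auto
    qed
    ultimately show ?case by blast
  qed simp
  from this[OF order_refl] obtain v :: "nat \<Rightarrow> 'K^'n"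
    where v1: "\<And>i. i < CARD('n) \<Longrightarrow> v i \<notin> vec.span (v ` {..<i})"
      and v2: "\<And>i h. i < CARD('n) \<Longrightarrow> h \<in> H \<Longrightarrow> h *v v i \<in> vec.span (v ` {..i})" by blast
  have r_less: "r i < CARD('n)" for i using r by (auto simp: bij_betw_def)
  have inj: "inj r" using r by (simp add: bij_betw_def)
  \<comment> \<open>Column \<open>j\<close> carries the vector with number \<open>r j\<close>, so
    that the spans of initial segments form the flag of \<open>g\<close>.\<close>
  define g :: "'K^'n^'n" where "g = (\<chi> i j. v (r j) $ i)"
  have col: "column j g = v (r j)" for j by (simp add: g_def column_def vec_eq_iff)
  have span_flag: "x \<in> flag g r m" if x: "x \<in> vec.span (v ` {..<m})" and m: "m \<le> CARD('n)" for x m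
    using x
  proof (induction rule: vec.span_induct_alt)
    case base
    show ?case unfolding flag_def by (rule CollectI, rule exI[of _ 0]) simp
  next
    case (step c x y)
    then obtain i where i: "i < m" "x = v i" by auto
    then obtain j where j: "r j = i" using r m by (metis bij_betw_iff_bijections lessThan_iff less_le_trans)
    obtain a where a: "y = g *v a" "\<forall>i. m \<le> r i \<longrightarrow> a $ i = 0" using step.IH by (auto simp: flag_def)
    have "g *v axis j 1 = x" using col[of j] i j by (simp add: matrix_vector_mul_component vec_eq_iff matrix_vector_mult_def axis_def column_def if_distrib cong: if_cong)
    then have "c *s x + y = g *v (c *s axis j 1 + a)"
      by (simp add: matrix_vector_right_distrib vector_scalar_commute a)
    then show ?case unfolding flag_def using a i j by (auto intro!: exI[of _ "c *s axis j 1 + a"] simp: axis_def)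
  qed
  have "vec.independent (v ` {..<k})" if "k \<le> CARD('n)" for k
    using that
  proof (induction k)
    case (Suc k)
    then show ?case using v1[of k] by (simp add: lessThan_Suc vec.independent_insertI)
  qed (simp add: vec.independent_empty)
  then have indep: "vec.independent (v ` {..<CARD('n)})" by simp
  have vinj: "inj_on v {..<CARD('n)}"
  proof (rule linorder_inj_onI)
    fix x y :: nat assume "x < y" "y \<in> {..<CARD('n)}"
    moreover have "v x \<in> vec.span (v ` {..<y})" using \<open>x < y\<close> by (intro vec.span_base) auto
    ultimately show "v x \<noteq> v y" using v1[of y] by auto
  qed auto
  have "inj (\<lambda>j. v (r j))"
    using vinj inj r_less by (auto simp: inj_on_def inj_def)
  have ker: "x = 0" if "g *v x = 0" for x :: "'K^'n"
  proof -
    let ?w = "\<lambda>j. v (r j)"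
    have winj: "inj ?w" by fact
    have winv: "inv_into UNIV ?w (v (r j)) = j" for j using inv_into_f_f[OF winj UNIV_I, of j] .
    have im: "?w ` UNIV = v ` {..<CARD('n)}"
      using bij_betw_imp_surj_on[OF r, symmetric] by (simp add: image_image)
    have "(\<Sum>j\<in>UNIV. x $ j *s ?w j) = 0"
      using that by (simp add: matrix_mult_sum col)
    then have "(\<Sum>y\<in>?w ` UNIV. x $ (inv_into UNIV ?w y) *s y) = 0"
      by (simp add: sum.reindex[OF winj] winv)
    then have sum: "(\<Sum>y\<in>v ` {..<CARD('n)}. x $ (inv_into UNIV ?w y) *s y) = 0" by (simp only: im)
    have "x $ (inv_into UNIV ?w (v (r j))) = 0" for j
      by (rule vec.independentD[OF indep _ subset_refl sum]) (simp_all add: r_less)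
    then show ?thesis by (simp add: winv vec_eq_iff)
  qed
  then have "\<exists>g'. g' ** g = mat 1" using matrix_left_invertible_ker[of g] by simp
  then have g: "g \<in> carrier GL" using invertible_left_inverse[of g] by (simp add: GL_carrier)
  have "Ad (ginv g) h \<in> upper r" if "h \<in> H" for h
    unfolding Ad_inv_upper_iff[OF g]
  proof
    fix j
    have "h *v column j g \<in> vec.span (v ` {..r j})" unfolding col using v2[OF r_less that] .
    then show "h *v column j g \<in> flag g r (Suc (r j))"
      using span_flag[of _ "Suc (r j)"] r_less[of j] by (simp add: lessThan_Suc_atMost)
  qed
  then show thesis using that g by blast
qed

section \<open>Decomposing the stabilizer of a flag\<close>

text \<open>Ties of \<open>f\<close> are broken by an arbitrary enumeration; counting predecessors
  then compresses the values to an initial segment.\<close>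

lemma exists_order_refining:
  fixes f :: "'n::finite \<Rightarrow> nat"
  obtains s where "bij_betw s (UNIV :: 'n set) {..<CARD('n)}" "\<And>i j. f i < f j \<Longrightarrow> s i < s j"
proof -
  obtain r :: "'n \<Rightarrow> nat" where r: "bij_betw r UNIV {0..<CARD('n)}"
    using ex_bij_betw_finite_nat[of "UNIV :: 'n set"] by auto
  \<comment> \<open>The lexicographic order on the pairs \<open>(f i, r i)\<close>: as
    \<open>r i < CARD('n)\<close>, the value \<open>f i\<close> is the leading digit.\<close>
  define q where "q i = f i * CARD('n) + r i" for i
  have r_less: "r i < CARD('n)" for i using r by (auto simp: bij_betw_def)
  have q_less: "q i < q j" if "f i < f j" for i j
  proof -
    have "Suc (f i) * CARD('n) \<le> f j * CARD('n)" using that by (intro mult_right_mono) auto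
    then show ?thesis using r_less[of i] by (simp add: q_def)
  qed
  have q_inj: "i = j" if "q i = q j" for i j
  proof -
    have "f i = f j" using that q_less[of i j] q_less[of j i] by (metis less_irrefl linorder_neqE_nat)
    then have "r i = r j" using that by (simp add: q_def)
    then show ?thesis using r by (auto simp: bij_betw_def inj_def)
  qed
  define s where "s i = card {j. q j < q i}" for i
  have s_less: "s i < s j" if "q i < q j" for i j
    unfolding s_def by (rule psubset_card_mono) (use that in auto)
  have inj: "inj s"
    by (rule injI) (metis q_inj s_less less_irrefl linorder_neqE_nat)
  have "s i < CARD('n)" for i
    unfolding s_def by (rule psubset_card_mono) auto
  then have "s ` UNIV = {..<CARD('n)}"
    using inj by (intro card_subset_eq) (auto simp: card_image)
  then have "bij_betw s UNIV {..<CARD('n)}" using inj by (simp add: bij_betw_def)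
  then show thesis using that s_less q_less by blast
qed

definition outer :: "'a::comm_ring_1^'n::finite \<Rightarrow> 'a^'n \<Rightarrow> 'a^'n^'n" where
  "outer v \<phi> = (\<chi> i j. v $ i * \<phi> $ j)"

lemma outer_mult_vec: "outer v \<phi> *v x = (\<Sum>i\<in>UNIV. \<phi> $ i * x $ i) *s v"
  by (simp add: vec_eq_iff outer_def matrix_vector_mult_def sum_distrib_left sum_distrib_right mult_ac)

text \<open>In the order, the support of \<open>v\<close> comes first, with \<open>p\<close> last in it.\<close>

lemma outer_upper:
  fixes v \<phi> :: "'a::idom^'n::finite"
  assumes supp: "\<And>i. i \<noteq> p \<Longrightarrow> v $ i = 0 \<or> \<phi> $ i = 0"
  obtains s where "bij_betw s (UNIV :: 'n set) {..<CARD('n)}" "outer v \<phi> \<in> upper s"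
proof -
  \<comment> \<open>If the entry at \<open>i\<close>, \<open>j\<close> is nonzero, then
    \<open>f i \<le> 1\<close> and \<open>f j \<ge> 1\<close>, and the value 1 belongs to
    \<open>p\<close> alone; so either \<open>f i < f j\<close> or \<open>i = j = p\<close>.\<close>
  define f where "f i = (if i = p then 1 else if v $ i = 0 then 2 else 0::nat)" for i
  obtain s where s: "bij_betw s (UNIV :: 'n set) {..<CARD('n)}" "\<And>i j. f i < f j \<Longrightarrow> s i < s j"
    using exists_order_refining[of f] by blast
  have "v $ i * \<phi> $ j = 0" if "s j < s i" for i j
  proof (rule ccontr)
    assume "v $ i * \<phi> $ j \<noteq> 0"
    then have "v $ i \<noteq> 0" "\<phi> $ j \<noteq> 0" by auto
    then have "f i < f j \<or> i = j" using supp[of i] supp[of j] by (auto simp: f_def)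
    then show False using s(2)[of i j] that by auto
  qed
  then have "outer v \<phi> \<in> upper s" by (simp add: outer_def upper_def)
  then show thesis using that s(1) by blast
qed

text \<open>
  A minimal set \<open>J\<close> of coordinates that separates the points of a subspace is a coordinate system on it.
\<close>

lemma subspace_coordinates:
  fixes F :: "('k::field^'n::finite) set"
  assumes F: "vec.subspace F"
  obtains J :: "'n set" and w :: "'n \<Rightarrow> 'k^'n" where "\<And>p. p \<in> J \<Longrightarrow> w p \<in> F"
    "\<And>p q. p \<in> J \<Longrightarrow> q \<in> J \<Longrightarrow> w p $ q = (if p = q then 1 else 0)"
    "\<And>v. v \<in> F \<Longrightarrow> v = (\<Sum>p\<in>J. v $ p *s w p)"
proof -
  define sep where "sep J \<longleftrightarrow> (\<forall>v\<in>F. (\<forall>i\<in>J. v $ i = 0) \<longrightarrow> v = 0)" for J :: "'n set"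
  have "sep UNIV" by (simp add: sep_def vec_eq_iff)
  then obtain J where J: "sep J" "\<And>J'. sep J' \<Longrightarrow> card J \<le> card J'"
    using ex_has_least_nat[of sep UNIV card] by blast
  have "\<exists>w\<in>F. \<forall>q\<in>J. w $ q = (if p = q then 1 else 0)" if p: "p \<in> J" for p
  proof -
    \<comment> \<open>By minimality some nonzero vector of \<open>F\<close> vanishes on
      \<open>J - {p}\<close>; since \<open>J\<close> separates, it does not vanish at
      \<open>p\<close>, and rescaling makes it dual to \<open>p\<close>.\<close>
    have "card (J - {p}) < card J" using p by (intro psubset_card_mono) auto
    then have "\<not> sep (J - {p})" using J(2) by (meson not_le)
    then obtain v where v: "v \<in> F" "\<And>i. i \<in> J - {p} \<Longrightarrow> v $ i = 0" "v \<noteq> 0" by (auto simp: sep_def)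
    have "v $ p \<noteq> 0" using J(1) v by (auto simp: sep_def)
    then have "\<forall>q\<in>J. (inverse (v $ p) *s v) $ q = (if p = q then 1 else 0)"
      using v(2) by (simp add: vector_smult_component)
    then show ?thesis using vec.subspace_scale[OF F v(1)] by blast
  qed
  then obtain w :: "'n \<Rightarrow> 'k^'n" where w: "\<And>p. p \<in> J \<Longrightarrow> w p \<in> F"
      "\<And>p q. p \<in> J \<Longrightarrow> q \<in> J \<Longrightarrow> w p $ q = (if p = q then 1 else 0)"
    by metis
  have "v = (\<Sum>p\<in>J. v $ p *s w p)" if "v \<in> F" for v :: "'k^'n"
  proof -
    have "v - (\<Sum>p\<in>J. v $ p *s w p) \<in> F"
      using F that w(1) by (intro vec.subspace_diff vec.subspace_sum vec.subspace_scale)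
    moreover have "(v - (\<Sum>p\<in>J. v $ p *s w p)) $ q = 0" if "q \<in> J" for q
    proof -
      have "(\<Sum>p\<in>J. v $ p * w p $ q) = (\<Sum>p\<in>J. if p = q then v $ q else 0)"
        by (rule sum.cong) (use that w(2) in auto)
      then show ?thesis using that by (simp add: sum_component)
    qed
    ultimately have "v - (\<Sum>p\<in>J. v $ p *s w p) = 0" using J(1) unfolding sep_def by blast
    then show ?thesis by simp
  qed
  then show thesis using that w by blast
qed

lemma flag_mono: "m \<le> m' \<Longrightarrow> flag g r m \<subseteq> flag g r m'"
  by (auto simp: flag_def)

text \<open>The decomposition takes the form of an induction rule because \<open>P\<close> will
  express membership in an arbitrary tangent subspace, where only sums have to be formed. The
  columns of \<open>h\<close> are cleared in the order \<open>r\<close> by rank one matrices, each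
  of which preserves the flag of \<open>h\<close> as well as a coordinate flag.\<close>

lemma upper_conjugate_induct:
  fixes h A :: "'k::field^'n::finite^'n"
  assumes h: "h \<in> carrier GL" and r: "bij_betw r UNIV {..<CARD('n)}"
    and A: "Ad (ginv h) A \<in> upper r"
    and add: "\<And>A A'. P A \<Longrightarrow> P A' \<Longrightarrow> P (A + A')"
    and upper: "\<And>A s. bij_betw s UNIV {..<CARD('n)} \<Longrightarrow> A \<in> upper s \<Longrightarrow> Ad (ginv h) A \<in> upper r \<Longrightarrow> P A"
  shows "P A"
proof -
  have P0: "P 0" using upper[OF r, of 0] by simp
  have P_sum: "P (\<Sum>i\<in>I. f i)" if "\<And>i. i \<in> I \<Longrightarrow> P (f i)" for I :: "'n set" and f
    using that by (induction I rule: infinite_finite_induct) (simp_all add: P0 add)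
  have r_less: "r i < CARD('n)" for i using r by (auto simp: bij_betw_def)
  have r_inj: "r i = r j \<longleftrightarrow> i = j" for i j using r by (auto simp: bij_betw_def inj_def)
  let ?f = "\<lambda>j. column j h"
  have "P A" if "m \<le> CARD('n)" "Ad (ginv h) A \<in> upper r" "\<And>j. r j < m \<Longrightarrow> A *v ?f j = 0" for m A
    using that
  \<comment> \<open>Downwards from \<open>CARD('n)\<close>, where \<open>A\<close> kills all columns
    of \<open>h\<close> and is therefore 0.\<close>
  proof (induction m arbitrary: A rule: inc_induct)
    case base
    have "column j (A ** h) = 0" for j using base r_less by (simp add: column_mult)
    then have "A ** h = 0" by (simp add: vec_eq_iff column_def)
    then have "(A ** h) ** ginv h = 0" by simp
    then have "A = 0" using h by (simp add: matrix_mul_assoc[symmetric])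
    then show ?case using P0 by simp
  next
    case (step m)
    obtain j where j: "r j = m" using r step.hyps by (metis bij_betw_iff_bijections lessThan_iff)
    define F where "F = flag h r (Suc m)"
    obtain J and w :: "'n \<Rightarrow> 'k^'n" where w: "\<And>p. p \<in> J \<Longrightarrow> w p \<in> F"
        "\<And>p q. p \<in> J \<Longrightarrow> q \<in> J \<Longrightarrow> w p $ q = (if p = q then 1 else 0)"
        "\<And>v. v \<in> F \<Longrightarrow> v = (\<Sum>p\<in>J. v $ p *s w p)"
      using subspace_coordinates[OF subspace_flag, of h r "Suc m", folded F_def] by blast
    \<comment> \<open>The coordinate along column \<open>j\<close> of \<open>h\<close>. On
      \<open>F\<close> it is a combination of the coordinates in \<open>J\<close>, which gives
      \<open>\<phi>\<close>; outside \<open>F\<close> the two functionals may differ.\<close>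
    define \<theta> where "\<theta> v = (ginv h *v v) $ j" for v :: "'k^'n"
    have \<theta>_f: "\<theta> (?f i) = (if i = j then 1 else 0)" for i
      using h by (simp add: \<theta>_def flip: column_mult) (simp add: column_def mat_def)
    define \<phi> where "\<phi> = (\<chi> p. if p \<in> J then \<theta> (w p) else 0)"
    have \<phi>: "(\<Sum>i\<in>UNIV. \<phi> $ i * v $ i) = \<theta> v" if "v \<in> F" for v :: "'k^'n"
    proof -
      have "\<theta> v = \<theta> (\<Sum>p\<in>J. v $ p *s w p)" using w(3)[OF that] by simp
      also have "\<dots> = (\<Sum>p\<in>J. \<phi> $ p * v $ p)"
        by (simp add: \<theta>_def \<phi>_def vec.linear_sum[OF matrix_vector_mul_linear_gen] vector_scalar_commute mult.commute)
      also have "\<dots> = (\<Sum>i\<in>UNIV. \<phi> $ i * v $ i)"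
        by (rule sum.mono_neutral_left) (auto simp: \<phi>_def)
      finally show ?thesis by simp
    qed
    have fF: "?f i \<in> F \<longleftrightarrow> r i \<le> m" for i
      using column_in_flag[OF h] by (simp add: F_def less_Suc_eq_le)
    have outer_f: "outer v \<phi> *v ?f i = (if i = j then v else 0)" if "r i \<le> m" for v :: "'k^'n" and i
      using \<phi>[of "?f i"] that by (simp add: outer_mult_vec fF \<theta>_f)
    \<comment> \<open>Columns of rank below \<open>m\<close> are killed; for every other column the
      image lies in \<open>F\<close>, which is contained in the flag step that is allowed for
      it.\<close>
    have outer_ok: "Ad (ginv h) (outer v \<phi>) \<in> upper r" if "v \<in> F" for v
      unfolding Ad_inv_upper_iff[OF h]
    proof
      fix i
      show "outer v \<phi> *v ?f i \<in> flag h r (Suc (r i))"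
      proof (cases "r i < m")
        case True
        then have "i \<noteq> j" using j by auto
        then show ?thesis using True outer_f[of i v] vec.subspace_0[OF subspace_flag] by simp
      next
        case False
        then have "F \<subseteq> flag h r (Suc (r i))" unfolding F_def by (intro flag_mono) simp
        then show ?thesis using that unfolding outer_mult_vec by (intro vec.subspace_scale subspace_flag) auto
      qed
    qed
    have Pw: "P (outer (c *s w p) \<phi>)" if p: "p \<in> J" for c p
    proof -
      have "(c *s w p) $ i = 0 \<or> \<phi> $ i = 0" if "i \<noteq> p" for i
        using w(2)[OF p, of i] that by (auto simp: \<phi>_def)
      then obtain s where "bij_betw s (UNIV :: 'n set) {..<CARD('n)}" "outer (c *s w p) \<phi> \<in> upper s"
        using outer_upper[of p "c *s w p" \<phi>] by blast
      moreover have "c *s w p \<in> F" unfolding F_def by (rule vec.subspace_scale[OF subspace_flag]) (use w(1)[OF p] F_def in simp)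
      ultimately show ?thesis using upper outer_ok by blast
    qed
    let ?v = "A *v ?f j"
    have vF: "?v \<in> F" using step.prems(1) j unfolding Ad_inv_upper_iff[OF h] F_def by blast
    have "outer ?v \<phi> = (\<Sum>p\<in>J. outer (?v $ p *s w p) \<phi>)"
    proof -
      have comp: "(\<Sum>p\<in>J. ?v $ p * w p $ i) = ?v $ i" for i
        using arg_cong[OF w(3)[OF vF], of "\<lambda>v. v $ i"] by (simp add: sum_component)
      have "(\<Sum>p\<in>J. outer (?v $ p *s w p) \<phi>) $ i $ k = outer ?v \<phi> $ i $ k" for i k
      proof -
        have "(\<Sum>p\<in>J. outer (?v $ p *s w p) \<phi>) $ i $ k = (\<Sum>p\<in>J. ?v $ p * w p $ i) * \<phi> $ k"
          by (simp add: outer_def sum_component sum_distrib_right)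
        then show ?thesis unfolding comp by (simp add: outer_def)
      qed
      then show ?thesis by (simp add: vec_eq_iff)
    qed
    then have 1: "P (outer ?v \<phi>)" using Pw by (simp add: P_sum)
    \<comment> \<open>The subtraction clears column \<open>j\<close> and leaves the columns of lower
      rank at 0.\<close>
    have 2: "P (A + - outer ?v \<phi>)"
    proof (rule step.IH)
      have "- outer ?v \<phi> = outer (- ?v) \<phi>" by (simp add: outer_def vec_eq_iff)
      moreover have "- ?v \<in> F" unfolding F_def by (rule vec.subspace_neg[OF subspace_flag]) (use vF F_def in simp)
      ultimately show "Ad (ginv h) (A + - outer ?v \<phi>) \<in> upper r"
        using step.prems(1) outer_ok by (simp add: Ad_add upper_add)
    next
      fix i assume i: "r i < Suc m"
      have "(A + - outer ?v \<phi>) *v ?f i = A *v ?f i - outer ?v \<phi> *v ?f i"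
        by (simp add: matrix_vector_mult_diff_rdistrib)
      also have "\<dots> = 0"
        using i outer_f[of i ?v] step.prems(2)[of i] r_inj[of i j] j by (cases "i = j") auto
      finally show "(A + - outer ?v \<phi>) *v ?f i = 0" .
    qed
    from add[OF 1 2] show ?case by simp
  qed
  from this[of 0 A] show ?thesis using A by simp
qed

section \<open>Borel subgroups over an algebraically closed field\<close>

text \<open>As in Euclid's proof on primes: over a finite field, the product of all x - a, increased
  by 1, has no root.\<close>

lemma infinite_alg_closed_field: "infinite (UNIV :: 'K::alg_closed_field set)"
proof
  assume fin: "finite (UNIV :: 'K set)"
  let ?p = "(\<Prod>a\<in>UNIV. [:- a, 1:]) + [:1 :: 'K:]"
  have ev: "poly ?p x = 1" for x
  proof -
    have "poly (\<Prod>a\<in>UNIV. [:- a, 1:]) x = (\<Prod>a\<in>UNIV. x - a)" by (simp add: poly_prod)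
    also have "\<dots> = 0" using fin by (intro prod_zero) auto
    finally show ?thesis by simp
  qed
  have "Polynomial.degree (\<Prod>a\<in>(UNIV :: 'K set). [:- a, 1:]) = card (UNIV :: 'K set)"
    by (subst degree_prod_eq_sum_degree) auto
  moreover have "card (UNIV :: 'K set) > 0" using fin by (simp add: card_gt_0_iff)
  ultimately have "Polynomial.degree ?p > 0" by (subst degree_add_eq_left) auto
  then obtain x where "poly ?p x = 0" using alg_closed_imp_poly_has_root by blast
  then show False using ev[of x] by simp
qed

text \<open>The line \<open>a + t b\<close> with \<open>t\<close> kept as an indeterminate: field
  elements put for \<open>t\<close> give points, and \<open>\<epsilon>\<close> put for
  \<open>t\<close> gives a tangent vector.\<close>

definition line_matrix :: "'K::comm_ring_1^'n::finite^'n \<Rightarrow> 'K^'n^'n \<Rightarrow> 'K poly^'n^'n" where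
  "line_matrix a b = (\<chi> i j. [:a $ i $ j, b $ i $ j:])"

lemma ring_map_poly_eval: "ring_map (\<lambda>q. poly q (t :: 'K::comm_ring_1))"
  by unfold_locales simp_all

lemma poly_at_line:
  "poly (poly_at (\<lambda>c. [:\<iota> c:]) f (line_matrix a b)) t =
    poly_at \<iota> f (map_matrix (\<lambda>q. poly q t) (line_matrix a b))"
  by (simp add: ring_map.poly_at_map[OF ring_map_poly_eval])

lemma poly_fun_line:
  assumes "poly_fun p"
  obtains q where "\<And>t. poly q t = p (map_matrix (\<lambda>q. poly q t) (line_matrix a b))"
proof -
  obtain f where "\<And>g. p g = poly_at id f g" using assms by (auto simp: poly_fun_def)
  then show thesis
    using that[of "poly_at (\<lambda>c. [:id c:]) f (line_matrix a b)"] by (simp only: poly_at_line)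
qed

text \<open>A nonempty open subset of the line contains all its invertible points except at the
  roots of a nonzero polynomial in \<open>t\<close>. Since the field is infinite, two such subsets
  meet.\<close>

lemma connectedin_line:
  fixes a b :: "'K::alg_closed_field^'n::finite^'n"
  defines "x \<equiv> \<lambda>t. map_matrix (\<lambda>q. poly q t) (line_matrix a b)"
  shows "connectedin zariski {x t | t. x t \<in> carrier GL}"
  unfolding connectedin
proof (intro conjI notI)
  let ?S = "{x t | t. x t \<in> carrier GL}"
  show "?S \<subseteq> topspace zariski" by auto
  assume "\<exists>E1 E2. openin zariski E1 \<and> openin zariski E2 \<and> ?S \<subseteq> E1 \<union> E2 \<and>
      E1 \<inter> E2 \<inter> ?S = {} \<and> E1 \<inter> ?S \<noteq> {} \<and> E2 \<inter> ?S \<noteq> {}"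
  then obtain E1 E2 where E: "openin zariski E1" "openin zariski E2" "E1 \<inter> E2 \<inter> ?S = {}"
    and ne: "E1 \<inter> ?S \<noteq> {}" "E2 \<inter> ?S \<noteq> {}" by (elim exE conjE) (rule that)
  from ne(1) obtain t1 where t1: "x t1 \<in> E1" "x t1 \<in> carrier GL" by auto
  from ne(2) obtain t2 where t2: "x t2 \<in> E2" by auto
  obtain p1 where p1: "poly_fun p1" "p1 (x t1) \<noteq> 0" "\<forall>y\<in>carrier GL. p1 y \<noteq> 0 \<longrightarrow> y \<in> E1"
    using openin_zariski_principal[OF E(1) t1(1)] by blast
  obtain p2 where p2: "poly_fun p2" "p2 (x t2) \<noteq> 0" "\<forall>y\<in>carrier GL. p2 y \<noteq> 0 \<longrightarrow> y \<in> E2"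
    using openin_zariski_principal[OF E(2) t2] by blast
  obtain q1 where q1: "\<And>t. poly q1 t = p1 (x t)" using poly_fun_line[OF p1(1)] unfolding x_def by metis
  obtain q2 where q2: "\<And>t. poly q2 t = p2 (x t)" using poly_fun_line[OF p2(1)] unfolding x_def by metis
  have "poly_fun (\<lambda>g :: 'K^'n^'n. det g)" by (intro poly_fun_det poly_fun_entry)
  \<comment> \<open>The determinant along the line; as a third factor it keeps the common parameter
    inside \<open>GL\<close>.\<close>
  then obtain q3 where q3: "\<And>t. poly q3 t = det (x t)" using poly_fun_line unfolding x_def by metis
  have "q1 \<noteq> 0" "q2 \<noteq> 0" "q3 \<noteq> 0"
    using q1[of t1] q2[of t2] q3[of t1] p1(2) p2(2) t1(2) by (auto simp: det_nonzero_GL)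
  then have "finite {t. poly (q1 * q2 * q3) t = 0}" by (intro poly_roots_finite) simp
  then obtain t where t: "poly (q1 * q2 * q3) t \<noteq> 0"
    using infinite_alg_closed_field[where 'K='K] by (metis (mono_tags, lifting) ex_new_if_finite mem_Collect_eq)
  then have "x t \<in> carrier GL" by (simp add: det_nonzero_GL q3)
  moreover have "x t \<in> E1" "x t \<in> E2" using t p1(3) p2(3) calculation by (simp_all add: q1 q2)
  ultimately show False using E(3) by blast
qed

section \<open>The stabilizer of a flag is closed, connected and solvable\<close>

definition triangular_group :: "'r::comm_ring_1^'n::finite^'n \<Rightarrow> ('n \<Rightarrow> nat) \<Rightarrow> ('r^'n^'n) set" where
  "triangular_group g r = {x \<in> carrier GL. Ad (ginv g) x \<in> upper r}"

lemma regular_Ad: "regular (\<lambda>x :: 'K::field^'n::finite^'n. Ad g x $ i $ j)"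
  unfolding Ad_def by (intro regular_matrix_mult regular_const regular_entry)

lemma closedin_triangular_group:
  fixes g :: "'K::field^'n::finite^'n"
  shows "closedin zariski (triangular_group g r)"
proof -
  let ?Z = "\<lambda>(i, j). {x \<in> carrier GL. Ad (ginv g) x $ i $ j = 0}"
  let ?\<C> = "insert (carrier GL) (?Z ` {(i, j). r j < r i})"
  have "triangular_group g r = \<Inter>?\<C>" by (auto simp: triangular_group_def upper_def)
  moreover have "closedin zariski (\<Inter>?\<C>)"
  proof (rule closedin_Inter)
    fix C assume "C \<in> ?\<C>"
    then consider "C = carrier GL" | i j where "C = {x \<in> carrier GL. Ad (ginv g) x $ i $ j = 0}"
      by auto
    then show "closedin zariski C"
    proof cases
      case 1
      then show ?thesis using closedin_topspace[of "zariski :: ('K^'n^'n) topology"] by simp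
    next
      case 2
      then show ?thesis using closedin_zariski_regular[OF regular_Ad] by simp
    qed
  qed simp
  ultimately show ?thesis by simp
qed

lemma matrix_diff_mult:
  fixes A B C :: "'r::comm_ring_1^'n::finite^'n"
  shows "(A - B) ** C = A ** C - B ** C" and "C ** (A - B) = C ** A - C ** B"
  by (simp_all add: vec_eq_iff matrix_matrix_mult_def left_diff_distrib right_diff_distrib sum_subtractf)

lemma Ad_diff: "Ad g (A - B) = Ad g A - Ad g B"
  by (simp add: Ad_def matrix_diff_mult)

lemma upper_diff: "A \<in> upper r \<Longrightarrow> B \<in> upper r \<Longrightarrow> A - B \<in> upper r"
  by (auto simp: upper_def)

text \<open>Each \<open>b\<close> is joined to 1 by the line \<open>1 + t (b - 1)\<close>, whose
  invertible points stay in the group.\<close>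

lemma connectedin_triangular_group:
  fixes g :: "'K::alg_closed_field^'n::finite^'n"
  assumes g: "g \<in> carrier GL"
  shows "connectedin zariski (triangular_group g r)"
proof -
  let ?G = "triangular_group g r"
  define x where "x b t = map_matrix (\<lambda>q. poly q t) (line_matrix (mat 1) (b - mat 1))"
    for b :: "'K^'n^'n" and t
  define L where "L b = {x b t | t. x b t \<in> carrier GL}" for b
  have x: "x b t = mat 1 + map_matrix ((*) t) (b - mat 1)" for b t
    by (simp add: x_def line_matrix_def vec_eq_iff)
  have x0: "x b 0 = mat 1" and x1: "x b 1 = b" for b by (simp_all add: x vec_eq_iff)
  have LG: "L b \<subseteq> ?G" if "b \<in> ?G" for b
    using that g
    by (auto simp: L_def triangular_group_def x Ad_add Ad_scale Ad_mat_one Ad_diff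
        intro!: upper_add upper_scale upper_diff)
  have "connectedin zariski (\<Union>(L ` ?G))"
  proof (rule connectedin_Union)
    fix S assume "S \<in> L ` ?G"
    then show "connectedin zariski S"
      using connectedin_line[of "mat 1" "_ - mat 1"] by (auto simp: L_def x_def)
  next
    have "mat 1 \<in> L b" for b unfolding L_def by (intro CollectI exI[of _ 0]) (simp add: x0)
    then show "\<Inter>(L ` ?G) \<noteq> {}" by blast
  qed
  moreover have "b \<in> L b" if "b \<in> ?G" for b
    unfolding L_def using x1[of b] that by (intro CollectI exI[of _ 1]) (simp add: triangular_group_def)
  then have "\<Union>(L ` ?G) = ?G" using LG by blast
  ultimately show ?thesis by simp
qed

text \<open>The filtration by superdiagonals: step 0 consists of the triangular matrices, step 1 of
  the strictly triangular ones.\<close>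

definition strictly_upper :: "('n::finite \<Rightarrow> nat) \<Rightarrow> nat \<Rightarrow> ('r::comm_ring_1^'n^'n) set" where
  "strictly_upper r k = {A. \<forall>i j. r j < r i + k \<longrightarrow> A $ i $ j = 0}"

lemma strictly_upper_0: "strictly_upper r 0 = upper r"
  by (simp add: strictly_upper_def upper_def)

lemma strictly_upper_mono: "k \<le> l \<Longrightarrow> strictly_upper r l \<subseteq> strictly_upper r k"
  by (force simp: strictly_upper_def)

lemma strictly_upper_add: "A \<in> strictly_upper r k \<Longrightarrow> B \<in> strictly_upper r k \<Longrightarrow> A + B \<in> strictly_upper r k"
  and strictly_upper_diff: "A \<in> strictly_upper r k \<Longrightarrow> B \<in> strictly_upper r k \<Longrightarrow> A - B \<in> strictly_upper r k"
  by (auto simp: strictly_upper_def)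

lemma strictly_upper_mult:
  assumes "A \<in> strictly_upper r k" "B \<in> strictly_upper r l"
  shows "A ** B \<in> strictly_upper r (k + l)"
proof -
  have "A $ i $ m * B $ m $ j = 0" if "r j < r i + (k + l)" for i j m
  proof (cases "r m < r i + k")
    case True
    then show ?thesis using assms by (simp add: strictly_upper_def)
  next
    case False
    then have "r j < r m + l" using that by simp
    then show ?thesis using assms by (simp add: strictly_upper_def)
  qed
  then show ?thesis by (simp add: strictly_upper_def matrix_matrix_mult_def)
qed

text \<open>The diagonal of a product of triangular matrices is the product of the diagonals, so it
  cancels in the commutator.\<close>

lemma upper_commutator:
  fixes A B :: "'r::comm_ring_1^'n::finite^'n"
  assumes "inj r" "A \<in> upper r" "B \<in> upper r"
  shows "A ** B - B ** A \<in> strictly_upper r 1"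
proof -
  have diag: "(A ** B) $ i $ i = A $ i $ i * B $ i $ i"
    if "A \<in> upper r" "B \<in> upper r" for A B :: "'r^'n^'n" and i
  proof -
    have "(A ** B) $ i $ i = (\<Sum>k\<in>{i}. A $ i $ k * B $ k $ i)"
      unfolding matrix_matrix_mult_def
    proof (simp only: vec_lambda_beta, rule sum.mono_neutral_right)
      show "\<forall>k\<in>UNIV - {i}. A $ i $ k * B $ k $ i = 0"
      proof
        fix k assume "k \<in> UNIV - {i}"
        then have "r k < r i \<or> r i < r k" using \<open>inj r\<close> by (metis DiffD2 injD insertI1 linorder_neqE_nat)
        then show "A $ i $ k * B $ k $ i = 0" using that by (auto simp: upper_def)
      qed
    qed auto
    then show ?thesis by simp
  qed
  show ?thesis
    unfolding strictly_upper_def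
  proof (intro CollectI allI impI)
    fix i j assume "r j < r i + 1"
    then consider "i = j" | "r j < r i" using \<open>inj r\<close> by (metis Suc_eq_plus1 injD less_antisym)
    then show "(A ** B - B ** A) $ i $ j = 0"
    proof cases
      case 1
      then show ?thesis using diag assms by (simp add: mult.commute)
    next
      case 2
      then show ?thesis using upper_mult[of A r B] upper_mult[of B r A] assms by (simp add: upper_def)
    qed
  qed
qed

text \<open>The derived series descends through the subgroups \<open>N k\<close> of elements
  congruent to 1 modulo step \<open>k\<close> of the filtration. \<open>N (CARD('n))\<close> is
  trivial because two ranks differ by less than \<open>CARD('n)\<close>.\<close>

lemma solvable_triangular_group:
  fixes g :: "'r::comm_ring_1^'n::finite^'n"
  assumes g: "g \<in> carrier GL" and r: "bij_betw r UNIV {..<CARD('n)}"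
  shows "solvable (GL\<lparr>carrier := triangular_group g r\<rparr>)"
proof -
  have inj: "inj r" using r by (simp add: bij_betw_def)
  let ?G = "triangular_group g r"
  let ?A = "Ad (ginv g)"
  define N where "N k = {x \<in> carrier GL. ?A x - mat 1 \<in> strictly_upper r k}" for k
  have one_upper: "mat 1 \<in> strictly_upper r 0" by (simp add: strictly_upper_0)
  have N0: "N 0 = ?G"
  proof -
    have "a \<in> upper r" if "a - mat 1 \<in> strictly_upper r 0" for a :: "'r^'n^'n"
      using strictly_upper_add[OF that one_upper] by (simp add: strictly_upper_0)
    then show ?thesis using strictly_upper_diff[OF _ one_upper] by (auto simp: N_def triangular_group_def strictly_upper_0)
  qed
  have sub0: "subgroup ?G GL" unfolding triangular_group_def using subgroup_upper[OF inj g] .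
  have NG: "N k \<subseteq> ?G" for k unfolding N0[symmetric] N_def using strictly_upper_mono[of 0 k r] by auto
  have up: "?A x \<in> strictly_upper r 0" if "x \<in> ?G" for x
    using that by (simp add: triangular_group_def strictly_upper_0)
  have carr: "x \<in> carrier GL" if "x \<in> ?G" for x using that by (simp add: triangular_group_def)
  have gi: "ginv g \<in> carrier GL" using g by simp
  have A_mult: "?A (x ** y) = ?A x ** ?A y" for x y using Ad_mult_matrix[OF gi] .
  have A_one: "?A (mat 1) = mat 1" using Ad_mat_one[OF gi] .
  have subN: "subgroup (N k) GL" for k
  proof
    show "N k \<subseteq> carrier GL" by (auto simp: N_def)
    show "\<one>\<^bsub>GL\<^esub> \<in> N k" by (auto simp: N_def A_one strictly_upper_def)
  next
    fix x y assume x: "x \<in> N k" and y: "y \<in> N k"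
    have "(?A x - mat 1) ** ?A y \<in> strictly_upper r (k + 0)"
      using x y NG up by (intro strictly_upper_mult) (auto simp: N_def)
    moreover have "?A y - mat 1 \<in> strictly_upper r k" using y by (simp add: N_def)
    moreover have "?A (x ** y) - mat 1 = (?A x - mat 1) ** ?A y + (?A y - mat 1)"
      by (simp add: A_mult matrix_diff_mult)
    ultimately have "?A (x ** y) - mat 1 \<in> strictly_upper r k"
      by (metis add_0_right strictly_upper_add)
    then show "x \<otimes>\<^bsub>GL\<^esub> y \<in> N k" using x y by (simp add: N_def)
  next
    fix x assume x: "x \<in> N k"
    then have xG: "x \<in> carrier GL" "ginv x \<in> ?G" using NG[of k] carr subgroup.m_inv_closed[OF sub0] by auto
    have "?A (ginv x) ** (mat 1 - ?A x) \<in> strictly_upper r (0 + k)"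
    proof (rule strictly_upper_mult)
      show "mat 1 - ?A x \<in> strictly_upper r k" using x by (simp add: N_def strictly_upper_def)
    qed (rule up[OF xG(2)])
    moreover have "?A (ginv x) - mat 1 = ?A (ginv x) ** (mat 1 - ?A x)"
      using xG by (simp add: matrix_diff_mult A_one flip: A_mult)
    ultimately show "ginv x \<in> N k" using xG by (simp add: N_def)
  qed
  have step: "derived GL (N k) \<subseteq> N (Suc k)" for k
    unfolding derived_def
  proof (rule GL.generate_subgroup_incl[OF _ subN])
    show "derived_set GL (N k) \<subseteq> N (Suc k)"
    proof
      fix z assume "z \<in> derived_set GL (N k)"
      then obtain x y where x: "x \<in> N k" and y: "y \<in> N k"
        and z: "z = x ** y ** ginv x ** ginv y" by auto
      have xy: "x \<in> ?G" "y \<in> ?G" using x y NG by auto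
      note G = carr[OF xy(1)] carr[OF xy(2)]
      let ?c = "?A x ** ?A y - ?A y ** ?A x"
      have c: "?c \<in> strictly_upper r (Suc k)"
      \<comment> \<open>From \<open>N 0\<close> to \<open>N 1\<close> the reason is that diagonal
        entries commute; later it is that products of two deviations from 1 lie in step
        \<open>k + k\<close>, and \<open>k + k \<ge> Suc k\<close>.\<close>
      proof (cases k)
        case 0
        then show ?thesis using upper_commutator[OF inj, of "?A x" "?A y"] up[OF xy(1)] up[OF xy(2)]
          by (simp add: strictly_upper_0)
      next
        case (Suc l)
        let ?x = "?A x - mat 1" and ?y = "?A y - mat 1"
        have xk: "?x \<in> strictly_upper r k" and yk: "?y \<in> strictly_upper r k"
          using x y by (auto simp: N_def)
        have "?x ** ?y - ?y ** ?x \<in> strictly_upper r (k + k)"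
          by (rule strictly_upper_diff[OF strictly_upper_mult[OF xk yk] strictly_upper_mult[OF yk xk]])
        moreover have "?c = ?x ** ?y - ?y ** ?x" by (simp add: matrix_diff_mult)
        ultimately show ?thesis using strictly_upper_mono[of "Suc k" "k + k" r] Suc by auto
      qed
      have "z - mat 1 = (x ** y - y ** x) ** (ginv x ** ginv y)"
        using G by (simp add: z matrix_diff_mult matrix_mul_assoc[symmetric])
      then have "?A (z - mat 1) = ?c ** ?A (ginv x ** ginv y)"
        by (simp add: A_mult Ad_diff)
      moreover have "ginv x ** ginv y \<in> ?G"
        using subgroup.m_closed[OF sub0] subgroup.m_inv_closed[OF sub0] xy by auto
      ultimately have "?A (z - mat 1) \<in> strictly_upper r (Suc k + 0)"
        using strictly_upper_mult[OF c up] by metis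
      then show "z \<in> N (Suc k)" using G by (simp add: N_def Ad_diff A_one z)
    qed
  qed
  have "(derived (GL\<lparr>carrier := ?G\<rparr>) ^^ k) ?G \<subseteq> N k" for k
  proof (induction k)
    case (Suc k)
    have "derived (GL\<lparr>carrier := ?G\<rparr>) ((derived (GL\<lparr>carrier := ?G\<rparr>) ^^ k) ?G)
        = derived GL ((derived (GL\<lparr>carrier := ?G\<rparr>) ^^ k) ?G)"
      using Suc NG[of k] by (intro GL.derived_consistent sub0) auto
    also have "\<dots> \<subseteq> derived GL (N k)" using Suc by (intro GL.mono_derived)
    also have "\<dots> \<subseteq> N (Suc k)" by (rule step)
    finally show ?case by simp
  qed (simp add: N0)
  moreover have "N (CARD('n)) = {mat 1}"
  proof -
    have "r j < r i + CARD('n)" for i j using r by (auto simp: bij_betw_def intro: trans_less_add2)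
    then have "strictly_upper r (CARD('n)) = {0 :: 'r^'n^'n}"
      by (auto simp: strictly_upper_def vec_eq_iff)
    moreover have "x = mat 1" if "?A x = mat 1" for x
      using arg_cong[OF that, of "Ad g"] g by (simp add: Ad_mat_one)
    ultimately show ?thesis by (auto simp: N_def A_one)
  qed
  ultimately have sub: "(derived (GL\<lparr>carrier := ?G\<rparr>) ^^ CARD('n)) ?G \<subseteq> {mat 1}" by metis
  interpret T: group "GL\<lparr>carrier := ?G\<rparr>" by (rule GL.subgroup_imp_group[OF sub0])
  have "subgroup ((derived (GL\<lparr>carrier := ?G\<rparr>) ^^ CARD('n)) ?G) (GL\<lparr>carrier := ?G\<rparr>)"
    using T.exp_of_derived_is_subgroup[OF T.subgroup_self] by simp
  then have "mat 1 \<in> (derived (GL\<lparr>carrier := ?G\<rparr>) ^^ CARD('n)) ?G"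
    using subgroup.one_closed by fastforce
  with sub have "(derived (GL\<lparr>carrier := ?G\<rparr>) ^^ CARD('n)) ?G = {mat 1}" by blast
  then show ?thesis using T.solvable_iff_trivial_derived_seq by auto
qed

text \<open>Lie and Kolchin place \<open>B\<close> inside a triangular group. That group is itself
  connected and solvable, so maximality turns the inclusion into an equality.\<close>

lemma connected_solvable_maximal:
  fixes B :: "('K::alg_closed_field^'n::finite^'n) set"
  assumes B: "connected_solvable B" and max: "\<And>B'. connected_solvable B' \<Longrightarrow> B \<subseteq> B' \<Longrightarrow> B' = B"
    and r: "bij_betw r UNIV {..<CARD('n)}"
  obtains g where "g \<in> carrier GL" "B = triangular_group g r"
proof -
  have sub: "subgroup B GL" using B by (simp add: connected_solvable_def)
  obtain g where g: "g \<in> carrier GL" "\<And>b. b \<in> B \<Longrightarrow> Ad (ginv g) b \<in> upper r"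
    using lie_kolchin[of B r] B r by (auto simp: connected_solvable_def)
  have "B \<subseteq> triangular_group g r" using g(2) subgroup.subset[OF sub] by (auto simp: triangular_group_def)
  moreover have "subgroup (triangular_group g r) GL"
    unfolding triangular_group_def using r by (intro subgroup_upper g(1)) (simp add: bij_betw_def)
  then have "connected_solvable (triangular_group g r)"
    by (simp add: connected_solvable_def closedin_triangular_group connectedin_triangular_group[OF g(1)]
        solvable_triangular_group[OF g(1) r])
  ultimately show thesis using max g(1) that by metis
qed

section \<open>Descent to the base field\<close>

text \<open>The \<open>k\<close>-linear functionals on the algebraic closure. They do the work of
  Galois automorphisms in the descent, also when \<open>k\<close> is imperfect.\<close>

definition base_linear :: "('k::field alg_closure \<Rightarrow> 'k) \<Rightarrow> bool" where
  "base_linear l \<longleftrightarrow> (\<forall>x y. l (x + y) = l x + l y) \<and> (\<forall>a x. l (to_ac a * x) = a * l x)"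

lemma base_linear_add: "base_linear l \<Longrightarrow> l (x + y) = l x + l y"
  and base_linear_scale: "base_linear l \<Longrightarrow> l (to_ac a * x) = a * l x"
  by (simp_all add: base_linear_def)

lemma base_linear_0: "base_linear l \<Longrightarrow> l 0 = 0"
  using base_linear_scale[of l 0 0] by simp

lemma base_linear_sum: "base_linear l \<Longrightarrow> l (\<Sum>i\<in>I. f i) = (\<Sum>i\<in>I. l (f i))"
  by (induction I rule: infinite_finite_induct) (simp_all add: base_linear_0 base_linear_add)

lemma base_linear_scale_right: "base_linear l \<Longrightarrow> l (x * to_ac a) = l x * a"
  using base_linear_scale[of l a x] by (simp add: mult.commute)

interpretation ac: vector_space "\<lambda>(a :: 'k::field) x. to_ac a * x"
  by unfold_locales (simp_all add: algebra_simps)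

definition base_vec :: "('k::field alg_closure \<Rightarrow> 'k) \<Rightarrow> 'k alg_closure^'n::finite \<Rightarrow> 'k alg_closure^'n" where
  "base_vec l v = (\<chi> a. to_ac (l (v $ a)))"

text \<open>Expanding the coordinates of \<open>x\<close> in a \<open>k\<close>-basis of the closure
  writes \<open>x\<close> as a combination of vectors \<open>base_vec l x\<close> with
  \<open>l\<close> the coordinate functionals. If all of these lay in \<open>F\<close>, so would
  \<open>x\<close>.\<close>

lemma base_linear_separates:
  fixes F :: "('k::field alg_closure^'n::finite) set"
  assumes F: "vec.subspace F" and x: "x \<notin> F"
  obtains l where "base_linear l" "base_vec l x \<notin> F"
proof (rule ccontr)
  assume contra: "\<not> thesis"
  define \<B> where "\<B> = ac.extend_basis ({} :: 'k alg_closure set)"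
  have \<B>: "ac.independent \<B>" "ac.span \<B> = UNIV"
    using ac.independent_extend_basis[OF ac.independent_empty] ac.span_extend_basis[OF ac.independent_empty]
    by (simp_all add: \<B>_def)
  define l where "l b y = ac.representation \<B> y b" for b y
  have l: "base_linear (l b)" for b
    using \<B> by (simp add: base_linear_def l_def ac.representation_add ac.representation_scale)
  define S where "S = (\<Union>a\<in>UNIV. {b. l b (x $ a) \<noteq> 0})"
  have fin: "finite S" unfolding S_def l_def by (intro finite_UN_I ac.finite_representation) simp
  have "x = (\<Sum>b\<in>S. b *s base_vec (l b) x)"
  proof -
    have "x $ a = (\<Sum>b\<in>S. to_ac (l b (x $ a)) * b)" for a
    proof -
      have "x $ a = (\<Sum>b | l b (x $ a) \<noteq> 0. to_ac (l b (x $ a)) * b)"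
        using ac.sum_nonzero_representation_eq[of \<B> "x $ a"] \<B> by (simp add: l_def)
      also have "\<dots> = (\<Sum>b\<in>S. to_ac (l b (x $ a)) * b)"
        by (rule sum.mono_neutral_left) (use fin in \<open>auto simp: S_def\<close>)
      finally show ?thesis .
    qed
    then show ?thesis by (simp add: vec_eq_iff sum_component base_vec_def mult.commute)
  qed
  also have "\<dots> \<in> F"
    using contra l that by (intro vec.subspace_sum[OF F] vec.subspace_scale[OF F]) blast
  finally show False using x by simp
qed

lemma module_times: "Modules.module ((*) :: 'r::comm_ring_1 \<Rightarrow> 'r \<Rightarrow> 'r)"
  by unfold_locales (simp_all add: algebra_simps)

text \<open>Applying \<open>l\<close> to coefficients commutes with multiplication by a polynomial
  over \<open>k\<close>. A combination of generators over \<open>k\<close> is thus sent to a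
  combination of the same generators with coefficients over \<open>k\<close>.\<close>

lemma vanishing_base_linear:
  fixes B :: "('k::field alg_closure^'n::finite^'n) set"
  assumes B: "defined_over_base B" and l: "base_linear l" and f: "f \<in> vanishing id B"
  shows "Poly_Mapping.map l f \<in> vanishing to_ac B"
proof -
  interpret m: Modules.module "(*) :: ('k alg_closure, 'n) entry_poly \<Rightarrow> _" by (rule module_times)
  have map_mult: "Poly_Mapping.map l (c * Poly_Mapping.map to_ac F) = Poly_Mapping.map l c * F"
    for c :: "('k alg_closure, 'n) entry_poly" and F
  proof (induction c rule: poly_mapping_sum_induct)
    case (single u a)
    show ?case
    proof (induction F rule: poly_mapping_sum_induct)
      case (single v b)
      show ?case
        by (simp add: mult_single base_linear_0[OF l] base_linear_scale_right[OF l])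
    next
      case (add F G)
      then show ?case
        by (simp add: poly_mapping_map_add distrib_left base_linear_0[OF l] base_linear_add[OF l])
    qed
  qed (simp add: poly_mapping_map_add distrib_right base_linear_0[OF l] base_linear_add[OF l])
  have "f \<in> m.span (Poly_Mapping.map to_ac ` vanishing to_ac B)"
    using f B by (simp add: defined_over_base_def)
  then show ?thesis
  proof (induction rule: m.span_induct_alt)
    case base
    have "Poly_Mapping.map l 0 = (0 :: ('k, 'n) entry_poly)"
      by (rule poly_mapping_eqI) (simp add: map.rep_eq when_def)
    then show ?case by (simp add: vanishing_def)
  next
    case (step c p y)
    then obtain F where F: "F \<in> vanishing to_ac B" "p = Poly_Mapping.map to_ac F" by auto
    have "Poly_Mapping.map l (c * p + y) = Poly_Mapping.map l c * F + Poly_Mapping.map l y"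
      by (simp add: F poly_mapping_map_add base_linear_0[OF l] base_linear_add[OF l] map_mult)
    then show ?case
      using F(1) step.IH by (simp add: vanishing_def to_ac.poly_at_add to_ac.poly_at_mult)
  qed
qed

section \<open>Linear forms vanishing on a triangular group, and descent of its flag\<close>

definition trace_poly :: "'r::comm_ring_1^'n::finite^'n \<Rightarrow> ('r, 'n) entry_poly" where
  "trace_poly c = (\<Sum>i\<in>UNIV. \<Sum>j\<in>UNIV. Poly_Mapping.single (Poly_Mapping.single (j, i) 1) (c $ i $ j))"

lemma (in ring_map) poly_at_sum: "poly_at \<phi> (\<Sum>i\<in>I. f i) g = (\<Sum>i\<in>I. poly_at \<phi> (f i) g)"
  by (induction I rule: infinite_finite_induct) (simp_all add: poly_at_add)

lemma (in ring_map) poly_at_trace_poly: "poly_at \<phi> (trace_poly c) x = trace (map_matrix \<phi> c ** x)"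
  by (simp add: trace_poly_def poly_at_sum poly_at_single map_zero trace_def matrix_matrix_mult_def)

lemma map_trace_poly:
  assumes "base_linear l"
  shows "Poly_Mapping.map l (trace_poly c) = trace_poly (map_matrix l c)"
proof -
  have sum: "Poly_Mapping.map l (\<Sum>i\<in>I. f i) = (\<Sum>i\<in>I. Poly_Mapping.map l (f i))" if "finite I"
    for I :: "'i set" and f :: "'i \<Rightarrow> 'c \<Rightarrow>\<^sub>0 _"
    using that
  proof induction
    case empty
    show ?case by (rule poly_mapping_eqI) (simp add: map.rep_eq when_def)
  qed (simp add: poly_mapping_map_add base_linear_0[OF assms] base_linear_add[OF assms])
  show ?thesis
    by (simp add: trace_poly_def sum base_linear_0[OF assms])
qed

lemma trace_Ad: "g \<in> carrier GL \<Longrightarrow> trace (Ad g A) = trace A"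
  by (simp add: Ad_def trace_mul_sym[of "g ** A"] matrix_mul_assoc)

lemma trace_strictly_upper: "A \<in> strictly_upper r 1 \<Longrightarrow> trace A = 0"
  by (simp add: trace_def strictly_upper_def)

definition elementary :: "'n::finite \<Rightarrow> 'n \<Rightarrow> 'r::comm_ring_1^'n^'n" where
  "elementary p q = (\<chi> i j. if i = p \<and> j = q then 1 else 0)"

lemma trace_mult_elementary: "trace (A ** elementary p q) = A $ q $ p"
proof -
  have "(A ** elementary p q) $ i $ i = (if i = q then A $ q $ p else 0)" for i
  proof -
    have "(A ** elementary p q) $ i $ i = (\<Sum>k\<in>{p}. A $ i $ k * elementary p q $ k $ i)"
      unfolding matrix_matrix_mult_def
      by (simp only: vec_lambda_beta, rule sum.mono_neutral_right) (auto simp: elementary_def)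
    then show ?thesis by (auto simp: elementary_def)
  qed
  then show ?thesis by (simp add: trace_def)
qed

lemma elementary_mult_vec: "elementary p q *v x = x $ q *s axis p 1"
proof -
  have "(elementary p q *v x) $ i = (\<Sum>j\<in>{q}. elementary p q $ i $ j * x $ j)" for i
    unfolding matrix_vector_mult_def
    by (simp only: vec_lambda_beta, rule sum.mono_neutral_right) (auto simp: elementary_def)
  then show ?thesis by (auto simp: vec_eq_iff elementary_def axis_def)
qed

text \<open>Under the trace form the strictly triangular matrices are the orthogonal complement of
  the triangular ones. The group detects all triangular matrices: an elementary matrix
  \<open>E\<close> is reached through 1 and an invertible \<open>1 + t E\<close> with
  \<open>t \<noteq> 0\<close>.\<close>

lemma trace_vanishes_triangular_group:
  fixes g :: "'K::alg_closed_field^'n::finite^'n"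
  assumes g: "g \<in> carrier GL"
  shows "(\<forall>x\<in>triangular_group g r. trace (N ** x) = 0) \<longleftrightarrow> Ad (ginv g) N \<in> strictly_upper r 1"
proof
  have gi: "ginv g \<in> carrier GL" using g by simp
  have tr: "trace (N ** x) = trace (Ad (ginv g) N ** Ad (ginv g) x)" for x
    by (simp add: trace_Ad[OF gi] flip: Ad_mult_matrix[OF gi])
  {
    assume N: "Ad (ginv g) N \<in> strictly_upper r 1"
    show "\<forall>x\<in>triangular_group g r. trace (N ** x) = 0"
    proof
      fix x assume "x \<in> triangular_group g r"
      then have "Ad (ginv g) x \<in> strictly_upper r 0"
        by (simp add: triangular_group_def strictly_upper_0)
      then show "trace (N ** x) = 0"
        unfolding tr using strictly_upper_mult[OF N] by (intro trace_strictly_upper[of _ r]) force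
    qed
  next
    assume *: "\<forall>x\<in>triangular_group g r. trace (N ** x) = 0"
    let ?N = "Ad (ginv g) N"
    have zero: "trace (?N ** y) = 0" if y: "y \<in> upper r" "y \<in> carrier GL" for y
    proof -
      have "Ad g y \<in> triangular_group g r" using y g by (simp add: triangular_group_def Ad_GL_iff)
      then have "trace (N ** Ad g y) = 0" using * by blast
      then show ?thesis unfolding tr using g by simp
    qed
    show "?N \<in> strictly_upper r 1"
      unfolding strictly_upper_def
    proof (intro CollectI allI impI)
      fix i j assume ij: "r j < r i + 1"
      let ?y = "\<lambda>t. mat 1 + map_matrix ((*) t) (elementary j i) :: 'K^'n^'n"
      have y: "?y t = map_matrix (\<lambda>q. poly q t) (line_matrix (mat 1) (elementary j i))" for t :: 'K
        by (simp add: vec_eq_iff line_matrix_def)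
      have det: "poly_fun (\<lambda>g :: 'K^'n^'n. det g)" by (intro poly_fun_det poly_fun_entry)
      obtain q where "\<And>t. poly q t = det (map_matrix (\<lambda>q. poly q t) (line_matrix (mat 1) (elementary j i)) :: 'K^'n^'n)"
        by (rule poly_fun_line[OF det, where a="mat 1" and b="elementary j i"], rule that)
      then have q: "poly q t = det (?y t)" for t by (simp only: y)
      have "?y 0 = mat 1" by (simp add: vec_eq_iff)
      then have "det (?y 0) = 1" by (simp only: det_I)
      then have "poly q 0 = 1" by (simp only: q)
      \<comment> \<open>The factor \<open>[:0, 1:]\<close> excludes \<open>t = 0\<close>, where the
        elementary matrix would drop out.\<close>
      then have "q * [:0, 1:] \<noteq> 0" by auto
      then have "finite {t. poly (q * [:0, 1:]) t = 0}" by (rule poly_roots_finite)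
      then obtain t where t: "poly (q * [:0, 1:]) t \<noteq> 0"
        using infinite_alg_closed_field[where 'K='K] by (metis (mono_tags, lifting) ex_new_if_finite mem_Collect_eq)
      have "elementary j i \<in> upper r" using ij by (auto simp: upper_def elementary_def)
      then have "?y t \<in> upper r" by (intro upper_add upper_scale) simp_all
      moreover have "?y t \<in> carrier GL" using t by (simp add: det_nonzero_GL q[symmetric])
      ultimately have "trace (?N ** ?y t) = 0" by (rule zero)
      moreover have "trace (?N ** ?y t) = trace (?N ** mat 1) + t * trace (?N ** elementary j i)"
        by (simp add: trace_def matrix_matrix_mult_def distrib_left sum.distrib sum_distrib_left mult_ac)
      moreover have "trace (?N ** mat 1) = 0" by (rule zero) simp_all
      ultimately show "?N $ i $ j = 0" using t by (simp add: trace_mult_elementary)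
    qed
  }
qed

text \<open>Each step of the flag is recovered from the previous one and the forms that vanish on
  the group, without a choice of basis. This allows descent by induction on the step.\<close>

lemma flag_Suc_iff:
  fixes g :: "'K::field^'n::finite^'n"
  assumes g: "g \<in> carrier GL" and r: "bij_betw r UNIV {..<CARD('n)}"
  shows "v \<in> flag g r (Suc m) \<longleftrightarrow>
    (\<forall>N. Ad (ginv g) N \<in> strictly_upper r 1 \<longrightarrow> N *v v \<in> flag g r m)"
proof
  let ?c = "ginv g *v v"
  have eq: "ginv g *v (N *v v) = Ad (ginv g) N *v ?c" for N
    using g by (simp add: Ad_def matrix_vector_mul_assoc matrix_mul_assoc[symmetric])
  {
    assume v: "v \<in> flag g r (Suc m)"
    show "\<forall>N. Ad (ginv g) N \<in> strictly_upper r 1 \<longrightarrow> N *v v \<in> flag g r m"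
    proof (intro allI impI)
      fix N assume N: "Ad (ginv g) N \<in> strictly_upper r 1"
      have zero: "Ad (ginv g) N $ i $ j * ?c $ j = 0" if "m \<le> r i" for i j
      proof (cases "r j < r i + 1")
        case True
        then show ?thesis using N by (simp add: strictly_upper_def)
      next
        case False
        then show ?thesis using v that by (simp add: flag_iff[OF g])
      qed
      show "N *v v \<in> flag g r m"
        unfolding flag_iff[OF g] eq matrix_vector_mult_def[of "Ad (ginv g) N"] vec_lambda_beta
        by (intro allI impI sum.neutral ballI zero)
    qed
  next
    assume *: "\<forall>N. Ad (ginv g) N \<in> strictly_upper r 1 \<longrightarrow> N *v v \<in> flag g r m"
    show "v \<in> flag g r (Suc m)"
      unfolding flag_iff[OF g]
    proof (intro allI impI)
      fix p assume p: "Suc m \<le> r p"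
      moreover have "r p < CARD('n)" using r by (auto simp: bij_betw_def)
      ultimately obtain q where q: "r q = m" using r by (metis bij_betw_iff_bijections lessThan_iff less_trans Suc_le_lessD)
      \<comment> \<open>It moves coordinate \<open>p\<close> to position \<open>q\<close>, the first
        one that has to vanish on step \<open>m\<close>.\<close>
      let ?N = "Ad g (elementary q p)"
      have "Ad (ginv g) ?N \<in> strictly_upper r 1"
        using g p q by (auto simp: strictly_upper_def elementary_def)
      then have "?N *v v \<in> flag g r m" using * by blast
      then have "(elementary q p *v ?c) $ q = 0" unfolding flag_iff[OF g] eq using g q by simp
      then show "?c $ p = 0" by (simp add: elementary_mult_vec axis_def)
    qed
  }
qed

text \<open>If \<open>N\<close> violated the criterion of \<open>flag_Suc_iff\<close>, some
  functional \<open>\<mu>\<close> would detect this. Applied to the entries of \<open>N\<close>, it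
  gives a form over \<open>k\<close> that still vanishes on the group, so the induction hypothesis
  applies to it. The two functionals can be exchanged: both orders give the sums over
  \<open>j\<close> of \<open>\<mu>(N_ij) l(v_j)\<close>.\<close>

lemma base_vec_flag:
  fixes g :: "'k::field alg_closure^'n::finite^'n"
  assumes g: "g \<in> carrier GL" and r: "bij_betw r UNIV {..<CARD('n)}"
    and B: "defined_over_base (triangular_group g r)"
    and l: "base_linear l" and v: "v \<in> flag g r m"
  shows "base_vec l v \<in> flag g r m"
  using l v
proof (induction m arbitrary: l v)
  case 0
  have "v = g *v (ginv g *v v)" using g by (simp add: matrix_vector_mul_assoc)
  moreover have "ginv g *v v = 0" using 0(2) by (simp add: flag_iff[OF g] vec_eq_iff)
  ultimately have "v = 0" by simp
  then have "base_vec l v = 0" by (simp add: base_vec_def vec_eq_iff base_linear_0[OF 0(1)])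
  then show ?case using vec.subspace_0 by (auto simp: flag_iff[OF g])
next
  case (Suc m)
  show ?case
    unfolding flag_Suc_iff[OF g r]
  proof (intro allI impI, rule ccontr)
    fix N assume N: "Ad (ginv g) N \<in> strictly_upper r 1" and nin: "N *v base_vec l v \<notin> flag g r m"
    obtain \<mu> where \<mu>: "base_linear \<mu>" "base_vec \<mu> (N *v base_vec l v) \<notin> flag g r m"
      by (rule base_linear_separates[OF subspace_flag nin])
    let ?N = "map_matrix (\<lambda>c. to_ac (\<mu> c)) N"
    have "trace_poly N \<in> vanishing id (triangular_group g r)"
      using N trace_vanishes_triangular_group[OF g, of r N]
      by (auto simp: vanishing_def id.poly_at_trace_poly map_matrix_def)
    then have "trace_poly (map_matrix \<mu> N) \<in> vanishing to_ac (triangular_group g r)"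
      unfolding map_trace_poly[OF \<mu>(1), symmetric] by (rule vanishing_base_linear[OF B \<mu>(1)])
    then have "\<forall>x\<in>triangular_group g r. trace (?N ** x) = 0"
      by (simp add: vanishing_def to_ac.poly_at_trace_poly map_matrix_def)
    then have "Ad (ginv g) ?N \<in> strictly_upper r 1"
      using trace_vanishes_triangular_group[OF g] by blast
    then have "?N *v v \<in> flag g r m" using Suc.prems(2) unfolding flag_Suc_iff[OF g r] by blast
    then have "base_vec l (?N *v v) \<in> flag g r m" by (rule Suc.IH[OF Suc.prems(1)])
    moreover have "base_vec l (?N *v v) = base_vec \<mu> (N *v base_vec l v)"
      by (simp add: base_vec_def vec_eq_iff matrix_vector_mult_def base_linear_sum[OF Suc.prems(1)]
          base_linear_sum[OF \<mu>(1)] base_linear_scale[OF Suc.prems(1)] base_linear_scale_right[OF \<mu>(1)])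
    ultimately show False using \<mu>(2) by simp
  qed
qed

text \<open>At the last nonzero coordinate \<open>i\<close> of a kernel vector \<open>c\<close>, row
  \<open>i\<close> reduces to \<open>u_ii c_i = 0\<close>.\<close>

lemma upper_nonzero_diagonal_GL:
  fixes u :: "'K::field^'n::finite^'n"
  assumes "inj r" "u \<in> upper r" "\<And>i. u $ i $ i \<noteq> 0"
  shows "u \<in> carrier GL"
proof -
  have "c = 0" if c: "u *v c = 0" for c :: "'K^'n"
  proof (rule ccontr)
    assume "c \<noteq> 0"
    then have ne: "{i. c $ i \<noteq> 0} \<noteq> {}" by (auto simp: vec_eq_iff)
    have "Max (r ` {i. c $ i \<noteq> 0}) \<in> r ` {i. c $ i \<noteq> 0}" using ne by (intro Max_in) auto
    then obtain i where i: "c $ i \<noteq> 0" and ri: "r i = Max (r ` {i. c $ i \<noteq> 0})" by auto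
    have max: "r j \<le> r i" if "c $ j \<noteq> 0" for j unfolding ri using that by (intro Max_ge) auto
    have "(u *v c) $ i = (\<Sum>j\<in>{i}. u $ i $ j * c $ j)"
      unfolding matrix_vector_mult_def
    proof (simp only: vec_lambda_beta, rule sum.mono_neutral_right)
      show "\<forall>j\<in>UNIV - {i}. u $ i $ j * c $ j = 0"
      proof
        fix j assume "j \<in> UNIV - {i}"
        then have "r j \<noteq> r i" using \<open>inj r\<close> by (auto dest: injD)
        then show "u $ i $ j * c $ j = 0" using max[of j] assms(2) by (cases "c $ j = 0") (auto simp: upper_def)
      qed
    qed auto
    then show False using c i assms(3) by simp
  qed
  then have "\<exists>u'. u' ** u = mat 1" using matrix_left_invertible_ker[of u] by simp
  then show ?thesis using invertible_left_inverse[of u] by (simp add: GL_carrier)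
qed

lemma to_ac_GL_iff: "map_matrix to_ac g \<in> carrier GL \<longleftrightarrow> g \<in> carrier GL"
proof -
  have "det (map_matrix to_ac g) = to_ac (det g)"
    by (simp add: det_def to_ac_sum to_ac_prod)
  then show ?thesis by (simp add: det_nonzero_GL)
qed

text \<open>For each column of \<open>g\<close> some functional keeps it outside step
  \<open>r j\<close> of the flag, while \<open>base_vec_flag\<close> keeps it inside step
  \<open>Suc (r j)\<close>. The resulting columns over \<open>k\<close> differ from those of
  \<open>g\<close> by a triangular matrix with nonzero diagonal and so define the same
  group.\<close>

theorem borel_subgroup_over_base:
  fixes B :: "('k::field alg_closure^'n::finite^'n) set"
  assumes B: "borel_subgroup B" and r: "bij_betw r UNIV {..<CARD('n)}"
  obtains g0 where "g0 \<in> carrier GL" "B = triangular_group (map_matrix to_ac g0) r"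
proof -
  have inj: "inj r" using r by (simp add: bij_betw_def)
  have cs: "connected_solvable B"
    and max: "\<And>B'. connected_solvable B' \<Longrightarrow> B \<subseteq> B' \<Longrightarrow> B' = B"
    using B unfolding borel_subgroup_def by auto
  obtain g where g: "g \<in> carrier GL" and Bg: "B = triangular_group g r"
    by (rule connected_solvable_maximal[OF cs max r])
  have base: "defined_over_base (triangular_group g r)"
    using B by (simp add: borel_subgroup_def k_subgroup_def Bg)
  have "\<exists>l. base_linear l \<and> base_vec l (column j g) \<notin> flag g r (r j)" for j
  proof -
    have "column j g \<notin> flag g r (r j)" by (simp add: column_in_flag[OF g])
    then show ?thesis by (rule base_linear_separates[OF subspace_flag]) blast
  qed
  then obtain l where l: "\<And>j. base_linear (l j)" "\<And>j. base_vec (l j) (column j g) \<notin> flag g r (r j)"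
    by metis
  define g0 where "g0 = (\<chi> i j. l j (g $ i $ j))"
  let ?G = "map_matrix to_ac g0"
  have col: "column j ?G = base_vec (l j) (column j g)" for j
    by (simp add: g0_def column_def base_vec_def vec_eq_iff)
  let ?u = "ginv g ** ?G"
  have u: "?u $ i $ j = (ginv g *v column j ?G) $ i" for i j
    by (simp add: column_def matrix_matrix_mult_def matrix_vector_mult_def)
  have "column j ?G \<in> flag g r (Suc (r j))" for j
    unfolding col using column_in_flag[OF g, of j r "Suc (r j)"] by (intro base_vec_flag[OF g r base l(1)]) simp
  then have up: "?u \<in> upper r" unfolding upper_def flag_iff[OF g] by (auto simp: u Suc_le_eq)
  have diag: "?u $ j $ j \<noteq> 0" for j
  proof
    assume 0: "?u $ j $ j = 0"
    have "(ginv g *v column j ?G) $ i = 0" if "r j \<le> r i" for i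
    proof (cases "i = j")
      case True
      then show ?thesis using 0 u by simp
    next
      case False
      then have "r j < r i" using that inj by (metis injD le_neq_implies_less)
      then show ?thesis using up by (simp add: upper_def u)
    qed
    then have "column j ?G \<in> flag g r (r j)" by (simp add: flag_iff[OF g])
    then show False using l(2) col by simp
  qed
  have uG: "?u \<in> carrier GL" by (rule upper_nonzero_diagonal_GL[OF inj up diag])
  have G: "?G = g ** ?u" using g by simp
  then have GG: "?G \<in> carrier GL" using g uG by (metis GL_mem_mult)
  have "Ad (ginv ?G) x = Ad (ginv ?u) (Ad (ginv g) x)" for x
    using G GL_inv_mult[OF g uG] Ad_mult[of "ginv ?u" "ginv g"] g uG by (metis GL.inv_closed)
  moreover have "Ad (ginv ?u) y \<in> upper r \<longleftrightarrow> y \<in> upper r" for y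
  proof
    assume "Ad (ginv ?u) y \<in> upper r"
    then have "?u ** Ad (ginv ?u) y ** ginv ?u \<in> upper r"
      by (intro upper_mult upper_inv up uG inj)
    then show "y \<in> upper r" using Ad_Ad_inv[OF uG, of y] by (simp only: Ad_def[of ?u])
  next
    assume "y \<in> upper r"
    then show "Ad (ginv ?u) y \<in> upper r"
      unfolding Ad_def using uG by (simp add: upper_mult upper_inv up inj)
  qed
  ultimately have "triangular_group ?G r = triangular_group g r" by (simp add: triangular_group_def)
  then show thesis using that[of g0] GG Bg by (simp add: to_ac_GL_iff)
qed

section \<open>Matrices over the dual numbers\<close>

definition dual_matrix :: "'k::comm_ring_1^'n::finite^'n \<Rightarrow> 'k^'n^'n \<Rightarrow> 'k dual^'n^'n" where
  "dual_matrix a b = (\<chi> i j. Dual (a $ i $ j) (b $ i $ j))"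

lemma dual_matrix_cases: obtains a b where "x = dual_matrix a b"
proof
  show "x = dual_matrix (\<chi> i j. std (x $ i $ j)) (\<chi> i j. (case x $ i $ j of Dual _ b \<Rightarrow> b))"
    by (simp add: dual_matrix_def vec_eq_iff dual.case_eq_if)
qed

lemma dual_matrix_eq_iff: "dual_matrix a b = dual_matrix c d \<longleftrightarrow> a = c \<and> b = d"
  by (auto simp: dual_matrix_def vec_eq_iff)

lemma sum_Dual: "(\<Sum>i\<in>I. Dual (f i) (g i)) = Dual (\<Sum>i\<in>I. f i) (\<Sum>i\<in>I. g i)"
  by (induction I rule: infinite_finite_induct) (simp_all add: zero_dual_def)

lemma dual_matrix_mult: "dual_matrix a b ** dual_matrix c d = dual_matrix (a ** c) (a ** d + b ** c)"
  by (simp add: dual_matrix_def matrix_matrix_mult_def vec_eq_iff sum_Dual sum.distrib)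

lemma dual_matrix_one: "mat 1 = dual_matrix (mat 1) 0"
  by (simp add: dual_matrix_def mat_def vec_eq_iff one_dual_def zero_dual_def)

lemma dual_matrix_zero: "0 = dual_matrix 0 0"
  by (simp add: dual_matrix_def vec_eq_iff zero_dual_def)

lemma map_std_dual_matrix [simp]: "map_matrix std (dual_matrix a b) = a"
  by (simp add: dual_matrix_def vec_eq_iff)

lemma map_dual_of [simp]: "map_matrix dual_of a = dual_matrix a 0"
  by (simp add: dual_matrix_def vec_eq_iff dual_of_def)

lemma dual_matrix_GL_iff: "dual_matrix a b \<in> carrier GL \<longleftrightarrow> a \<in> carrier GL"
proof
  assume "dual_matrix a b \<in> carrier GL"
  then show "a \<in> carrier GL" using std.mm_GL by fastforce
next
  assume a: "a \<in> carrier GL"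
  let ?i = "ginv a"
  have neg: "c ** (- d) = - (c ** d)" "(- d) ** c = - (d ** c)" for c d :: "'a^'b^'b"
    by (simp_all add: matrix_matrix_mult_def vec_eq_iff sum_negf)
  show "dual_matrix a b \<in> carrier GL"
    by (rule GL_memI[of _ "dual_matrix ?i (- (?i ** b ** ?i))"])
       (use a in \<open>simp_all add: dual_matrix_mult dual_matrix_one neg matrix_mul_assoc[symmetric]\<close>)
qed

lemma Ad_dual_matrix: "g \<in> carrier GL \<Longrightarrow> Ad (dual_matrix g 0) (dual_matrix a b) = dual_matrix (Ad g a) (Ad g b)"
proof -
  assume g: "g \<in> carrier GL"
  have "ginv (dual_matrix g 0) = dual_matrix (ginv g) 0"
    using dual_of.mm_inv[OF g] by simp
  then show ?thesis by (simp add: Ad_def dual_matrix_mult)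
qed

text \<open>Conjugating an infinitesimal matrix involves only the reduction \<open>h\<close>, since
  \<open>\<epsilon>^2 = 0\<close>. This makes the directions \<open>A\<close> and \<open>Z\<close>
  independent.\<close>

lemma Ad_inv_dual_eps:
  assumes "h \<in> carrier GL"
  shows "Ad (ginv (dual_matrix h Z)) (dual_matrix 0 A) = dual_matrix 0 (Ad (ginv h) A)"
proof -
  have G: "dual_matrix h Z \<in> carrier GL" using assms by (simp add: dual_matrix_GL_iff)
  obtain c d where cd: "ginv (dual_matrix h Z) = dual_matrix c d" by (rule dual_matrix_cases)
  have "c = ginv h" using arg_cong[OF cd, of "map_matrix std"] std.mm_inv[OF G] by simp
  then show ?thesis using assms
    unfolding Ad_def GL.inv_inv[OF G] unfolding cd by (simp add: dual_matrix_mult)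
qed

lemma dual_matrix_upper_iff: "dual_matrix a b \<in> upper r \<longleftrightarrow> a \<in> upper r \<and> b \<in> upper r"
  by (auto simp: upper_def dual_matrix_def zero_dual_def)


section \<open>Points and Lie algebra of a Borel subgroup\<close>

text \<open>Every entry of the conjugate is a linear form in \<open>y\<close> with coefficients from
  the source ring. With source \<open>k\<close>, the entries below the diagonal become equations
  over \<open>k\<close> for the triangular group.\<close>

lemma (in ring_map) trace_Ad_entry:
  fixes g :: "'r^'n::finite^'n" and y :: "'s^'n^'n"
  assumes g: "g \<in> carrier GL"
  shows "trace (map_matrix \<phi> (\<chi> b a. (ginv g) $ i $ a * g $ b $ j) ** y) =
    Ad (ginv (map_matrix \<phi> g)) y $ i $ j"
proof -
  have G: "map_matrix \<phi> g \<in> carrier GL" by (rule mm_GL[OF g])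
  have "(ginv (map_matrix \<phi> g)) $ i $ a = \<phi> ((ginv g) $ i $ a)" for a
    using mm_inv[OF g] by (metis nth_map_matrix)
  then show ?thesis
    by (subst Ad_entry, subst sum.swap)
      (simp add: G trace_def matrix_matrix_mult_def map_mult mult_ac)
qed

lemma points_triangular_group_subset:
  assumes "ring_map \<iota>" and g: "g \<in> carrier GL" and x: "x \<in> points \<iota> (triangular_group (map_matrix to_ac g) r)"
  shows "Ad (ginv (map_matrix \<iota> g)) x \<in> upper r"
proof -
  interpret \<iota>: ring_map \<iota> by fact
  have "Ad (ginv (map_matrix \<iota> g)) x $ i $ j = 0" if ij: "r j < r i" for i j
  proof -
    let ?c = "\<chi> b a. (ginv g) $ i $ a * g $ b $ j"
    have "trace_poly ?c \<in> vanishing to_ac (triangular_group (map_matrix to_ac g) r)"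
      unfolding vanishing_def
      by (auto simp: to_ac.poly_at_trace_poly to_ac.trace_Ad_entry[OF g] triangular_group_def upper_def ij)
    then have "poly_at \<iota> (trace_poly ?c) x = 0" using x by (auto simp: points_def)
    then show ?thesis by (simp add: \<iota>.poly_at_trace_poly \<iota>.trace_Ad_entry[OF g])
  qed
  then show ?thesis by (simp add: upper_def)
qed

lemma points_id_triangular_group:
  assumes g: "g \<in> carrier GL"
  shows "points id (triangular_group (map_matrix to_ac g) r) = {x \<in> carrier GL. Ad (ginv g) x \<in> upper r}"
proof (intro equalityI subsetI)
  fix x assume x: "x \<in> points id (triangular_group (map_matrix to_ac g) r)"
  have "map_matrix id g = g" by (simp add: vec_eq_iff)
  then show "x \<in> {x \<in> carrier GL. Ad (ginv g) x \<in> upper r}"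
    using points_triangular_group_subset[OF ring_map_id g x] x by (simp add: points_def)
next
  fix x assume x: "x \<in> {x \<in> carrier GL. Ad (ginv g) x \<in> upper r}"
  have "Ad (ginv (map_matrix to_ac g)) (map_matrix to_ac x) = map_matrix to_ac (Ad (ginv g) x)"
    using g by (simp add: to_ac.mm_Ad to_ac.mm_inv)
  then have "map_matrix to_ac x \<in> triangular_group (map_matrix to_ac g) r"
    using x by (simp add: triangular_group_def upper_def to_ac.mm_GL)
  then have "to_ac (poly_at id f x) = 0" if "f \<in> vanishing to_ac (triangular_group (map_matrix to_ac g) r)" for f
    using that by (simp add: to_ac.poly_at_map vanishing_def)
  then show "x \<in> points id (triangular_group (map_matrix to_ac g) r)" using x by (simp add: points_def)
qed

fun dual_to_ac :: "'k::field dual \<Rightarrow> 'k alg_closure dual" where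
  "dual_to_ac (Dual a b) = Dual (to_ac a) (to_ac b)"

lemma ring_map_dual_to_ac: "ring_map dual_to_ac"
proof
  fix x y :: "'a dual"
  show "dual_to_ac (x + y) = dual_to_ac x + dual_to_ac y" by (cases x; cases y) simp
  show "dual_to_ac (x * y) = dual_to_ac x * dual_to_ac y" by (cases x; cases y) simp
qed (simp add: one_dual_def)

text \<open>Reduction modulo \<open>t^2\<close>, with \<open>t\<close> becoming
  \<open>\<epsilon>\<close>.\<close>

definition poly_to_dual :: "'K::comm_ring_1 poly \<Rightarrow> 'K dual" where
  "poly_to_dual q = Dual (poly.coeff q 0) (poly.coeff q 1)"

lemma ring_map_poly_to_dual: "ring_map poly_to_dual"
proof
  fix x y :: "'a poly"
  show "poly_to_dual (x + y) = poly_to_dual x + poly_to_dual y" by (simp add: poly_to_dual_def)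
  have "poly.coeff (x * y) 1 = poly.coeff x 0 * poly.coeff y 1 + poly.coeff x 1 * poly.coeff y 0"
    by (simp add: Polynomial.coeff_mult atMost_Suc)
  then show "poly_to_dual (x * y) = poly_to_dual x * poly_to_dual y"
    by (simp add: poly_to_dual_def Polynomial.coeff_mult)
qed (simp add: poly_to_dual_def one_dual_def)

text \<open>
  A polynomial vanishing on the group vanishes on \<open>a + bt\<close> for almost all \<open>t\<close>, hence as a polynomial
  in \<open>t\<close>; now put \<open>t = \<epsilon>\<close>.
\<close>

lemma points_dual_triangular_group:
  assumes g: "g \<in> carrier GL"
  shows "points dual_of (triangular_group (map_matrix to_ac g) r) =
    {x \<in> carrier GL. Ad (ginv (dual_matrix g 0)) x \<in> upper r}"
proof (intro equalityI subsetI)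
  fix x assume "x \<in> points dual_of (triangular_group (map_matrix to_ac g) r)"
  then show "x \<in> {x \<in> carrier GL. Ad (ginv (dual_matrix g 0)) x \<in> upper r}"
    using points_triangular_group_subset[OF ring_map_dual_of g] by (simp add: points_def)
next
  let ?B = "triangular_group (map_matrix to_ac g) r"
  interpret d: ring_map dual_to_ac by (rule ring_map_dual_to_ac)
  interpret p: ring_map poly_to_dual by (rule ring_map_poly_to_dual)
  fix x assume x: "x \<in> {x \<in> carrier GL. Ad (ginv (dual_matrix g 0)) x \<in> upper r}"
  obtain a b where ab: "x = dual_matrix a b" by (rule dual_matrix_cases)
  have gi: "ginv g \<in> carrier GL" using g by simp
  have "ginv (dual_matrix g 0) = dual_matrix (ginv g) 0" using dual_of.mm_inv[OF g] by simp
  then have up: "Ad (ginv g) a \<in> upper r" "Ad (ginv g) b \<in> upper r" and aG: "a \<in> carrier GL"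
    using x by (auto simp: ab Ad_dual_matrix[OF gi] dual_matrix_upper_iff dual_matrix_GL_iff)
  let ?a = "map_matrix to_ac a" and ?b = "map_matrix to_ac b"
  let ?L = "line_matrix ?a ?b"
  let ?y = "\<lambda>t. map_matrix (\<lambda>q. poly q t) ?L"
  have y: "?y t = ?a + map_matrix ((*) t) ?b" for t by (simp add: vec_eq_iff line_matrix_def)
  have Adto: "Ad (ginv (map_matrix to_ac g)) (map_matrix to_ac c) = map_matrix to_ac (Ad (ginv g) c)" for c
    using g by (simp add: to_ac.mm_Ad to_ac.mm_inv)
  have to_ac_upper: "map_matrix to_ac c \<in> upper r" if "c \<in> upper r" for c :: "'a^'b^'b"
    using that by (simp add: upper_def)
  have yB: "?y t \<in> ?B" if "?y t \<in> carrier GL" for t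
    using that unfolding triangular_group_def y
    by (auto simp: Ad_add Ad_scale Adto intro!: upper_add upper_scale to_ac_upper up)
  have det: "poly_fun (\<lambda>g :: 'a alg_closure^'b^'b. det g)" by (intro poly_fun_det poly_fun_entry)
  \<comment> \<open>The determinant along the line is not the zero polynomial, because
    \<open>a\<close> is invertible; so it can be cancelled from a vanishing product.\<close>
  obtain q3 where q3: "\<And>t. poly q3 t = det (?y t)"
    by (rule poly_fun_line[OF det, where a="?a" and b="?b"], rule that)
  have "?y 0 = ?a" by (simp add: vec_eq_iff line_matrix_def)
  moreover have "?a \<in> carrier GL" using aG by (simp add: to_ac_GL_iff)
  ultimately have "poly q3 0 \<noteq> 0" unfolding q3 by (simp add: det_nonzero_GL)
  then have q3_ne: "q3 \<noteq> 0" by auto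
  have "poly_at dual_of f x = 0" if f: "f \<in> vanishing to_ac ?B" for f
  proof -
    define q where "q = poly_at (\<lambda>c. [:to_ac c:]) f ?L"
    have "poly (q * q3) t = 0" for t
    proof (cases "?y t \<in> carrier GL")
      case True
      then have "poly q t = 0" unfolding q_def poly_at_line using f yB by (simp add: vanishing_def)
      then show ?thesis by simp
    next
      case False
      then show ?thesis by (simp add: q3 det_nonzero_GL)
    qed
    then have "infinite {t. poly (q * q3) t = 0}" using infinite_alg_closed_field[where 'K="'a alg_closure"] by simp
    then have "q * q3 = 0" using poly_roots_finite by blast
    then have "q = 0" using q3_ne by simp
    then have "poly_to_dual q = 0" by (simp add: p.map_zero)
    moreover have "poly_to_dual q = poly_at (\<lambda>c. Dual (to_ac c) 0) f (dual_matrix ?a ?b)"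
    proof -
      have "map_matrix poly_to_dual ?L = dual_matrix ?a ?b"
        by (simp add: vec_eq_iff line_matrix_def dual_matrix_def poly_to_dual_def)
      then show ?thesis unfolding q_def p.poly_at_map by (simp add: poly_to_dual_def)
    qed
    \<comment> \<open>The comparison is made over the closure, into whose dual numbers those of
      \<open>k\<close> embed.\<close>
    moreover have "dual_to_ac (poly_at dual_of f x) = poly_at (\<lambda>c. Dual (to_ac c) 0) f (dual_matrix ?a ?b)"
    proof -
      have "map_matrix dual_to_ac x = dual_matrix ?a ?b"
        by (simp add: vec_eq_iff ab dual_matrix_def)
      then show ?thesis unfolding d.poly_at_map by (simp add: dual_of_def)
    qed
    ultimately have "dual_to_ac (poly_at dual_of f x) = 0" by simp
    then show ?thesis by (cases "poly_at dual_of f x") (simp add: zero_dual_def)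
  qed
  then show "x \<in> points dual_of ?B" using x by (simp add: points_def)
qed

lemma lie_triangular_group:
  assumes g: "g \<in> carrier GL"
  shows "lie (triangular_group (map_matrix to_ac g) r) = {A. Ad (ginv g) A \<in> upper r}"
proof -
  have gi: "ginv g \<in> carrier GL" using g by simp
  have inv: "ginv (dual_matrix g 0) = dual_matrix (ginv g) 0" using dual_of.mm_inv[OF g] by simp
  have "lie (triangular_group (map_matrix to_ac g) r)
      = {A. dual_matrix (mat 1) A \<in> points dual_of (triangular_group (map_matrix to_ac g) r)}"
    by (simp add: lie_def dual_matrix_def)
  then show ?thesis
    by (simp add: points_dual_triangular_group[OF g] inv Ad_dual_matrix[OF gi] dual_matrix_upper_iff
        dual_matrix_GL_iff Ad_mat_one[OF gi])
qed

text \<open>The three hypotheses make \<open>lie H\<close> a \<open>k\<close>-space; extending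
  scalars to \<open>k + k \<epsilon>\<close> then yields two copies of it.\<close>

lemma lie_points_dual:
  assumes add: "\<And>A C. A \<in> lie H \<Longrightarrow> C \<in> lie H \<Longrightarrow> A + C \<in> lie H"
    and scale: "\<And>c A. A \<in> lie H \<Longrightarrow> map_matrix ((*) c) A \<in> lie H" and zero: "0 \<in> lie H"
  shows "lie_points dual_of H = {dual_matrix A C | A C. A \<in> lie H \<and> C \<in> lie H}"
proof -
  interpret m: Modules.module "\<lambda>c :: 'a dual. map_matrix ((*) c) :: 'a dual^'b^'b \<Rightarrow> _"
    by unfold_locales (simp_all add: vec_eq_iff algebra_simps)
  let ?S = "{dual_matrix A C | A C. A \<in> lie H \<and> C \<in> lie H}"
  have "m.span (map_matrix dual_of ` lie H) = ?S"
  proof (intro equalityI subsetI)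
    fix x assume "x \<in> m.span (map_matrix dual_of ` lie H)"
    then show "x \<in> ?S"
    proof (induction rule: m.span_induct_alt)
      case base
      show ?case using dual_matrix_zero zero by blast
    next
      case (step c x y)
      then obtain A M N where A: "x = dual_matrix A 0" "A \<in> lie H" and MN: "y = dual_matrix M N" "M \<in> lie H" "N \<in> lie H"
        by auto
      obtain u v where c: "c = Dual u v" by (cases c)
      have "map_matrix ((*) c) x + y = dual_matrix (map_matrix ((*) u) A + M) (map_matrix ((*) v) A + N)"
        by (simp add: vec_eq_iff A MN c dual_matrix_def)
      then show ?case using A MN add scale by blast
    qed
  next
    fix x assume "x \<in> ?S"
    then obtain A C where AC: "x = dual_matrix A C" "A \<in> lie H" "C \<in> lie H" by auto
    have "x = map_matrix dual_of A + map_matrix ((*) (Dual 0 1)) (map_matrix dual_of C)"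
      by (simp add: AC vec_eq_iff dual_matrix_def)
    also have "\<dots> \<in> m.span (map_matrix dual_of ` lie H)"
      using AC by (intro m.span_add m.span_scale m.span_base) auto
    finally show "x \<in> m.span (map_matrix dual_of ` lie H)" .
  qed
  then show ?thesis by (simp add: lie_points_def)
qed

section \<open>Split tori are diagonalizable over the base field\<close>

text \<open>Dedekind's argument: choose \<open>s\<close> with
  \<open>\<psi> s \<noteq> \<psi>0 s\<close> and subtract \<open>\<psi>0 s\<close> times the
  relation at \<open>t\<close> from the relation at \<open>mul s t\<close>. The term of
  \<open>\<psi>0\<close> disappears.\<close>

lemma characters_independent:
  fixes \<Psi> :: "('a \<Rightarrow> 'K::field) set"
  assumes fin: "finite \<Psi>"
    and mult: "\<And>\<psi> s t. \<psi> \<in> \<Psi> \<Longrightarrow> s \<in> C \<Longrightarrow> t \<in> C \<Longrightarrow> \<psi> (mul s t) = \<psi> s * \<psi> t"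
    and closed: "\<And>s t. s \<in> C \<Longrightarrow> t \<in> C \<Longrightarrow> mul s t \<in> C"
    and one: "e \<in> C" "\<And>\<psi>. \<psi> \<in> \<Psi> \<Longrightarrow> \<psi> e = 1"
    and distinct: "\<And>\<psi> \<psi>'. \<psi> \<in> \<Psi> \<Longrightarrow> \<psi>' \<in> \<Psi> \<Longrightarrow> \<psi> \<noteq> \<psi>' \<Longrightarrow> \<exists>t\<in>C. \<psi> t \<noteq> \<psi>' t"
    and zero: "\<And>t. t \<in> C \<Longrightarrow> (\<Sum>\<psi>\<in>\<Psi>. a \<psi> * \<psi> t) = 0"
    and \<psi>: "\<psi> \<in> \<Psi>"
  shows "a \<psi> = 0"
  using assms
proof (induction \<Psi> arbitrary: a \<psi> rule: finite_induct)
  case (insert \<psi>0 \<Psi>)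
  have X0: "a \<psi> = 0" if in_X: "\<psi> \<in> \<Psi>" for \<psi>
  proof -
    have "\<psi> \<noteq> \<psi>0" using in_X insert.hyps by auto
    then obtain s where s: "s \<in> C" "\<psi> s \<noteq> \<psi>0 s" using insert.prems(5)[of \<psi> \<psi>0] in_X by auto
    have "a \<psi> * (\<psi> s - \<psi>0 s) = 0"
    proof (rule insert.IH[where a="\<lambda>\<psi>. a \<psi> * (\<psi> s - \<psi>0 s)"])
      fix t assume t: "t \<in> C"
      have "(\<Sum>\<psi>\<in>insert \<psi>0 \<Psi>. a \<psi> * \<psi> (mul s t)) = (\<Sum>\<psi>\<in>insert \<psi>0 \<Psi>. a \<psi> * (\<psi> s * \<psi> t))"
        using insert.prems(1) s t by (intro sum.cong) auto
      then have 1: "(\<Sum>\<psi>\<in>insert \<psi>0 \<Psi>. a \<psi> * (\<psi> s * \<psi> t)) = 0"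
        using insert.prems(6)[of "mul s t"] insert.prems(2)[of s t] s t by simp
      have 2: "\<psi>0 s * (\<Sum>\<psi>\<in>insert \<psi>0 \<Psi>. a \<psi> * \<psi> t) = 0" using insert.prems(6)[of t] t by simp
      have "(\<Sum>\<psi>\<in>insert \<psi>0 \<Psi>. a \<psi> * (\<psi> s * \<psi> t)) - \<psi>0 s * (\<Sum>\<psi>\<in>insert \<psi>0 \<Psi>. a \<psi> * \<psi> t)
          = (\<Sum>\<psi>\<in>insert \<psi>0 \<Psi>. a \<psi> * (\<psi> s - \<psi>0 s) * \<psi> t)"
        by (simp add: sum_distrib_left sum_subtractf[symmetric] algebra_simps)
      also have "\<dots> = (\<Sum>\<psi>\<in>\<Psi>. a \<psi> * (\<psi> s - \<psi>0 s) * \<psi> t)" using insert.hyps by simp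
      finally show "(\<Sum>\<psi>\<in>\<Psi>. a \<psi> * (\<psi> s - \<psi>0 s) * \<psi> t) = 0" using 1 2 by simp
    qed (use insert.prems in_X in auto)
    then show ?thesis using s by simp
  qed
  have "(\<Sum>\<psi>\<in>insert \<psi>0 \<Psi>. a \<psi> * \<psi> e) = a \<psi>0 * \<psi>0 e" using insert.hyps X0 by simp
  then have "a \<psi>0 = 0" using insert.prems(6)[OF insert.prems(3)] insert.prems(4)[of \<psi>0] by simp
  then show ?case using X0 insert.prems(7) by auto
qed simp

text \<open>The character with exponent \<open>m\<close>, extended by \<open>undefined\<close> off
  the torus: characters that agree on the torus are then equal functions, as the independence
  argument requires.\<close>

definition weight :: "nat \<Rightarrow> (nat \<Rightarrow>\<^sub>0 int) \<Rightarrow> (nat \<Rightarrow> 'K::field) \<Rightarrow> 'K" where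
  "weight r m = (\<lambda>t\<in>carrier (Gm_power r). \<Prod>i\<in>Poly_Mapping.keys m. t i powi Poly_Mapping.lookup m i)"

lemma weight_mult:
  assumes "s \<in> carrier (Gm_power r)" "t \<in> carrier (Gm_power r)"
  shows "weight r m (s \<otimes>\<^bsub>Gm_power r\<^esub> t) = weight r m s * weight r m t"
  using assms by (simp add: weight_def Gm_power_def power_int_mult_distrib prod.distrib)

text \<open>
  A split torus acts by \<open>\<Sum>\<psi> \<psi>(t) A\<^sub>\<psi>\<close> with matrices \<open>A\<^sub>\<psi>\<close> over \<open>k\<close>. By independence of characters the
  nonzero columns of \<open>A\<^sub>\<psi>\<close> are eigenvectors of weight \<open>\<psi>\<close>, and they span since \<open>\<Sum>\<psi> A\<^sub>\<psi> = 1\<close>.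
\<close>

theorem split_torus_diagonalizable:
  fixes T :: "('k::field alg_closure^'n::finite^'n) set"
  assumes T: "split_torus T"
  obtains g1 :: "'k^'n^'n" where "g1 \<in> carrier GL"
    "\<And>t i j. t \<in> T \<Longrightarrow> i \<noteq> j \<Longrightarrow> Ad (ginv (map_matrix to_ac g1)) t $ i $ j = 0"
proof -
  have "k_subgroup T" and "\<exists>r. \<exists>\<phi>\<in>iso (Gm_power r) (GL\<lparr>carrier := T\<rparr>).
      \<forall>i j. \<exists>f. \<forall>t\<in>carrier (Gm_power r). \<phi> t $ i $ j = laurent_at f t"
    using T unfolding split_torus_def by blast+
  then obtain r and \<phi> :: "(nat \<Rightarrow> 'k alg_closure) \<Rightarrow> 'k alg_closure^'n^'n" where sub: "subgroup T GL" and iso: "\<phi> \<in> iso (Gm_power r) (GL\<lparr>carrier := T\<rparr>)"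
    and "\<forall>i j. \<exists>f. \<forall>t\<in>carrier (Gm_power r). \<phi> t $ i $ j = laurent_at f t"
    unfolding k_subgroup_def by blast
  then obtain f where f: "\<And>i j t. t \<in> carrier (Gm_power r) \<Longrightarrow> \<phi> t $ i $ j = laurent_at (f i j) t"
    by metis
  let ?M = "Gm_power r :: (nat \<Rightarrow> 'k alg_closure) monoid"
  let ?C = "carrier ?M"
  have \<phi>T: "\<phi> ` ?C = T" and \<phi>_mult: "\<And>s t. s \<in> ?C \<Longrightarrow> t \<in> ?C \<Longrightarrow> \<phi> (s \<otimes>\<^bsub>?M\<^esub> t) = \<phi> s ** \<phi> t"
    using iso by (auto simp: iso_def hom_def bij_betw_def)
  have oneC: "\<one>\<^bsub>?M\<^esub> \<in> ?C" and closed: "\<And>s t. s \<in> ?C \<Longrightarrow> t \<in> ?C \<Longrightarrow> s \<otimes>\<^bsub>?M\<^esub> t \<in> ?C"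
    by (auto simp: Gm_power_def)
  define \<Psi> :: "((nat \<Rightarrow> 'k alg_closure) \<Rightarrow> 'k alg_closure) set"
    where "\<Psi> = weight r ` (\<Union>i j. Poly_Mapping.keys (f i j))"
  have finX: "finite \<Psi>" by (simp add: \<Psi>_def)
  \<comment> \<open>It collects the coefficients of all exponents that give the same
    character.\<close>
  define A :: "((nat \<Rightarrow> 'k alg_closure) \<Rightarrow> 'k alg_closure) \<Rightarrow> 'k^'n^'n"
    where "A \<psi> = (\<chi> i j. \<Sum>m | m \<in> Poly_Mapping.keys (f i j) \<and> weight r m = \<psi>. Poly_Mapping.lookup (f i j) m)" for \<psi>
  have expand: "\<phi> t $ i $ j = (\<Sum>\<psi>\<in>\<Psi>. to_ac (A \<psi> $ i $ j) * \<psi> t)" if t: "t \<in> ?C" for t i j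
  proof -
    have "\<phi> t $ i $ j = (\<Sum>m\<in>Poly_Mapping.keys (f i j). to_ac (Poly_Mapping.lookup (f i j) m) * weight r m t)"
      using t by (simp add: f laurent_at_def weight_def)
    also have "\<dots> = (\<Sum>\<psi>\<in>\<Psi>. \<Sum>m | m \<in> Poly_Mapping.keys (f i j) \<and> weight r m = \<psi>.
        to_ac (Poly_Mapping.lookup (f i j) m) * weight r m t)"
      by (rule sum.group[symmetric]) (use finX in \<open>auto simp: \<Psi>_def\<close>)
    also have "\<dots> = (\<Sum>\<psi>\<in>\<Psi>. to_ac (A \<psi> $ i $ j) * \<psi> t)"
      by (intro sum.cong) (auto simp: A_def to_ac_sum sum_distrib_right)
    finally show ?thesis .
  qed
  have X_mult: "\<psi> (s \<otimes>\<^bsub>?M\<^esub> t) = \<psi> s * \<psi> t" if "\<psi> \<in> \<Psi>" "s \<in> ?C" "t \<in> ?C" for \<psi> s t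
    using that weight_mult by (auto simp: \<Psi>_def)
  have X_one: "\<psi> \<one>\<^bsub>?M\<^esub> = 1" if "\<psi> \<in> \<Psi>" for \<psi>
    using that oneC by (auto simp: \<Psi>_def weight_def) (simp add: Gm_power_def)
  have X_distinct: "\<exists>t\<in>?C. \<psi> t \<noteq> \<psi>' t" if "\<psi> \<in> \<Psi>" "\<psi>' \<in> \<Psi>" "\<psi> \<noteq> \<psi>'" for \<psi> \<psi>'
  proof (rule ccontr)
    assume "\<not> ?thesis"
    then have "\<psi> t = \<psi>' t" for t using that by (cases "t \<in> ?C") (auto simp: \<Psi>_def weight_def)
    then show False using that by auto
  qed
  have eigen: "\<phi> t ** map_matrix to_ac (A \<psi>) = map_matrix ((*) (\<psi> t)) (map_matrix to_ac (A \<psi>))"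
    if t: "t \<in> ?C" and \<psi>: "\<psi> \<in> \<Psi>" for t \<psi>
  proof -
    \<comment> \<open>The two sides of \<open>\<phi> (t s) = \<phi> t \<phi> s\<close> are expanded
      in characters of \<open>s\<close>, and the coefficients of \<open>\<psi>\<close> are
      compared.\<close>
    have "\<psi> t * to_ac (A \<psi> $ i $ j) - (\<phi> t ** map_matrix to_ac (A \<psi>)) $ i $ j = 0" for i j
    proof (rule characters_independent[of \<Psi> ?C "\<lambda>s t. s \<otimes>\<^bsub>?M\<^esub> t" "\<one>\<^bsub>?M\<^esub>"
          "\<lambda>\<psi>. \<psi> t * to_ac (A \<psi> $ i $ j) - (\<phi> t ** map_matrix to_ac (A \<psi>)) $ i $ j" \<psi>])
      fix s assume s: "s \<in> ?C"
      have "(\<Sum>\<psi>\<in>\<Psi>. \<psi> t * to_ac (A \<psi> $ i $ j) * \<psi> s)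
          = (\<Sum>\<psi>\<in>\<Psi>. to_ac (A \<psi> $ i $ j) * \<psi> (t \<otimes>\<^bsub>?M\<^esub> s))"
        by (rule sum.cong) (simp_all add: X_mult[OF _ t s])
      also have "\<dots> = \<phi> (t \<otimes>\<^bsub>?M\<^esub> s) $ i $ j" by (rule expand[OF closed[OF t s], symmetric])
      also have "\<dots> = (\<Sum>k\<in>UNIV. \<phi> t $ i $ k * (\<Sum>\<psi>\<in>\<Psi>. to_ac (A \<psi> $ k $ j) * \<psi> s))"
        using \<phi>_mult[OF t s] expand[OF s] by (simp add: matrix_matrix_mult_def)
      also have "\<dots> = (\<Sum>\<psi>\<in>\<Psi>. (\<phi> t ** map_matrix to_ac (A \<psi>)) $ i $ j * \<psi> s)"
        by (simp add: matrix_matrix_mult_def sum_distrib_left sum_distrib_right mult.assoc) (rule sum.swap)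
      finally show "(\<Sum>\<psi>\<in>\<Psi>. (\<psi> t * to_ac (A \<psi> $ i $ j) - (\<phi> t ** map_matrix to_ac (A \<psi>)) $ i $ j) * \<psi> s) = 0"
        by (simp add: left_diff_distrib sum_subtractf)
    qed (fact finX X_mult closed oneC X_one X_distinct \<psi>)+
    then show ?thesis by (simp add: vec_eq_iff)
  qed
  have sumA: "(\<Sum>\<psi>\<in>\<Psi>. A \<psi>) = mat 1"
  proof -
    have "\<phi> \<one>\<^bsub>?M\<^esub> = mat 1"
    proof -
      have G: "\<phi> \<one>\<^bsub>?M\<^esub> \<in> carrier GL" using \<phi>T oneC subgroup.subset[OF sub] by blast
      have "\<phi> \<one>\<^bsub>?M\<^esub> ** \<phi> \<one>\<^bsub>?M\<^esub> = \<phi> \<one>\<^bsub>?M\<^esub>" using \<phi>_mult[OF oneC oneC] by (simp add: Gm_power_def)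
      then show ?thesis using GL_inv_left'[OF G, of "\<phi> \<one>\<^bsub>?M\<^esub>"] GL_inv_left[OF G] by simp
    qed
    moreover have "(\<Sum>\<psi>\<in>\<Psi>. to_ac (A \<psi> $ i $ j) * \<psi> \<one>\<^bsub>?M\<^esub>) = to_ac ((\<Sum>\<psi>\<in>\<Psi>. A \<psi>) $ i $ j)" for i j
      unfolding sum_component to_ac_sum by (rule sum.cong) (simp_all add: X_one)
    moreover have "(mat 1 :: 'k alg_closure^'n^'n) $ i $ j = to_ac (mat 1 $ i $ j)" for i j :: 'n
      by (simp add: mat_def)
    ultimately have "to_ac (mat 1 $ i $ j) = to_ac ((\<Sum>\<psi>\<in>\<Psi>. A \<psi>) $ i $ j)" for i j
      using expand[OF oneC, of i j] by simp
    then show ?thesis by (simp add: vec_eq_iff)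
  qed
  define S where "S = {column j (A \<psi>) | j \<psi>. \<psi> \<in> \<Psi>}"
  have "v \<in> vec.span S" for v :: "'k^'n"
  proof -
    have "v = (\<Sum>\<psi>\<in>\<Psi>. A \<psi>) *v v" by (simp add: sumA)
    also have "\<dots> = (\<Sum>\<psi>\<in>\<Psi>. A \<psi> *v v)"
      by (induction \<Psi> rule: infinite_finite_induct) (simp_all add: matrix_vector_mult_add_rdistrib)
    also have "\<dots> = (\<Sum>\<psi>\<in>\<Psi>. \<Sum>j\<in>UNIV. v $ j *s column j (A \<psi>))" by (simp add: matrix_mult_sum)
    also have "\<dots> \<in> vec.span S"
      by (intro vec.span_sum vec.span_scale vec.span_base) (auto simp: S_def)
    finally show ?thesis .
  qed
  then have spanS: "vec.span S = UNIV" by auto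
  obtain Bs where Bs: "Bs \<subseteq> S" "vec.independent Bs" "S \<subseteq> vec.span Bs"
    using vec.maximal_independent_subset by metis
  have spanB: "vec.span Bs = UNIV"
    using spanS vec.span_minimal[OF Bs(3) vec.subspace_span] by auto
  have "card Bs = CARD('n)"
    using vec.dim_eq_card_independent[OF Bs(2)] vec.dim_span[of Bs] vec_dim_card[where 'a='k and 'n='n]
    unfolding spanB by simp
  then obtain b where b: "bij_betw b (UNIV :: 'n set) Bs"
    using finite_same_card_bij[of "UNIV :: 'n set" Bs] vec.finiteI_independent[OF Bs(2)] by auto
  define g1 :: "'k^'n^'n" where "g1 = (\<chi> i j. b j $ i)"
  have col: "column j g1 = b j" for j by (simp add: g1_def column_def vec_eq_iff)
  have "columns g1 = Bs" using b unfolding columns_def bij_betw_def by (auto simp: col)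
  then have "\<exists>g'. g1 ** g' = mat 1" using matrix_right_invertible_span_columns[of g1] spanB by simp
  then have g1: "g1 \<in> carrier GL" using invertible_right_inverse[of g1] by (simp add: GL_carrier)
  let ?G = "map_matrix to_ac g1"
  have G: "?G \<in> carrier GL" by (rule to_ac.mm_GL[OF g1])
  have "Ad (ginv ?G) t $ i $ j = 0" if "t \<in> T" "i \<noteq> j" for t i j
  proof -
    obtain u where u: "u \<in> ?C" "t = \<phi> u" using \<phi>T \<open>t \<in> T\<close> by blast
    have "b j \<in> S" using b Bs(1) by (auto simp: bij_betw_def)
    then obtain \<psi> l where \<psi>: "\<psi> \<in> \<Psi>" "b j = column l (A \<psi>)" by (auto simp: S_def)
    have "column j ?G = column l (map_matrix to_ac (A \<psi>))"
      using col[of j] \<psi>(2) by (simp add: column_def vec_eq_iff)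
    then have "t *v column j ?G = column l (map_matrix ((*) (\<psi> u)) (map_matrix to_ac (A \<psi>)))"
      by (simp add: u(2) eigen[OF u(1) \<psi>(1)] flip: column_mult)
    also have "\<dots> = \<psi> u *s column j ?G"
      using \<open>column j ?G = _\<close> by (simp add: column_def vec_eq_iff)
    finally have "ginv ?G *v (t *v column j ?G) = \<psi> u *s column j (ginv ?G ** ?G)"
      by (simp add: vector_scalar_commute column_mult)
    moreover have "Ad (ginv ?G) t $ i $ j = (ginv ?G *v (t *v column j ?G)) $ i"
      using G by (simp add: Ad_def matrix_mul_assoc[symmetric] flip: column_mult) (simp add: column_def)
    ultimately show ?thesis using G \<open>i \<noteq> j\<close> by (simp add: column_def mat_def)
  qed
  then show thesis using that g1 by blast
qed

section \<open>Tangent spaces of the resolution\<close>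

lemma one_in_points:
  assumes "ring_map \<iota>" and "mat 1 \<in> B"
  shows "mat 1 \<in> points \<iota> B"
proof -
  interpret \<iota>: ring_map \<iota> by fact
  have "poly_at \<iota> f (mat 1) = 0" if "f \<in> vanishing to_ac B" for f
  proof -
    have "to_ac (poly_at id f (mat 1)) = poly_at to_ac f (mat 1)"
      by (simp add: to_ac.poly_at_map to_ac.mm_one)
    also have "\<dots> = 0" using that assms(2) by (simp add: vanishing_def)
    finally have "\<iota> (poly_at id f (mat 1)) = 0" by (simp add: \<iota>.map_zero)
    then show ?thesis by (simp add: \<iota>.poly_at_map \<iota>.mm_one)
  qed
  then show ?thesis by (simp add: points_def)
qed

lemma mult_Ad_inv: "g \<in> carrier GL \<Longrightarrow> g ** Ad (ginv g) t = t ** g"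
  by (simp add: Ad_def matrix_mul_assoc[symmetric])

lemma coset_eq: "a <#\<^bsub>GL\<^esub> H = (**) a ` H"
  by (auto simp: l_coset_def)

lemma coset_absorb:
  assumes "subgroup H GL" "p \<in> H" "g \<in> carrier GL"
  shows "(g ** p) <#\<^bsub>GL\<^esub> H = g <#\<^bsub>GL\<^esub> H"
proof -
  have p: "p \<in> carrier GL" using subgroup.subset[OF assms(1)] assms(2) by blast
  have "(g ** p) ** q \<in> (**) g ` H" if "q \<in> H" for q
    using subgroup.m_closed[OF assms(1,2) that] by (auto simp: matrix_mul_assoc[symmetric])
  moreover have "g ** q \<in> (**) (g ** p) ` H" if "q \<in> H" for q
  proof (rule image_eqI)
    show "ginv p ** q \<in> H"
      using subgroup.m_closed[OF assms(1) subgroup.m_inv_closed[OF assms(1,2)] that] by simp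
    show "g ** q = g ** p ** (ginv p ** q)" using p by (simp add: matrix_mul_assoc[symmetric])
  qed
  ultimately show ?thesis unfolding coset_eq by blast
qed

lemma coset_mem_eqD:
  assumes "subgroup H GL" "g <#\<^bsub>GL\<^esub> H = h <#\<^bsub>GL\<^esub> H"
  obtains p where "p \<in> H" "g = h ** p"
proof -
  have "g \<in> g <#\<^bsub>GL\<^esub> H" unfolding coset_eq
    using subgroup.one_closed[OF assms(1)] by (intro image_eqI[of _ _ "mat 1"]) simp_all
  then have "g \<in> (**) h ` H" using assms(2) unfolding coset_eq by simp
  then show thesis using that by blast
qed

text \<open>On the source side only the unit is asked for, so the lemma covers the ring
  \<open>dual2\<close>, whose points of \<open>B\<close> are not computed.\<close>

lemma flag_map_coset:
  assumes \<phi>: "ring_map \<phi>" and \<kappa>: "\<And>c. \<phi> (\<iota> c) = \<kappa> c" and one: "mat 1 \<in> points \<iota> B"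
    and sub: "subgroup (points \<kappa> B) GL" and g: "g \<in> carrier GL"
  shows "flag_map \<kappa> B \<phi> (g <#\<^bsub>GL\<^esub> points \<iota> B) = map_matrix \<phi> g <#\<^bsub>GL\<^esub> points \<kappa> B"
proof -
  interpret \<phi>: ring_map \<phi> by fact
  have pts: "map_matrix \<phi> p \<in> points \<kappa> B" if "p \<in> points \<iota> B" for p
    using \<phi>.mm_points[OF that] by (simp add: \<kappa>)
  have flag: "flag_map \<kappa> B \<phi> (g <#\<^bsub>GL\<^esub> points \<iota> B)
      = {map_matrix \<phi> (g ** p) ** q | p q. p \<in> points \<iota> B \<and> q \<in> points \<kappa> B}"
    by (auto simp: flag_map_def coset_eq set_mult_def)
  show ?thesis unfolding flag
  proof (intro equalityI subsetI)
    fix y assume "y \<in> {map_matrix \<phi> (g ** p) ** q | p q. p \<in> points \<iota> B \<and> q \<in> points \<kappa> B}"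
    then obtain p q where "p \<in> points \<iota> B" "q \<in> points \<kappa> B" "y = map_matrix \<phi> (g ** p) ** q" by auto
    then show "y \<in> map_matrix \<phi> g <#\<^bsub>GL\<^esub> points \<kappa> B"
      unfolding coset_eq using subgroup.m_closed[OF sub pts]
      by (auto simp: \<phi>.mm_mult matrix_mul_assoc[symmetric])
  next
    fix y assume "y \<in> map_matrix \<phi> g <#\<^bsub>GL\<^esub> points \<kappa> B"
    then obtain q where q: "q \<in> points \<kappa> B" "y = map_matrix \<phi> g ** q" by (auto simp: coset_eq)
    have "y = map_matrix \<phi> (g ** mat 1) ** q" using q by simp
    then show "y \<in> {map_matrix \<phi> (g ** p) ** q | p q. p \<in> points \<iota> B \<and> q \<in> points \<kappa> B}"
      using one q by blast
  qed
qed

lemma lie_points_map: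
  fixes \<phi> :: "'r::comm_ring_1 \<Rightarrow> 's::comm_ring_1"
  assumes "ring_map \<phi>" and \<kappa>: "\<And>c. \<phi> (\<iota> c) = \<kappa> c" and x: "x \<in> lie_points \<iota> H"
  shows "map_matrix \<phi> x \<in> lie_points \<kappa> (H :: ('k::field alg_closure^'n::finite^'n) set)"
proof -
  interpret \<phi>: ring_map \<phi> by fact
  interpret m1: Modules.module "\<lambda>c. map_matrix ((*) c) :: 'r^'n^'n \<Rightarrow> _"
    by unfold_locales (simp_all add: vec_eq_iff algebra_simps)
  interpret m2: Modules.module "\<lambda>c. map_matrix ((*) c) :: 's^'n^'n \<Rightarrow> _"
    by unfold_locales (simp_all add: vec_eq_iff algebra_simps)
  have "x \<in> m1.span (map_matrix \<iota> ` lie H)" using x by (simp add: lie_points_def)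
  then have "map_matrix \<phi> x \<in> m2.span (map_matrix \<kappa> ` lie H)"
  proof (induction rule: m1.span_induct_alt)
    case base
    have "map_matrix \<phi> 0 = (0 :: 's^'n^'n)" by (simp add: vec_eq_iff \<phi>.map_zero)
    then show ?case by (simp add: m2.span_zero)
  next
    case (step c x y)
    then obtain A where A: "A \<in> lie H" "x = map_matrix \<iota> A" by auto
    have "map_matrix \<phi> (map_matrix ((*) c) x + y) = map_matrix ((*) (\<phi> c)) (map_matrix \<kappa> A) + map_matrix \<phi> y"
      by (simp add: A vec_eq_iff \<phi>.map_add \<phi>.map_mult \<kappa>)
    then show ?case using step.IH A by (simp add: m2.span_add m2.span_scale m2.span_base)
  qed
  then show ?thesis by (simp add: lie_points_def)
qed

lemma dual2_matrix_GL:
  fixes h M N :: "'k::field^'n::finite^'n"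
  assumes h: "h \<in> carrier GL"
  defines "z \<equiv> \<lambda>a b c. (\<chi> i j. Dual2 (a $ i $ j) (b $ i $ j) (c $ i $ j)) :: 'k dual2^'n^'n"
  shows "z h M N \<in> carrier GL"
    and "Ad (ginv (z h M N)) (z 0 A C) = z 0 (Ad (ginv h) A) (Ad (ginv h) C)"
proof -
  let ?i = "ginv h"
  have sum: "(\<Sum>i\<in>I. Dual2 (f i) (g i) (e i)) = Dual2 (\<Sum>i\<in>I. f i) (\<Sum>i\<in>I. g i) (\<Sum>i\<in>I. e i)"
    for I :: "'n set" and f g e :: "'n \<Rightarrow> 'k"
    by (induction I rule: infinite_finite_induct) (simp_all add: zero_dual2_def)
  have mult: "z a b c ** z a' b' c' = z (a ** a') (a ** b' + b ** a') (a ** c' + c ** a')" for a b c a' b' c'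
    by (simp add: z_def matrix_matrix_mult_def vec_eq_iff sum sum.distrib)
  have one: "mat 1 = z (mat 1) 0 0"
    by (simp add: z_def mat_def vec_eq_iff one_dual2_def zero_dual2_def)
  have neg: "c ** (- d) = - (c ** d)" "(- d) ** c = - (d ** c)" for c d :: "'k^'n^'n"
    by (simp_all add: matrix_matrix_mult_def vec_eq_iff sum_negf)
  let ?j = "z ?i (- (?i ** M ** ?i)) (- (?i ** N ** ?i))"
  have 1: "z h M N ** ?j = mat 1" "?j ** z h M N = mat 1"
    using h by (simp_all add: mult one neg matrix_mul_assoc[symmetric])
  then show "z h M N \<in> carrier GL" by (rule GL_memI)
  have "ginv (z h M N) = ?j" using 1 by (rule GL_inv_eqI)
  then show "Ad (ginv (z h M N)) (z 0 A C) = z 0 (Ad ?i A) (Ad ?i C)"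
    using h GL_inv_eqI[OF 1(2,1)] by (simp add: Ad_def mult)
qed

section \<open>Tangent spaces for a Borel subgroup in triangular form over \<open>k\<close>\<close>

locale rational_borel =
  fixes B :: "('k::field alg_closure^'n::finite^'n) set" and g0 :: "'k^'n^'n" and r :: "'n \<Rightarrow> nat"
  assumes r: "bij_betw r UNIV {..<CARD('n)}" and g0: "g0 \<in> carrier GL"
    and B: "B = triangular_group (map_matrix to_ac g0) r"
begin

lemma inj_r: "inj r"
  using r by (simp add: bij_betw_def)

lemma points_id: "points id B = {x \<in> carrier GL. Ad (ginv g0) x \<in> upper r}"
  unfolding B by (rule points_id_triangular_group[OF g0])

lemma points_dual: "points dual_of B = {x \<in> carrier GL. Ad (ginv (dual_matrix g0 0)) x \<in> upper r}"
  unfolding B by (rule points_dual_triangular_group[OF g0])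

lemma lie_B: "lie B = {A. Ad (ginv g0) A \<in> upper r}"
  unfolding B by (rule lie_triangular_group[OF g0])

lemma subgroup_points_id: "subgroup (points id B) GL"
  unfolding points_id by (rule subgroup_upper[OF inj_r g0])

lemma subgroup_points_dual: "subgroup (points dual_of B) GL"
  unfolding points_dual by (rule subgroup_upper[OF inj_r]) (simp add: dual_matrix_GL_iff g0)

lemma one_in_B: "mat 1 \<in> B"
  unfolding B triangular_group_def using to_ac.mm_GL[OF g0] by (simp add: Ad_mat_one)

lemma lie_points_dual_B: "dual_matrix A C \<in> lie_points dual_of B \<longleftrightarrow> A \<in> lie B \<and> C \<in> lie B"
proof -
  have "lie_points dual_of B = {dual_matrix A C | A C. A \<in> lie B \<and> C \<in> lie B}"
    by (rule lie_points_dual) (auto simp: lie_B Ad_add Ad_scale upper_add upper_scale)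
  then show ?thesis by (auto simp: dual_matrix_eq_iff)
qed

lemma Ad_points_lie:
  assumes p: "p \<in> points id B"
  shows "Ad p A \<in> lie B \<longleftrightarrow> A \<in> lie B"
proof -
  have *: "Ad p A \<in> lie B" if p: "p \<in> points id B" and A: "A \<in> lie B" for p A
  proof -
    have gi: "ginv g0 \<in> carrier GL" using g0 by simp
    have "ginv p \<in> points id B" by (rule subgroup.m_inv_closed[OF subgroup_points_id p])
    then show ?thesis
      using p A unfolding points_id lie_B Ad_def[of p] by (simp add: Ad_mult_matrix[OF gi] upper_mult)
  qed
  have "ginv p \<in> points id B" by (rule subgroup.m_inv_closed[OF subgroup_points_id p])
  moreover have "p \<in> carrier GL" using p by (simp add: points_def)
  ultimately show ?thesis using *[OF p, of A] *[of "ginv p" "Ad p A"] by auto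
qed

text \<open>The tangent vector at \<open>(0, hB)\<close> with direction \<open>A\<close> in the Lie
  algebra and \<open>Z\<close> along the flag variety. \<open>Z\<close> is a representative:
  different choices can give the same coset.\<close>

abbreviation vector :: "'k^'n^'n \<Rightarrow> 'k^'n^'n \<Rightarrow> 'k^'n^'n \<Rightarrow> ('k dual^'n^'n) \<times> ('k dual^'n^'n) set" where
  "vector h A Z \<equiv> (dual_matrix 0 A, dual_matrix h Z <#\<^bsub>GL\<^esub> points dual_of B)"

lemma flag_map_std: "g \<in> carrier GL \<Longrightarrow> flag_map id B std (g <#\<^bsub>GL\<^esub> points dual_of B) = map_matrix std g <#\<^bsub>GL\<^esub> points id B"
  by (rule flag_map_coset[OF ring_map_std _ one_in_points[OF ring_map_dual_of one_in_B] subgroup_points_id])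
     (simp_all add: dual_of_def)

lemma flag_map_dual_of: "g \<in> carrier GL \<Longrightarrow> flag_map dual_of B dual_of (g <#\<^bsub>GL\<^esub> points id B) = map_matrix dual_of g <#\<^bsub>GL\<^esub> points dual_of B"
  by (rule flag_map_coset[OF ring_map_dual_of _ one_in_points[OF ring_map_id one_in_B] subgroup_points_dual])
     simp_all

lemma flag_map_comb: "g \<in> carrier GL \<Longrightarrow> flag_map dual_of B (comb a b) (g <#\<^bsub>GL\<^esub> points dual2_of B) = map_matrix (comb a b) g <#\<^bsub>GL\<^esub> points dual_of B"
  by (rule flag_map_coset[OF ring_map_comb _ one_in_points[OF ring_map_dual2_of one_in_B] subgroup_points_dual])
     (simp_all add: dual_of_def dual2_of_def)

lemma zero_lie: "0 \<in> lie B"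
  by (simp add: lie_B)

lemma tangent_gtilde_iff:
  assumes h: "h \<in> carrier GL"
  shows "tangent_gtilde B (0, h <#\<^bsub>GL\<^esub> points id B) = {vector h A Z | A Z. Ad (ginv h) A \<in> lie B}"
proof (intro equalityI subsetI)
  fix v assume "v \<in> {vector h A Z | A Z. Ad (ginv h) A \<in> lie B}"
  then obtain A Z where v: "v = vector h A Z" and A: "Ad (ginv h) A \<in> lie B" by auto
  have G: "dual_matrix h Z \<in> carrier GL" using h by (simp add: dual_matrix_GL_iff)
  have "v \<in> gtilde dual_of B"
    unfolding v gtilde_def using G A
    by (auto simp: Ad_inv_dual_eps[OF h] lie_points_dual_B zero_lie intro!: exI[of _ "dual_matrix h Z"])
  moreover have "gtilde_map id B std v = (0, h <#\<^bsub>GL\<^esub> points id B)"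
    by (simp add: v gtilde_map_def flag_map_std[OF G])
  ultimately show "v \<in> tangent_gtilde B (0, h <#\<^bsub>GL\<^esub> points id B)" by (simp add: tangent_gtilde_def)
next
  fix v assume "v \<in> tangent_gtilde B (0, h <#\<^bsub>GL\<^esub> points id B)"
  then obtain M g where v: "v = (M, g <#\<^bsub>GL\<^esub> points dual_of B)" and g: "g \<in> carrier GL"
    and M: "Ad (ginv g) M \<in> lie_points dual_of B"
    and map: "gtilde_map id B std v = (0, h <#\<^bsub>GL\<^esub> points id B)"
    by (auto simp: tangent_gtilde_def gtilde_def)
  obtain M0 A where M0: "M = dual_matrix M0 A" by (rule dual_matrix_cases)
  obtain a Y where a: "g = dual_matrix a Y" by (rule dual_matrix_cases)
  have aG: "a \<in> carrier GL" using g by (simp add: a dual_matrix_GL_iff)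
  have "M0 = 0" and coset: "a <#\<^bsub>GL\<^esub> points id B = h <#\<^bsub>GL\<^esub> points id B"
    using map flag_map_std[OF g] by (simp_all add: v gtilde_map_def M0 a)
  obtain p where p: "p \<in> points id B" "a = h ** p" by (rule coset_mem_eqD[OF subgroup_points_id coset])
  have pG: "p \<in> carrier GL" using p by (simp add: points_def)
  have pd: "dual_matrix p 0 \<in> points dual_of B"
    using dual_of.mm_points[OF p(1)] by simp
  \<comment> \<open>\<open>g\<close> reduces to \<open>h ** p\<close>; multiplying on the right by
    the inverse of the constant matrix \<open>p\<close> normalizes the reduction to
    \<open>h\<close>.\<close>
  define Z where "Z = Y ** ginv p"
  have G: "dual_matrix h Z \<in> carrier GL" using h by (simp add: dual_matrix_GL_iff)
  have "g = dual_matrix h Z ** dual_matrix p 0"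
    using pG by (simp add: a p(2) dual_matrix_mult Z_def matrix_mul_assoc[symmetric])
  then have "g <#\<^bsub>GL\<^esub> points dual_of B = dual_matrix h Z <#\<^bsub>GL\<^esub> points dual_of B"
    using coset_absorb[OF subgroup_points_dual pd G] by simp
  moreover have "Ad (ginv h) A \<in> lie B"
  proof -
    have "Ad (ginv a) A \<in> lie B"
      using M by (simp add: a M0 \<open>M0 = 0\<close> Ad_inv_dual_eps[OF aG] lie_points_dual_B)
    moreover have "Ad (ginv a) A = Ad (ginv p) (Ad (ginv h) A)"
      using h pG by (simp add: p(2) GL_inv_mult Ad_mult)
    ultimately show ?thesis
      using Ad_points_lie[OF subgroup.m_inv_closed[OF subgroup_points_id p(1)]] by simp
  qed
  ultimately show "v \<in> {vector h A Z | A Z. Ad (ginv h) A \<in> lie B}"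
    using v M0 \<open>M0 = 0\<close> by blast
qed

text \<open>This gives the upper bound for the sum: the hull is contained in every subspace that
  contains the images.\<close>

lemma tangent_subspace_tangent_gtilde:
  assumes h: "h \<in> carrier GL"
  defines "x \<equiv> (0, h <#\<^bsub>GL\<^esub> points id B)"
  shows "tangent_subspace B x (tangent_gtilde B x)"
  unfolding tangent_subspace_def
proof (intro conjI ballI impI allI)
  show "tangent_gtilde B x \<subseteq> tangent_gtilde B x" ..
  have "gtilde_map dual_of B dual_of x = vector h 0 0"
    by (simp add: x_def gtilde_map_def flag_map_dual_of[OF h])
  then show "gtilde_map dual_of B dual_of x \<in> tangent_gtilde B x"
    unfolding x_def tangent_gtilde_iff[OF h] using zero_lie by force
next
  fix z a b assume z: "z \<in> gtilde dual2_of B"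
    and W: "gtilde_map dual_of B (comb 1 0) z \<in> tangent_gtilde B x \<and>
      gtilde_map dual_of B (comb 0 1) z \<in> tangent_gtilde B x"
  from z obtain M g where zM: "z = (M, g <#\<^bsub>GL\<^esub> points dual2_of B)" and g: "g \<in> carrier GL"
    and M: "Ad (ginv g) M \<in> lie_points dual2_of B" by (auto simp: gtilde_def)
  have map: "gtilde_map dual_of B (comb a b) z = (map_matrix (comb a b) M, map_matrix (comb a b) g <#\<^bsub>GL\<^esub> points dual_of B)" for a b
    by (simp add: zM gtilde_map_def flag_map_comb[OF g])
  have G: "map_matrix (comb a b) g \<in> carrier GL" for a b by (rule comb.mm_GL[OF g])
  have "map_matrix (comb a b) (Ad (ginv g) M) \<in> lie_points dual_of B"
    by (rule lie_points_map[OF ring_map_comb _ M]) (simp add: dual2_of_def dual_of_def)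
  then have "gtilde_map dual_of B (comb a b) z \<in> gtilde dual_of B"
    unfolding map gtilde_def using G[of a b] g
    by (auto simp: comb.mm_Ad comb.mm_inv intro!: exI[of _ "map_matrix (comb a b) g"])
  moreover have "gtilde_map id B std (gtilde_map dual_of B (comb a b) z)
      = gtilde_map id B std (gtilde_map dual_of B (comb 1 0) z)"
  proof -
    \<comment> \<open>All \<open>comb a b\<close> have the same reduction, so every combination
      stays over the same point.\<close>
    have "std (comb a b y) = std (comb 1 0 y)" for y :: "'k dual2" by (cases y) simp
    then have "map_matrix std (map_matrix (comb a b) N) = map_matrix std (map_matrix (comb 1 0) N)"
      for N :: "'k dual2^'n^'n" by (simp add: vec_eq_iff)
    then show ?thesis unfolding map by (simp add: gtilde_map_def flag_map_std[OF G])
  qed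
  ultimately show "gtilde_map dual_of B (comb a b) z \<in> tangent_gtilde B x"
    using W by (simp add: tangent_gtilde_def)
qed

text \<open>The pair of vectors is represented by the point with Lie algebra part
  \<open>\<epsilon>1 A + \<epsilon>2 C\<close> and flag part \<open>h + \<epsilon>1 Z\<close>, and
  \<open>comb 1 1\<close> adds them. As the second vector has no flag direction, \<open>Z\<close> is
  unchanged.\<close>

lemma tangent_subspace_add:
  assumes h: "h \<in> carrier GL" and W: "tangent_subspace B (0, h <#\<^bsub>GL\<^esub> points id B) W"
    and 1: "vector h A Z \<in> W" and 2: "vector h C 0 \<in> W"
  shows "vector h (A + C) Z \<in> W"
proof -
  have lie: "Ad (ginv h) D \<in> lie B" if "vector h D Y \<in> W" for D Y
  proof -
    have "vector h D Y \<in> {vector h A Z | A Z. Ad (ginv h) A \<in> lie B}"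
      using W that unfolding tangent_subspace_def tangent_gtilde_iff[OF h] by blast
    then show ?thesis by (auto simp: dual_matrix_eq_iff)
  qed
  define d2 where "d2 a b c = (\<chi> i j. Dual2 (a $ i $ j) (b $ i $ j) (c $ i $ j))" for a b c :: "'k^'n^'n"
  note d2_GL = dual2_matrix_GL[OF h, folded d2_def]
  have G: "d2 h Z 0 \<in> carrier GL" by (rule d2_GL)
  interpret m: Modules.module "\<lambda>c. map_matrix ((*) c) :: 'k dual2^'n^'n \<Rightarrow> _"
    by unfold_locales (simp_all add: vec_eq_iff algebra_simps)
  let ?A = "Ad (ginv h) A" and ?C = "Ad (ginv h) C"
  have "d2 0 ?A ?C = map_matrix ((*) (Dual2 0 1 0)) (map_matrix dual2_of ?A)
      + map_matrix ((*) (Dual2 0 0 1)) (map_matrix dual2_of ?C)"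
    by (simp add: d2_def vec_eq_iff dual2_of_def)
  also have "\<dots> \<in> m.span (map_matrix dual2_of ` lie B)"
    using lie[OF 1] lie[OF 2] by (intro m.span_add m.span_scale m.span_base) auto
  finally have "Ad (ginv (d2 h Z 0)) (d2 0 A C) \<in> lie_points dual2_of B"
    by (simp add: d2_GL(2) lie_points_def)
  then have z: "(d2 0 A C, d2 h Z 0 <#\<^bsub>GL\<^esub> points dual2_of B) \<in> gtilde dual2_of B" (is "?z \<in> _")
    using G by (auto simp: gtilde_def)
  have comb: "map_matrix (comb s t) (d2 a b c) = dual_matrix a (map_matrix ((*) s) b + map_matrix ((*) t) c)" for s t a b c
    by (simp add: d2_def dual_matrix_def vec_eq_iff)
  have one: "map_matrix ((*) 1) D = D" and zero: "map_matrix ((*) 0) D = 0" "map_matrix ((*) s) 0 = 0"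
    for D :: "'k^'n^'n" and s :: 'k by (simp_all add: vec_eq_iff)
  have map: "gtilde_map dual_of B (comb s t) ?z = vector h (map_matrix ((*) s) A + map_matrix ((*) t) C) (map_matrix ((*) s) Z)" for s t
    by (simp add: gtilde_map_def flag_map_comb[OF G] comb zero)
  have "gtilde_map dual_of B (comb 1 0) ?z \<in> W" "gtilde_map dual_of B (comb 0 1) ?z \<in> W"
    using 1 2 unfolding map by (simp_all add: one zero)
  then have "gtilde_map dual_of B (comb 1 1) ?z \<in> W" using W z unfolding tangent_subspace_def by blast
  then show ?thesis unfolding map by (simp add: one)
qed

text \<open>The lift keeps the first flag constant, at the coset of \<open>dual_matrix g 0\<close>,
  while the second moves along \<open>Z\<close>.\<close>

lemma vector_in_image:
  assumes h: "h \<in> carrier GL" and g: "g \<in> carrier GL"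
    and A: "Ad (ginv h) A \<in> lie B" "Ad (ginv g) A \<in> lie B"
  shows "vector h A Z \<in> pi2 ` tangent_steinberg B (g <#\<^bsub>GL\<^esub> points id B, 0, h <#\<^bsub>GL\<^esub> points id B)"
proof -
  let ?C = "dual_matrix g 0 <#\<^bsub>GL\<^esub> points dual_of B" and ?D = "dual_matrix h Z <#\<^bsub>GL\<^esub> points dual_of B"
  have "(dual_matrix 0 A, ?C) \<in> tangent_gtilde B (0, g <#\<^bsub>GL\<^esub> points id B)"
    unfolding tangent_gtilde_iff[OF g] using A(2) by blast
  moreover have "(dual_matrix 0 A, ?D) \<in> tangent_gtilde B (0, h <#\<^bsub>GL\<^esub> points id B)"
    unfolding tangent_gtilde_iff[OF h] using A(1) by blast
  ultimately have "(?C, dual_matrix 0 A, ?D) \<in> tangent_steinberg B (g <#\<^bsub>GL\<^esub> points id B, 0, h <#\<^bsub>GL\<^esub> points id B)"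
    by (simp add: tangent_gtilde_def tangent_steinberg_def steinberg_def steinberg_map_def gtilde_map_def)
  then show ?thesis by (rule image_eqI[rotated]) (simp add: pi2_def)
qed

end

section \<open>Permutation matrices and coordinate flags\<close>

definition perm_matrix :: "('n::finite \<Rightarrow> 'n) \<Rightarrow> 'r::comm_ring_1^'n^'n" where
  "perm_matrix \<sigma> = (\<chi> i k. if k = \<sigma> i then 1 else 0)"

lemma perm_matrix_mult: "(A ** perm_matrix \<sigma>) $ i $ \<sigma> j = A $ i $ j" if "bij \<sigma>"
proof -
  have "(A ** perm_matrix \<sigma>) $ i $ \<sigma> j = (\<Sum>k\<in>{j}. A $ i $ k * perm_matrix \<sigma> $ k $ \<sigma> j)"
    unfolding matrix_matrix_mult_def
    by (simp only: vec_lambda_beta, rule sum.mono_neutral_right)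
      (use that in \<open>auto simp: perm_matrix_def bij_def inj_def\<close>)
  then show ?thesis by (simp add: perm_matrix_def)
qed

lemma transpose_perm_matrix_mult: "(transpose (perm_matrix \<sigma>) ** A) $ \<sigma> i $ j = A $ i $ j" if "bij \<sigma>"
proof -
  have "(transpose (perm_matrix \<sigma>) ** A) $ \<sigma> i $ j = (\<Sum>k\<in>{i}. perm_matrix \<sigma> $ k $ \<sigma> i * A $ k $ j)"
    unfolding matrix_matrix_mult_def transpose_def
    by (simp only: vec_lambda_beta, rule sum.mono_neutral_right)
      (use that in \<open>auto simp: perm_matrix_def bij_def inj_def\<close>)
  then show ?thesis by (simp add: perm_matrix_def)
qed

lemma perm_matrix_GL:
  fixes \<sigma> :: "'n::finite \<Rightarrow> 'n"
  assumes \<sigma>: "bij \<sigma>"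
  shows "(perm_matrix \<sigma> :: 'r::field^'n^'n) \<in> carrier GL"
    and "ginv (perm_matrix \<sigma>) = (transpose (perm_matrix \<sigma>) :: 'r::field^'n^'n)"
proof -
  let ?P = "perm_matrix \<sigma> :: 'r^'n^'n"
  have "(transpose ?P ** ?P) $ k $ l = mat 1 $ k $ l" for k l
  proof -
    obtain i j where "k = \<sigma> i" "l = \<sigma> j" using \<sigma> by (metis bij_pointE)
    then show ?thesis using transpose_perm_matrix_mult[OF \<sigma>, of ?P i l] \<sigma>
      by (auto simp: perm_matrix_def mat_def bij_def inj_eq)
  qed
  then have 1: "transpose ?P ** ?P = mat 1" by (simp add: vec_eq_iff)
  then have 2: "?P ** transpose ?P = mat 1" by (simp add: matrix_left_right_inverse)
  show "?P \<in> carrier GL" using 2 1 by (rule GL_memI)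
  show "ginv ?P = transpose ?P" using 2 1 by (rule GL_inv_eqI)
qed

lemma Ad_perm_matrix:
  fixes A :: "'r::field^'n::finite^'n"
  assumes \<sigma>: "bij \<sigma>"
  shows "Ad (ginv (perm_matrix \<sigma>)) A $ \<sigma> i $ \<sigma> j = A $ i $ j"
proof -
  have "Ad (ginv (perm_matrix \<sigma>)) A = ginv (perm_matrix \<sigma>) ** A ** perm_matrix \<sigma>"
    unfolding Ad_def GL.inv_inv[OF perm_matrix_GL(1)[OF \<sigma>]] ..
  then have "Ad (ginv (perm_matrix \<sigma>)) A = transpose (perm_matrix \<sigma>) ** A ** perm_matrix \<sigma>"
    by (simp only: perm_matrix_GL(2)[OF \<sigma>])
  then show ?thesis by (simp only: perm_matrix_mult[OF \<sigma>] transpose_perm_matrix_mult[OF \<sigma>])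
qed

text \<open>Relabelling the indices by \<open>\<sigma>\<close> turns the coordinate flag ordered by
  \<open>r \<circ> \<sigma>\<close> into the one ordered by \<open>r\<close>.\<close>

lemma Ad_perm_matrix_upper:
  fixes A :: "'r::field^'n::finite^'n"
  assumes \<sigma>: "bij \<sigma>" and A: "A \<in> upper (r \<circ> \<sigma>)"
  shows "Ad (ginv (perm_matrix \<sigma>)) A \<in> upper r"
  unfolding upper_def
proof (intro CollectI allI impI)
  fix k l assume kl: "r l < r k"
  obtain i j where "k = \<sigma> i" "l = \<sigma> j" using \<sigma> by (metis bij_pointE)
  then show "Ad (ginv (perm_matrix \<sigma>)) A $ k $ l = 0"
    using A kl by (simp add: Ad_perm_matrix[OF \<sigma>] upper_def)
qed

lemma exists_reordering:
  fixes r s :: "'n::finite \<Rightarrow> nat"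
  assumes r: "bij_betw r UNIV {..<CARD('n)}" and s: "bij_betw s UNIV {..<CARD('n)}"
  obtains \<sigma> where "bij \<sigma>" "r \<circ> \<sigma> = s"
proof
  have "bij_betw (the_inv_into UNIV r) {..<CARD('n)} UNIV" using r by (rule bij_betw_the_inv_into)
  then show "bij (the_inv_into UNIV r \<circ> s)" by (rule bij_betw_trans[OF s])
  show "r \<circ> (the_inv_into UNIV r \<circ> s) = s"
    using r s by (auto simp: bij_betw_def fun_eq_iff intro!: f_the_inv_into_f)
qed

text \<open>An abstract \<open>I\<close> serves both notions of fixed point. As \<open>B\<close> is
  the triangular group conjugated by \<open>g0\<close>, the factor \<open>ginv g0\<close> makes the
  stabilizer of the coset the triangular group conjugated by
  \<open>g1 ** perm_matrix \<sigma>\<close>.\<close>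

lemma (in rational_borel) tangent_sum_eq:
  assumes h: "h \<in> carrier GL" and g1: "g1 \<in> carrier GL"
    and I: "\<And>\<sigma>. bij \<sigma> \<Longrightarrow> (g1 ** perm_matrix \<sigma> ** ginv g0) <#\<^bsub>GL\<^esub> points id B \<in> I"
  defines "hB \<equiv> h <#\<^bsub>GL\<^esub> points id B"
  shows "tangent_sum B (0, hB) (\<lambda>gB. pi2 ` tangent_steinberg B (gB, 0, hB)) I = tangent_gtilde B (0, hB)"
proof (rule equalityI)
  have "(\<Union>gB\<in>I. pi2 ` tangent_steinberg B (gB, 0, hB)) \<subseteq> tangent_gtilde B (0, hB)"
    by (auto simp: tangent_steinberg_def steinberg_def steinberg_map_def tangent_gtilde_def gtilde_map_def pi2_def)
  then show "tangent_sum B (0, hB) (\<lambda>gB. pi2 ` tangent_steinberg B (gB, 0, hB)) I \<subseteq> tangent_gtilde B (0, hB)"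
    unfolding tangent_sum_def hB_def
    by (rule hull_minimal) (rule tangent_subspace_tangent_gtilde[OF h])
next
  show "tangent_gtilde B (0, hB) \<subseteq> tangent_sum B (0, hB) (\<lambda>gB. pi2 ` tangent_steinberg B (gB, 0, hB)) I"
    unfolding tangent_sum_def hull_def
  proof (intro subsetI InterI)
    fix v W assume v: "v \<in> tangent_gtilde B (0, hB)"
      and "W \<in> {t. tangent_subspace B (0, hB) t \<and> (\<Union>gB\<in>I. pi2 ` tangent_steinberg B (gB, 0, hB)) \<subseteq> t}"
    then have W: "tangent_subspace B (0, h <#\<^bsub>GL\<^esub> points id B) W"
      and sub: "(\<Union>gB\<in>I. pi2 ` tangent_steinberg B (gB, 0, hB)) \<subseteq> W" by (auto simp: hB_def)
    obtain A Z where vA: "v = vector h A Z" and A: "Ad (ginv h) A \<in> lie B"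
      using v unfolding hB_def tangent_gtilde_iff[OF h] by auto
    \<comment> \<open>The columns of this matrix span the flag of \<open>hB\<close>, written in the
      basis of the columns of \<open>g1\<close>.\<close>
    let ?h = "ginv g1 ** h ** g0"
    have hG: "?h \<in> carrier GL" using h g1 g0 by simp
    have Ad_h: "Ad (ginv ?h) C = Ad (ginv g0) (Ad (ginv h) (Ad g1 C))" for C
      using h g1 g0 by (simp add: GL_inv_mult Ad_mult)
    \<comment> \<open>All \<open>Z\<close> are included because an addition takes one summand with
      the given \<open>Z\<close> and the other with \<open>Z = 0\<close>.\<close>
    have "\<forall>Z. vector h (Ad g1 (Ad (ginv g1) A)) Z \<in> W"
    proof (rule upper_conjugate_induct[OF hG r, where P="\<lambda>C. \<forall>Z. vector h (Ad g1 C) Z \<in> W"])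
      show "Ad (ginv ?h) (Ad (ginv g1) A) \<in> upper r"
        unfolding Ad_h using A g1 by (simp add: lie_B)
    next
      fix C C' assume "\<forall>Z. vector h (Ad g1 C) Z \<in> W" "\<forall>Z. vector h (Ad g1 C') Z \<in> W"
      then show "\<forall>Z. vector h (Ad g1 (C + C')) Z \<in> W"
        unfolding Ad_add using tangent_subspace_add[OF h W] by blast
    next
      fix C s assume s: "bij_betw s UNIV {..<CARD('n)}" and C: "C \<in> upper s" "Ad (ginv ?h) C \<in> upper r"
      obtain \<sigma> where "bij \<sigma>" "r \<circ> \<sigma> = s" by (rule exists_reordering[OF r s])
      then have \<sigma>: "bij \<sigma>" "Ad (ginv (perm_matrix \<sigma>)) C \<in> upper r"
        using Ad_perm_matrix_upper C(1) by auto
      let ?P = "perm_matrix \<sigma> :: 'k^'n^'n"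
      let ?g = "g1 ** ?P ** ginv g0"
      note P = perm_matrix_GL(1)[OF \<sigma>(1), where 'r='k]
      have gG: "?g \<in> carrier GL" using g1 P g0 by simp
      have Ph: "Ad (ginv h) (Ad g1 C) \<in> lie B" using C(2) by (simp add: Ad_h lie_B)
      have "Ad (ginv ?g) (Ad g1 C) = Ad g0 (Ad (ginv ?P) C)"
        using g1 P g0 by (simp add: GL_inv_mult Ad_mult)
      then have "Ad (ginv ?g) (Ad g1 C) \<in> lie B" using \<sigma>(2) g0 by (simp add: lie_B)
      then have "vector h (Ad g1 C) Z \<in> pi2 ` tangent_steinberg B (?g <#\<^bsub>GL\<^esub> points id B, 0, hB)" for Z
        unfolding hB_def by (intro vector_in_image[OF h gG Ph])
      then show "\<forall>Z. vector h (Ad g1 C) Z \<in> W" using sub I[OF \<sigma>(1)] by blast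
    qed
    then show "v \<in> W" using g1 by (simp add: vA)
  qed
qed

theorem theorem2p6:
  fixes B T :: "('k::field alg_closure^'n::finite^'n) set"
    and hB :: "('k^'n^'n) set"
  assumes "borel_subgroup B"
    and "maximal_split_torus T"
    and "hB \<in> flag_points id B"
  shows "tangent_sum B (0, hB) (\<lambda>gB. pi2 ` tangent_steinberg B (gB, 0, hB))
           (fixed_by_rational_points B T) = tangent_gtilde B (0, hB) \<and>
         tangent_sum B (0, hB) (\<lambda>gB. pi2 ` tangent_steinberg B (gB, 0, hB))
           (fixed_by_torus B T) = tangent_gtilde B (0, hB)"
proof -
  \<comment> \<open>A constant map imposes no condition: this is an arbitrary enumeration of the
    indices.\<close>
  obtain r :: "'n \<Rightarrow> nat" where r: "bij_betw r UNIV {..<CARD('n)}"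
    using exists_order_refining[of "\<lambda>_. 0"] by metis
  obtain g0 :: "'k^'n^'n" where g0: "g0 \<in> carrier GL" and B: "B = triangular_group (map_matrix to_ac g0) r"
    using borel_subgroup_over_base[OF assms(1) r] .
  interpret rational_borel B g0 r by unfold_locales (fact r g0 B)+
  have T: "split_torus T" using assms(2) by (simp add: maximal_split_torus_def)
  obtain g1 :: "'k^'n^'n" where g1: "g1 \<in> carrier GL"
    and diag: "\<And>t i j. t \<in> T \<Longrightarrow> i \<noteq> j \<Longrightarrow> Ad (ginv (map_matrix to_ac g1)) t $ i $ j = 0"
    by (rule split_torus_diagonalizable[OF T], rule that)
  obtain h where h: "h \<in> carrier GL" and hB: "hB = h <#\<^bsub>GL\<^esub> points id B"
    using assms(3) by (auto simp: flag_points_def LCOSETS_def)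
  have TG: "T \<subseteq> carrier GL"
    using T by (auto simp: split_torus_def k_subgroup_def dest: subgroup.subset)
  \<comment> \<open>Over any field, since it serves both for \<open>T\<close> over the closure and
    for the points of \<open>T\<close> over \<open>k\<close>.\<close>
  have perm_diag: "Ad (ginv (perm_matrix \<sigma>)) A \<in> upper r"
    if \<sigma>: "bij \<sigma>" and A: "\<And>i j. i \<noteq> j \<Longrightarrow> A $ i $ j = 0" for \<sigma> and A :: "'f::field^'n^'n"
    by (rule Ad_perm_matrix_upper[OF \<sigma>]) (auto simp: upper_def intro!: A)
  have Ad_g: "Ad (ginv e0) (Ad (ginv (e1 ** p ** ginv e0)) t) = Ad (ginv p) (Ad (ginv e1) t)"
    if "e0 \<in> carrier GL" "e1 \<in> carrier GL" "p \<in> carrier GL" for e0 e1 p t :: "'f::field^'n^'n"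
    using that by (simp add: GL_inv_mult Ad_mult)
  have torus: "(g1 ** perm_matrix \<sigma> ** ginv g0) <#\<^bsub>GL\<^esub> points id B \<in> fixed_by_torus B T"
    if \<sigma>: "bij \<sigma>" for \<sigma> :: "'n \<Rightarrow> 'n"
  proof -
    let ?g = "g1 ** perm_matrix \<sigma> ** ginv g0"
    have gG: "?g \<in> carrier GL" using g1 g0 perm_matrix_GL(1)[OF \<sigma>, where 'r='k] by simp
    have P: "map_matrix to_ac (perm_matrix \<sigma>) = perm_matrix \<sigma>"
      by (simp add: vec_eq_iff perm_matrix_def)
    have g: "map_matrix to_ac ?g = map_matrix to_ac g1 ** perm_matrix \<sigma> ** ginv (map_matrix to_ac g0)"
      by (simp add: to_ac.mm_mult to_ac.mm_inv g0 P)
    have "t \<in> Ad (map_matrix to_ac ?g) ` B" if t: "t \<in> T" for t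
    proof (rule image_eqI)
      let ?t = "Ad (ginv (map_matrix to_ac ?g)) t"
      show "t = Ad (map_matrix to_ac ?g) ?t" using to_ac.mm_GL[OF gG] by simp
      have "Ad (ginv (map_matrix to_ac g0)) ?t \<in> upper r"
        unfolding g Ad_g[OF to_ac.mm_GL[OF g0] to_ac.mm_GL[OF g1] perm_matrix_GL(1)[OF \<sigma>]]
        by (rule perm_diag[OF \<sigma> diag[OF t]])
      moreover have "?t \<in> carrier GL" using to_ac.mm_GL[OF gG] TG t by (auto simp: Ad_GL_iff)
      ultimately show "?t \<in> B" by (simp add: B triangular_group_def)
    qed
    then show ?thesis using gG by (auto simp: fixed_by_torus_def)
  qed
  have rational: "(g1 ** perm_matrix \<sigma> ** ginv g0) <#\<^bsub>GL\<^esub> points id B \<in> fixed_by_rational_points B T"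
    if \<sigma>: "bij \<sigma>" for \<sigma> :: "'n \<Rightarrow> 'n"
  proof -
    let ?g = "g1 ** perm_matrix \<sigma> ** ginv g0"
    note PG = perm_matrix_GL(1)[OF \<sigma>, where 'r='k]
    have gG: "?g \<in> carrier GL" using g1 g0 PG by simp
    have "t <#\<^bsub>GL\<^esub> (?g <#\<^bsub>GL\<^esub> points id B) = ?g <#\<^bsub>GL\<^esub> points id B" if t: "t \<in> points id T" for t
    proof -
      have tG: "t \<in> carrier GL" using t by (simp add: points_def)
      have id_g1: "map_matrix id g1 = g1" by (simp add: vec_eq_iff)
      \<comment> \<open>The off-diagonal entries are linear forms over \<open>k\<close> that vanish
        on \<open>T\<close>, hence on \<open>points id T\<close>.\<close>
      have "Ad (ginv g1) t $ i $ j = 0" if "i \<noteq> j" for i j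
      proof -
        let ?c = "\<chi> b a. (ginv g1) $ i $ a * g1 $ b $ j"
        have "trace_poly ?c \<in> vanishing to_ac T"
          using diag[OF _ that] by (simp add: vanishing_def to_ac.poly_at_trace_poly to_ac.trace_Ad_entry[OF g1])
        then have "poly_at id (trace_poly ?c) t = 0" using t by (simp add: points_def)
        then show ?thesis by (simp add: id.poly_at_trace_poly id.trace_Ad_entry[OF g1] id_g1)
      qed
      then have "Ad (ginv g0) (Ad (ginv ?g) t) \<in> upper r"
        unfolding Ad_g[OF g0 g1 PG] by (rule perm_diag[OF \<sigma>])
      then have p: "Ad (ginv ?g) t \<in> points id B" using tG gG by (simp add: points_id Ad_GL_iff)
      have "t <#\<^bsub>GL\<^esub> (?g <#\<^bsub>GL\<^esub> points id B) = (t ** ?g) <#\<^bsub>GL\<^esub> points id B"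
        by (simp add: coset_eq image_image matrix_mul_assoc)
      also have "t ** ?g = ?g ** Ad (ginv ?g) t"
        by (rule mult_Ad_inv[OF gG, symmetric])
      also have "(?g ** Ad (ginv ?g) t) <#\<^bsub>GL\<^esub> points id B = ?g <#\<^bsub>GL\<^esub> points id B"
        by (rule coset_absorb[OF subgroup_points_id p gG])
      finally show ?thesis .
    qed
    then show ?thesis using gG by (auto simp: fixed_by_rational_points_def flag_points_def LCOSETS_def)
  qed
  show ?thesis unfolding hB using tangent_sum_eq[OF h g1 rational] tangent_sum_eq[OF h g1 torus] by blast
qed

end
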